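(* Let $\varphi>\frac12$, let $\vartheta\in\mathbb N_+$ (a positive integer), let $g$ be analytic everywhere on $[-1,1]$, and let $u(x)=g(x)(1-x^2)^{\varphi}\ln^{\vartheta}(1-x^2)$ on $[-1,1]$, with $u(\pm1)=\lim_{x\to\pm1}u(x)=0$. Let $a_n,b_n,c_n$ be the coefficients of the infinite expansions of $u$ in the Chebyshev, difference and quadratic-factor bases, and truncate each of the three series to a polynomial of degree $N$: $$u_N(x)=\sum_{n=0}^Na_nT_n(x),\qquad u_N^{diff}(x)=\sum_{n=0}^{N-2}b_n\{T_{n+2}(x)-T_n(x)\},\qquad u_N^{quad}(x)=\sum_{n=0}^{N-2}c_n(1-x^2)T_n(x).$$ Then the errors of the truncated series in the $L_\infty$ norm satisfy the following. (i) For the Chebyshev series, $$E_N\equiv\max_{x\in[-1,1]}|u(x)-u_N(x)|\sim\mathcal O\big(|A(N)|/N^{2\varphi}\big),\qquad N\to\infty.$$ (ii) For the difference basis, $$E_N^{diff}\equiv\max_{x\in[-1,1]}|u(x)-u_N^{diff}(x)|\sim\mathcal O\big(|A(N)|/N^{2\varphi}\big),\qquad N\to\infty.$$ (iii) For the quadratic-factor basis, $$E_N^{quad}\equiv\max_{x\in[-1,1]}|u(x)-u_N^{quad}(x)|\sim\mathcal O\big(|A(N)|/N^{2\varphi-1}\big),\qquad N\to\infty.$$ Here $A(\cdot)$ is the slowly varying factor in the asymptotic law $a_n\sim A(n)/n^{2\varphi+1}$ of the Chebyshev coefficients of $u$, whose explicit expression is given in the context.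
   Context: $T_n$ is the Chebyshev polynomial of the first kind of degree $n$. The Chebyshev coefficients are $a_0=\frac1\pi\int_{-1}^1\frac{T_0(x)u(x)}{\sqrt{1-x^2}}dx$, $a_n=\frac2\pi\int_{-1}^1\frac{T_n(x)u(x)}{\sqrt{1-x^2}}dx$ $(n>0)$. The difference-basis coefficients $b_n$ in $u=\sum_{n\ge0}b_n(T_{n+2}-T_n)$ are given by $b_0=-a_0$, $b_1=-a_1$, $b_{n-2}-b_n=a_n$ $(n\ge2)$. The quadratic-factor coefficients $c_n$ in $u=\sum_{n\ge0}c_n(1-x^2)T_n$ are the Chebyshev coefficients of $v=u/(1-x^2)$. The factor $A(n)$ varies more slowly than a power of $n$ (such as a logarithm, or a constant): $A(n)=\mathcal O(\ln^{\vartheta-1}(n))$ when $\varphi\in\mathbb N$ and $A(n)=\mathcal O(\ln^{\vartheta}(n))$ when $\varphi\notin\mathbb N$. Put $\gamma_3=(-1)^ng(-1)+g(1)$, $\gamma_1=2\psi_0(2\varphi+1)-\psi_0(n-\varphi)-\psi_0(n+\varphi+1)$ and $\gamma_2=4\psi_1(2\varphi+1)+\psi_1(n-\varphi)-\psi_1(n+\varphi+1)$, where $\psi_0,\psi_1$ are the polygamma functions of order $0$ and $1$, $\Gamma$ is the Gamma function and $\mathrm B$ the Beta function. Then: for $\vartheta=1$, $A(n)=-\frac{2\Gamma(2\varphi+1)}{\pi}\gamma_3\{(\gamma_1-\ln2)\sin(\varphi\pi)+\pi\cos(\varphi\pi)\}$; for $\vartheta=2$, $A(n)=-\frac{2\Gamma(2\varphi+1)}{\pi}\gamma_3\{(\gamma_1^2+\gamma_2-2\ln(2)\gamma_1+\ln^2(2)-\pi^2)\sin(\varphi\pi)+2\pi(\gamma_1-\ln(2))\cos(\varphi\pi)\}$;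 and for general $\vartheta\in\mathbb N_+$, $$A(n)=-\frac2\pi\gamma_3\,n^{2\varphi+1}\sum_{k=0}^{\vartheta}\sum_{j=0}^{k}\binom kj\pi^j\sin\Big(\frac j2\pi+\varphi\pi\Big)\ln^{k-j}\Big(\frac12\Big)\frac{d^{\vartheta-k}}{d\varphi^{\vartheta-k}}\mathrm B(2\varphi+1,n-\varphi)\sim-\frac{2\Gamma(2\varphi+1)}{\pi}\gamma_3\big\{\ln^{\vartheta}(n)\sin(\varphi\pi)+\ln^{\vartheta-1}(n)\cos(\varphi\pi)\big\}.$$
   Formalization: The |A(N)| bounds are claimed as N→∞ through N with γ₃(N)≠0 (for g=1 and odd N, A(N)=0 but the errors are positive); for all N they are claimed with |A(N)| replaced by ln^{ϑ-1}N if φ∈ℕ and ln^ϑ N otherwise. *)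

theory Defs
  imports
    "HOL-Analysis.Analysis"
    "HOL-Computational_Algebra.Polynomial"
    "HOL-Library.Landau_Symbols"
begin

fun cheb_poly :: "nat \<Rightarrow> real poly" where
  "cheb_poly 0 = 1"
| "cheb_poly (Suc 0) = [:0, 1:]"
| "cheb_poly (Suc (Suc n)) = [:0, 2:] * cheb_poly (Suc n) - cheb_poly n"

abbreviation cheb_T :: "nat \<Rightarrow> real \<Rightarrow> real" where
  "cheb_T n x \<equiv> poly (cheb_poly n) x"

text \<open>
  The integrands below may be singular at the endpoints, where division by zero gives the
  irrelevant value 0. All functions are complex-valued so that real and complex \<open>g\<close> are
  covered alike.
\<close>

definition cheb_coeff :: "(real \<Rightarrow> complex) \<Rightarrow> nat \<Rightarrow> complex" where
  "cheb_coeff f n = (if n = 0 then 1 / of_real pi else 2 / of_real pi) *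
     integral {-1..1} (\<lambda>x. of_real (cheb_T n x) * f x / of_real (sqrt (1 - x\<^sup>2)))"

fun diff_coeff :: "(real \<Rightarrow> complex) \<Rightarrow> nat \<Rightarrow> complex" where
  "diff_coeff f 0 = - cheb_coeff f 0"
| "diff_coeff f (Suc 0) = - cheb_coeff f 1"
| "diff_coeff f (Suc (Suc n)) = diff_coeff f n - cheb_coeff f (n + 2)"

definition quad_coeff :: "(real \<Rightarrow> complex) \<Rightarrow> nat \<Rightarrow> complex" where
  "quad_coeff f n = cheb_coeff (\<lambda>x. f x / of_real (1 - x\<^sup>2)) n"

definition cheb_trunc :: "(real \<Rightarrow> complex) \<Rightarrow> nat \<Rightarrow> real \<Rightarrow> complex" where
  "cheb_trunc f N x = (\<Sum>n\<le>N. cheb_coeff f n * of_real (cheb_T n x))"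

text \<open>The index range \<open>n < N - 1\<close> is \<open>0 \<le> n \<le> N - 2\<close>, and empty for \<open>N < 2\<close>.\<close>

definition diff_trunc :: "(real \<Rightarrow> complex) \<Rightarrow> nat \<Rightarrow> real \<Rightarrow> complex" where
  "diff_trunc f N x =
     (\<Sum>n<N - 1. diff_coeff f n * of_real (cheb_T (n + 2) x - cheb_T n x))"

definition quad_trunc :: "(real \<Rightarrow> complex) \<Rightarrow> nat \<Rightarrow> real \<Rightarrow> complex" where
  "quad_trunc f N x =
     (\<Sum>n<N - 1. quad_coeff f n * of_real ((1 - x\<^sup>2) * cheb_T n x))"

text \<open>For continuous \<open>f\<close> and \<open>p\<close> the supremum is the maximum.\<close>

definition max_err :: "(real \<Rightarrow> complex) \<Rightarrow> (real \<Rightarrow> complex) \<Rightarrow> real" where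
  "max_err f p = (SUP x\<in>{-1..1}. cmod (f x - p x))"

definition gamma1 :: "real \<Rightarrow> nat \<Rightarrow> real" where
  "gamma1 \<phi> n = 2 * Digamma (2 * \<phi> + 1) - Digamma (real n - \<phi>) - Digamma (real n + \<phi> + 1)"

definition gamma2 :: "real \<Rightarrow> nat \<Rightarrow> real" where
  "gamma2 \<phi> n = 4 * Polygamma 1 (2 * \<phi> + 1) + Polygamma 1 (real n - \<phi>)
     - Polygamma 1 (real n + \<phi> + 1)"

definition gamma3 :: "(complex \<Rightarrow> complex) \<Rightarrow> nat \<Rightarrow> complex" where
  "gamma3 g n = (-1) ^ n * g (-1) + g 1"

definition factor_one :: "real \<Rightarrow> (complex \<Rightarrow> complex) \<Rightarrow> nat \<Rightarrow> complex" where
  "factor_one \<phi> g n = - of_real (2 * Gamma (2 * \<phi> + 1) / pi) * gamma3 g n *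
     of_real ((gamma1 \<phi> n - ln 2) * sin (\<phi> * pi) + pi * cos (\<phi> * pi))"

definition factor_two :: "real \<Rightarrow> (complex \<Rightarrow> complex) \<Rightarrow> nat \<Rightarrow> complex" where
  "factor_two \<phi> g n = - of_real (2 * Gamma (2 * \<phi> + 1) / pi) * gamma3 g n *
     of_real (((gamma1 \<phi> n)\<^sup>2 + gamma2 \<phi> n - 2 * ln 2 * gamma1 \<phi> n + (ln 2)\<^sup>2 - pi\<^sup>2)
                * sin (\<phi> * pi)
              + 2 * pi * (gamma1 \<phi> n - ln 2) * cos (\<phi> * pi))"

text \<open>
  The weight \<open>w\<close> allows for both forms of the general expression: \<open>w k = 1\<close>, and
  the Leibniz weight \<open>w k = \<theta> choose k\<close>, which is the one that reproduces
  the second-order expression \<^term>\<open>factor_two\<close> up to a factor tending to 1.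
\<close>

definition factor_gen ::
  "(nat \<Rightarrow> real) \<Rightarrow> real \<Rightarrow> nat \<Rightarrow> (complex \<Rightarrow> complex) \<Rightarrow> nat \<Rightarrow> complex" where
  "factor_gen w \<phi> \<theta> g n = - of_real (2 / pi) * gamma3 g n *
     of_real (real n powr (2 * \<phi> + 1) *
       (\<Sum>k\<le>\<theta>. w k * (\<Sum>j\<le>k. real (k choose j) * pi ^ j * sin (real j / 2 * pi + \<phi> * pi)
           * ln (1 / 2) ^ (k - j)
           * (deriv ^^ (\<theta> - k)) (\<lambda>t. Beta (2 * t + 1) (real n - t)) \<phi>)))"

definition is_slow_factor ::
  "real \<Rightarrow> nat \<Rightarrow> (complex \<Rightarrow> complex) \<Rightarrow> (nat \<Rightarrow> complex) \<Rightarrow> bool" where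
  "is_slow_factor \<phi> \<theta> g A \<longleftrightarrow>
     A = factor_gen (\<lambda>k. 1) \<phi> \<theta> g \<or>
     A = factor_gen (\<lambda>k. real (\<theta> choose k)) \<phi> \<theta> g \<or>
     (\<theta> = 1 \<and> A = factor_one \<phi> g) \<or>
     (\<theta> = 2 \<and> A = factor_two \<phi> g)"

text \<open>The size of the slowly varying factor, irrespective of the parity-dependent \<^const>\<open>gamma3\<close>.\<close>

definition log_order :: "real \<Rightarrow> nat \<Rightarrow> nat \<Rightarrow> real" where
  "log_order \<phi> \<theta> n = ln (real n) ^ (if \<phi> \<in> \<nat> then \<theta> - 1 else \<theta>)"

text \<open>
  \<open>N\<close> tends to infinity through those \<open>N\<close> for which \<open>gamma3 g N\<close> does not vanish;
  this is \<^const>\<open>sequentially\<close> unless \<open>g 1 = g (-1)\<close> or \<open>g 1 = - g (-1)\<close>. Where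
  \<open>gamma3 g N = 0\<close>, the factor is 0 while the truncation error in general is not: for
  \<open>g = 1\<close>, \<open>u\<close> is even and not a polynomial, and \<open>gamma3 g N = 0\<close> for all odd \<open>N\<close>.
\<close>

definition nondegenerate :: "(complex \<Rightarrow> complex) \<Rightarrow> nat filter" where
  "nondegenerate g = inf sequentially (principal {N. gamma3 g N \<noteq> 0})"

end

theory Submission
  imports Defs "HOL-Complex_Analysis.Complex_Analysis"
begin

text \<open>
  With \<open>x = cos t\<close> the Chebyshev coefficients become integrals of
  \<open>g (cos t) * sin t powr (2 * \<phi>) * (2 * ln (sin t)) ^ \<theta>\<close> against \<open>cos (n * t)\<close>. Pushing the two
  exponentials \<open>exp (\<plusminus> \<i> n t)\<close> into the upper and lower half plane leaves, up to an exponentially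
  small error, Laplace integrals along the vertical lines through \<open>0\<close> and \<open>\<pi>\<close>. The two half planes
  contribute the jump of the singular factor, which gives
  \<open>a\<^sub>n = O(ln\<^sup>\<kappa> n / n powr (2 * \<phi> + 1))\<close> with \<open>\<kappa> = \<theta> - 1\<close> if \<open>\<phi> \<in> \<nat>\<close> and \<open>\<kappa> = \<theta>\<close> otherwise.

  The error of the Chebyshev series is a tail sum of the \<open>a\<^sub>n\<close>. The two other truncations differ from
  a truncated Chebyshev series by finitely many boundary terms: with coefficients \<open>b\<^sub>N\<^sub>-\<^sub>1\<close>, \<open>b\<^sub>N\<close> for the
  difference basis, controlled by evaluating the truncated series at \<open>\<plusminus>1\<close>, and with coefficients
  \<open>c\<^sub>N\<^sub>-\<^sub>3\<close>, \<dots>, \<open>c\<^sub>N\<close> for the quadratic factor basis. There \<open>- 4 a\<^sub>n\<close> is a second difference of the \<open>c\<^sub>n\<close>,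
  which tend to \<open>0\<close> by the Riemann-Lebesgue lemma, so summing twice costs two powers of \<open>n\<close>.

  The lower bound for \<open>A\<close> follows from \<open>f' = f * \<gamma>\<close> for the Beta factor \<open>f\<close>: by the Leibniz rule the
  \<open>m\<close>-th derivative of \<open>f\<close> is asymptotic to \<open>(- 2 * ln n) ^ m * f\<close>.
\<close>

section \<open>Logarithmic power weights\<close>

text \<open>The coefficients and the factor \<open>A\<close> are estimated separately. The errors
  are bounded by the logarithmic order alone, and \<open>A\<close> enters only through
  \<open>c * log_order \<phi> \<theta> N \<le> norm (A N)\<close>. Hence a lower bound for
  \<open>A\<close> is the second half of the work, and it is restricted to the indices at which
  \<open>gamma3\<close> does not vanish. The obstacle in the contour shift is that \<open>g\<close>
  need not be real on [-1,1], so the lower half plane does not simply contribute the conjugate of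
  the upper one. It contributes the conjugate of what the upper half plane gives for the reflected
  function \<open>cnj (g (cnj z))\<close>. Conjugating restores \<open>g\<close> but conjugates the
  branch, and exactly the jump of the branch is left. The condition \<phi> > 1/2 acts twice. It
  makes u / (1 - x^2) integrable against the Chebyshev weight, since in the variable t the
  singularity is sin t to the power 2 \<phi> - 2 > -1 up to logarithms. It also makes the second
  summation for the c_n converge, whose terms decay like n to the power -2 \<phi> up to
  logarithms.\<close>

lemma one_plus_ln_power_le:
  fixes \<epsilon> :: real
  assumes "\<epsilon> > 0"
  obtains C where "C > 0" "\<And>r. r > 0 \<Longrightarrow> (1 + \<bar>ln r\<bar>) ^ k \<le> C * (r powr \<epsilon> + r powr (- \<epsilon>))"
proof -
  \<comment> \<open>\<open>\<delta> \<le> 1\<close> gives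
    \<open>\<delta> * (1 + y) \<le> 1 + \<delta> * y\<close>, and
    \<open>k * \<delta> \<le> \<epsilon>\<close> keeps the k-th power of
    \<open>exp (\<delta> * y)\<close> below \<open>exp (\<epsilon> * y)\<close>. Dividing by
    \<open>Suc k\<close> covers k = 0.\<close>
  define \<delta> where "\<delta> = min 1 (\<epsilon> / real (Suc k))"
  have \<delta>: "\<delta> > 0" "\<delta> \<le> 1" using assms by (auto simp: \<delta>_def)
  have "real k * \<delta> \<le> real (Suc k) * (\<epsilon> / real (Suc k))"
    using \<delta> by (intro mult_mono) (auto simp: \<delta>_def)
  then have k\<delta>: "real k * \<delta> \<le> \<epsilon>" by simp
  have *: "(1 + \<bar>ln r\<bar>) ^ k \<le> (1 / \<delta>) ^ k * (r powr \<epsilon> + r powr (- \<epsilon>))" if r: "r > 0" for r :: real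
  proof -
    define y where "y = \<bar>ln r\<bar>"
    have y: "y \<ge> 0" by (simp add: y_def)
    have "\<delta> * (1 + y) \<le> 1 + \<delta> * y" using \<delta> by (simp add: algebra_simps)
    also have "\<dots> \<le> exp (\<delta> * y)" by (rule exp_ge_add_one_self)
    finally have "1 + y \<le> (1 / \<delta>) * exp (\<delta> * y)" using \<delta> by (simp add: field_simps)
    then have "(1 + y) ^ k \<le> ((1 / \<delta>) * exp (\<delta> * y)) ^ k"
      using y by (intro power_mono) auto
    also have "\<dots> = (1 / \<delta>) ^ k * exp (real k * \<delta> * y)"
      by (simp only: power_mult_distrib exp_of_nat_mult mult.assoc)
    also have "\<dots> \<le> (1 / \<delta>) ^ k * exp (\<epsilon> * y)"
      using \<delta> y k\<delta> by (intro mult_left_mono) (auto intro!: mult_right_mono)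
    also have "exp (\<epsilon> * y) \<le> r powr \<epsilon> + r powr (- \<epsilon>)"
    proof (cases "ln r \<ge> 0")
      case True
      then have "exp (\<epsilon> * y) = r powr \<epsilon>" using r by (simp add: y_def powr_def)
      then show ?thesis by simp
    next
      case False
      then have "exp (\<epsilon> * y) = r powr (- \<epsilon>)" using r by (simp add: y_def powr_def)
      then show ?thesis by simp
    qed
    finally show ?thesis using \<delta> by (simp add: y_def)
  qed
  show ?thesis by (rule that[of "(1 / \<delta>) ^ k"]) (use \<delta> * in auto)
qed

text \<open>This is \<open>ln y \<le> y - 1\<close> at \<open>y = a * r / q\<close>. Equality holds
  at r = q / a, so the constant found is the maximum of
  \<open>r powr q * exp (- a * r)\<close>.\<close>

lemma powr_le_exp:
  fixes q a :: real
  assumes "q > 0" "a > 0"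
  obtains C where "C > 0" "\<And>r. r > 0 \<Longrightarrow> r powr q \<le> C * exp (a * r)"
proof
  fix r :: real assume r: "r > 0"
  have "ln (a / q * r) \<le> a / q * r - 1" using assms r by (intro ln_le_minus_one) auto
  then have "ln r \<le> a / q * r - 1 - ln (a / q)" using assms r by (simp add: ln_mult ln_div)
  then have "q * ln r \<le> q * (a / q * r - 1 - ln (a / q))" using assms by (intro mult_left_mono) auto
  also have "\<dots> = a * r + q * (- 1 - ln (a / q))" using assms by (simp add: field_simps)
  finally show "r powr q \<le> exp (q * (- 1 - ln (a / q))) * exp (a * r)"
    using r by (simp add: powr_def flip: exp_add)
qed simp

text \<open>The summand 1 keeps the weight positive at n = 1, so that estimates hold for all n >= 1
  and can be summed; \<open>log_weight_bigo\<close> removes it at the end.\<close>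

definition log_weight :: "real \<Rightarrow> nat \<Rightarrow> nat \<Rightarrow> real" where
  "log_weight p k n = (1 + ln (real n)) ^ k / real n powr p"

lemma log_weight_pos: "n \<ge> 1 \<Longrightarrow> log_weight p k n > 0"
  by (auto simp: log_weight_def intro!: divide_pos_pos zero_less_power add_pos_nonneg)

text \<open>Submultiplicativity of \<open>1 + ln\<close>: a rescaling of the index can be split off
  as a factor.\<close>

lemma one_plus_ln_mult_le:
  fixes x y :: real
  assumes "x \<ge> 1" "y \<ge> 1"
  shows "1 + ln (x * y) \<le> (1 + ln x) * (1 + ln y)"
proof -
  have "0 \<le> ln x * ln y" using assms by simp
  then show ?thesis using assms by (simp add: ln_mult algebra_simps)
qed

lemma log_weight_shift_le:
  assumes "p \<ge> 0" "n \<ge> 1"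
  shows "log_weight p k (n + j) \<le> (1 + ln (1 + real j)) ^ k * log_weight p k n"
proof -
  have "real (n + j) \<le> real n * (1 + real j)" 
    using assms mult_right_mono[of 1 "real n" "real j"] by (simp add: algebra_simps)
  then have "1 + ln (real (n + j)) \<le> 1 + ln (real n * (1 + real j))"
    using assms by (intro add_left_mono ln_mono) auto
  also have "\<dots> \<le> (1 + ln (real n)) * (1 + ln (1 + real j))"
    using assms by (intro one_plus_ln_mult_le) auto
  finally have "(1 + ln (real (n + j))) ^ k \<le> ((1 + ln (real n)) * (1 + ln (1 + real j))) ^ k"
    using assms by (intro power_mono) auto
  moreover have "real n powr p \<le> real (n + j) powr p"
    using assms by (intro powr_mono2) auto
  ultimately have "log_weight p k (n + j) \<le> ((1 + ln (real n)) * (1 + ln (1 + real j))) ^ k / real n powr p"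
    unfolding log_weight_def using assms by (intro frac_le) auto
  then show ?thesis by (simp add: log_weight_def power_mult_distrib mult_ac)
qed

text \<open>Together with the preceding bound: a fixed shift j of the index costs only a constant in
  either direction. Forward the logarithm is responsible, backward the power.\<close>

lemma log_weight_le_shift:
  assumes "p \<ge> 0" "n \<ge> 1"
  shows "log_weight p k n \<le> (1 + real j) powr p * log_weight p k (n + j)"
proof -
  have "real (n + j) \<le> (1 + real j) * real n" 
    using assms mult_right_mono[of 1 "real n" "real j"] by (simp add: algebra_simps)
  then have "real (n + j) powr p \<le> ((1 + real j) * real n) powr p"
    using assms by (intro powr_mono2) auto
  then have *: "real (n + j) powr p \<le> (1 + real j) powr p * real n powr p"
    by (simp add: powr_mult)
  have "(1 + ln (real n)) ^ k \<le> (1 + ln (real (n + j))) ^ k"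
    using assms by (intro power_mono) auto
  then have "log_weight p k n \<le> (1 + ln (real (n + j))) ^ k / real n powr p"
    unfolding log_weight_def by (intro divide_right_mono) auto
  also have "\<dots> \<le> (1 + ln (real (n + j))) ^ k * ((1 + real j) powr p / real (n + j) powr p)"
  proof -
    have "1 / real n powr p \<le> (1 + real j) powr p / real (n + j) powr p"
      using * assms by (simp add: field_simps)
    then have "(1 + ln (real (n + j))) ^ k * (1 / real n powr p) \<le> (1 + ln (real (n + j))) ^ k * ((1 + real j) powr p / real (n + j) powr p)"
      using assms by (intro mult_left_mono) auto
    then show ?thesis by simp
  qed
  finally show ?thesis by (simp add: log_weight_def mult_ac)
qed

lemma powr_tail_step:
  fixes q :: real
  assumes "q > 0" "n \<ge> 1"
  shows "q * real (Suc n) powr (- q - 1) \<le> real n powr (- q) - real (Suc n) powr (- q)"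
proof -
  have "\<exists>z. z > real n \<and> z < real (Suc n) \<and> real (Suc n) powr (- q) - real n powr (- q) = (real (Suc n) - real n) * (- q * z powr (- q - 1))"
    using assms by (intro MVT2) (auto intro!: derivative_eq_intros)
  then obtain z where z: "z > real n" "z < real (Suc n)"
    "real (Suc n) powr (- q) - real n powr (- q) = - q * z powr (- q - 1)" by auto
  have "real (Suc n) powr (- q - 1) \<le> z powr (- q - 1)"
    using z assms by (intro powr_mono2') auto
  then have "q * real (Suc n) powr (- q - 1) \<le> q * z powr (- q - 1)"
    using assms by (intro mult_left_mono) auto
  then show ?thesis using z(3) by linarith
qed

text \<open>A comparison with the integral of \<open>x powr (- q - 1)\<close>, carried out by
  telescoping the differences of \<open>n powr (- q)\<close>.\<close>

lemma sum_powr_tail_le: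
  fixes q :: real
  assumes "q > 0" "N \<ge> 1"
  shows "(\<Sum>n\<in>{N<..M}. real n powr (- q - 1)) \<le> real N powr (- q) / q"
proof -
  \<comment> \<open>The subtracted term makes the induction close; it is dropped afterwards.\<close>
  have *: "q * (\<Sum>n\<in>{N<..N + d}. real n powr (- q - 1)) \<le> real N powr (- q) - real (N + d) powr (- q)" for d
  proof (induction d)
    case (Suc d)
    have "{N<..N + Suc d} = insert (Suc (N + d)) {N<..N + d}" by auto
    then have "q * (\<Sum>n\<in>{N<..N + Suc d}. real n powr (- q - 1)) =
       q * real (Suc (N + d)) powr (- q - 1) + q * (\<Sum>n\<in>{N<..N + d}. real n powr (- q - 1))"
      by (simp add: algebra_simps)
    also have "\<dots> \<le> real (N + d) powr (- q) - real (Suc (N + d)) powr (- q) + (real N powr (- q) - real (N + d) powr (- q))"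
      using assms by (intro add_mono Suc.IH powr_tail_step) auto
    finally show ?case by simp
  qed simp
  show ?thesis
  proof (cases "M \<ge> N")
    case True
    have "q * (\<Sum>n\<in>{N<..M}. real n powr (- q - 1)) \<le> real N powr (- q)"
      using *[of "M - N"] True by (smt (verit) le_add_diff_inverse powr_ge_zero)
    then show ?thesis using assms by (simp add: field_simps)
  next
    case False
    then show ?thesis using assms by simp
  qed
qed

text \<open>With n = N r the logarithms split into one factor in N and one in r. Half of the
  exponent p is spent on absorbing the powers of \<open>1 + ln r\<close>; the remaining exponent p/2
  + 1 is still summable, and the tail returns the missing p/2 as a power of N.\<close>

lemma log_weight_tail:
  assumes p: "p > 0"
  obtains C where "C > 0"
    "\<And>N M. N \<ge> 1 \<Longrightarrow> (\<Sum>n\<in>{N<..M}. log_weight (p + 1) k n) \<le> C * log_weight p k N"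
proof -
  obtain C where C: "C > 0" "\<And>r. r > 0 \<Longrightarrow> (1 + \<bar>ln r\<bar>) ^ k \<le> C * (r powr (p/2) + r powr (- (p/2)))"
    using one_plus_ln_power_le[of "p/2" k] p by auto
  have *: "log_weight (p + 1) k n \<le> 2 * C * ((1 + ln (real N)) ^ k / real N powr (p/2)) * real n powr (- (p/2) - 1)"
    if n: "N \<ge> 1" "N \<le> n" for N n :: nat
  proof -
    define r where "r = real n / real N"
    have r: "r \<ge> 1" using n by (simp add: r_def)
    have nr: "real n = real N * r" using n by (simp add: r_def)
    have "(1 + ln (real n)) ^ k \<le> ((1 + ln (real N)) * (1 + ln r)) ^ k"
      unfolding nr using n r
      by (intro power_mono one_plus_ln_mult_le) (auto simp: ln_mult)
    also have "\<dots> = (1 + ln (real N)) ^ k * (1 + \<bar>ln r\<bar>) ^ k" using r by (simp add: power_mult_distrib)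
    also have "\<dots> \<le> (1 + ln (real N)) ^ k * (C * (r powr (p/2) + r powr (- (p/2))))"
      using n r C(2)[of r] by (intro mult_left_mono) auto
    also have "\<dots> \<le> (1 + ln (real N)) ^ k * (C * (r powr (p/2) + r powr (p/2)))"
      using n r C p by (intro mult_left_mono add_left_mono powr_mono) auto
    also have "\<dots> = (1 + ln (real N)) ^ k * (2 * C) * r powr (p/2)" by simp
    finally have "log_weight (p + 1) k n \<le> (1 + ln (real N)) ^ k * (2 * C) * r powr (p/2) / real n powr (p + 1)"
      unfolding log_weight_def by (intro divide_right_mono) auto
    also have "r powr (p/2) / real n powr (p + 1) = real n powr (- (p/2) - 1) / real N powr (p/2)"
    proof -
      have "real n powr (p + 1) = real n powr (p/2) * real n powr (p/2 + 1)" by (simp flip: powr_add)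
      moreover have "real n powr (- (p/2) - 1) = 1 / real n powr (p/2 + 1)"
        using powr_minus_divide[of "real n" "p/2+1"] by simp
      ultimately show ?thesis using n by (simp add: r_def powr_divide field_simps)
    qed
    then have "(1 + ln (real N)) ^ k * (2 * C) * r powr (p/2) / real n powr (p + 1) =
       (1 + ln (real N)) ^ k * (2 * C) * (real n powr (- (p/2) - 1) / real N powr (p/2))"
      by (metis times_divide_eq_right)
    finally show ?thesis by (simp add: mult_ac)
  qed
  show ?thesis
  proof (rule that[of "2 * C * (2 / p)"])
    show "2 * C * (2 / p) > 0" using C p by simp
    fix N M :: nat assume N: "N \<ge> 1"
    have "(\<Sum>n\<in>{N<..M}. log_weight (p + 1) k n) \<le>
      (\<Sum>n\<in>{N<..M}. 2 * C * ((1 + ln (real N)) ^ k / real N powr (p/2)) * real n powr (- (p/2) - 1))"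
      using N by (intro sum_mono *) auto
    also have "\<dots> = 2 * C * ((1 + ln (real N)) ^ k / real N powr (p/2)) * (\<Sum>n\<in>{N<..M}. real n powr (- (p/2) - 1))"
      by (simp add: sum_distrib_left)
    also have "\<dots> \<le> 2 * C * ((1 + ln (real N)) ^ k / real N powr (p/2)) * (real N powr (- (p/2)) / (p/2))"
      using N C p by (intro mult_left_mono sum_powr_tail_le) auto
    also have "\<dots> = 2 * C * (2 / p) * log_weight p k N"
    proof -
      have "real N powr p = real N powr (p/2) * real N powr (p/2)" by (simp flip: powr_add)
      then show ?thesis using N by (simp add: log_weight_def powr_minus_divide field_simps)
    qed
    finally show "(\<Sum>n\<in>{N<..M}. log_weight (p + 1) k n) \<le> 2 * C * (2 / p) * log_weight p k N" .
  qed
qed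

text \<open>The substitution r = n s separates the powers and logarithms of n from a function of r
  alone. Half of the exponential pays for that function; the other half is kept because its integral
  over s supplies a further factor of order 1/n.\<close>

lemma laplace_log_integrand_le:
  assumes q: "q > 0"
  obtains C where "C > 0"
    "\<And>n s. n \<ge> 1 \<Longrightarrow> s > 0 \<Longrightarrow>
       exp (- (real n * s)) * s powr q * (1 + \<bar>ln s\<bar>) ^ k \<le> C * log_weight q k n * exp (- (real n * s / 2))"
proof -
  \<comment> \<open>With exponent q the negative power cancels against \<open>r powr q\<close>, so
    nothing singular at r = 0 remains.\<close>
  obtain C where C: "C > 0" "\<And>r. r > 0 \<Longrightarrow> (1 + \<bar>ln r\<bar>) ^ k \<le> C * (r powr q + r powr (- q))"
    using one_plus_ln_power_le[of q k] q by auto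
  obtain D where D: "D > 0" "\<And>r. r > 0 \<Longrightarrow> r powr (2 * q) \<le> D * exp (1/2 * r)"
    using powr_le_exp[of "2 * q" "1/2"] q by auto
  have *: "exp (- r) * r powr q * (1 + \<bar>ln r\<bar>) ^ k \<le> C * (D + 1) * exp (- (r / 2))" if r: "r > 0" for r
  proof -
    have "exp (- r) * r powr q * (1 + \<bar>ln r\<bar>) ^ k \<le> exp (- r) * r powr q * (C * (r powr q + r powr (- q)))"
      using r C by (intro mult_left_mono) auto
    also have "\<dots> = C * exp (- r) * (r powr (2 * q) + 1)"
    proof -
      have "r powr q * r powr q = r powr (2*q)" "r powr q * r powr (-q) = 1"
        using r by (simp_all flip: powr_add)
      then have "r powr q * (r powr q + r powr (- q)) = r powr (2 * q) + 1"
        by (simp add: algebra_simps)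
      then have "exp (- r) * C * (r powr q * (r powr q + r powr (- q))) = exp (- r) * C * (r powr (2 * q) + 1)"
        by simp
      then show ?thesis by (simp add: mult_ac)
    qed
    also have "\<dots> \<le> C * exp (- r) * (D * exp (1/2 * r) + exp (1/2 * r))"
      using C D r by (intro mult_left_mono add_mono) auto
    also have "\<dots> = C * (D + 1) * (exp (- r) * exp (1/2 * r))" by (simp add: algebra_simps)
    also have "exp (- r) * exp (1/2 * r) = exp (- (r / 2))" by (simp flip: exp_add)
    finally show ?thesis .
  qed
  show ?thesis
  proof (rule that[of "C * (D + 1)"])
    show "C * (D + 1) > 0" using C D by (simp add: add_pos_pos)
    fix n :: nat and s :: real assume n: "n \<ge> 1" and s: "s > 0"
    define r where "r = real n * s"
    have r: "r > 0" using n s by (simp add: r_def)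
    have sr: "s = r / real n" using n by (simp add: r_def)
    have "1 + \<bar>ln s\<bar> \<le> 1 + (\<bar>ln r\<bar> + ln (real n))"
      using n r by (simp add: sr ln_div) (use abs_triangle_ineq4[of "ln r" "ln (real n)"] in simp)
    also have "\<dots> \<le> (1 + ln (real n)) * (1 + \<bar>ln r\<bar>)"
      using n by (simp add: algebra_simps)
    finally have "(1 + \<bar>ln s\<bar>) ^ k \<le> ((1 + ln (real n)) * (1 + \<bar>ln r\<bar>)) ^ k"
      by (intro power_mono) auto
    then have "exp (- r) * s powr q * (1 + \<bar>ln s\<bar>) ^ k \<le> exp (- r) * s powr q * ((1 + ln (real n)) * (1 + \<bar>ln r\<bar>)) ^ k"
      by (intro mult_left_mono) auto
    also have "\<dots> = log_weight q k n * (exp (- r) * r powr q * (1 + \<bar>ln r\<bar>) ^ k)"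
      using n r by (simp add: sr log_weight_def power_mult_distrib powr_divide mult_ac)
    also have "\<dots> \<le> log_weight q k n * (C * (D + 1) * exp (- (r / 2)))"
      using n r by (intro mult_left_mono * less_imp_le[OF log_weight_pos]) auto
    finally show "exp (- (real n * s)) * s powr q * (1 + \<bar>ln s\<bar>) ^ k \<le> C * (D + 1) * log_weight q k n * exp (- (real n * s / 2))"
      by (simp add: r_def mult_ac)
  qed
qed

text \<open>From n = 3 on one has \<open>1 \<le> ln n\<close>, hence
  \<open>1 + ln n \<le> 2 * ln n\<close>; this is the origin of \<open>2 ^ k\<close>. The sign of C
  is left open, hence the absolute value.\<close>

lemma log_weight_bigo:
  assumes "\<And>n. n \<ge> N0 \<Longrightarrow> \<bar>f n\<bar> \<le> C * log_weight p k n"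
  shows "f \<in> O(\<lambda>n. ln (real n) ^ k / real n powr p)"
proof (rule bigoI[where c = "\<bar>C\<bar> * 2 ^ k"])
  show "\<forall>\<^sub>F n in sequentially. norm (f n) \<le> \<bar>C\<bar> * 2 ^ k * norm (ln (real n) ^ k / real n powr p)"
    using eventually_ge_at_top[of "max 3 N0"]
  proof eventually_elim
    fix n :: nat assume n: "max 3 N0 \<le> n"
    have "exp 1 \<le> real n" using exp_le n by simp
    then have "1 \<le> ln (real n)" using n by (simp add: ln_ge_iff)
    then have "(1 + ln (real n)) ^ k \<le> (2 * ln (real n)) ^ k" by (intro power_mono) auto
    then have "log_weight p k n \<le> 2 ^ k * (ln (real n) ^ k / real n powr p)"
      using n by (simp add: log_weight_def power_mult_distrib divide_right_mono)
    then have "\<bar>C\<bar> * log_weight p k n \<le> \<bar>C\<bar> * (2 ^ k * (ln (real n) ^ k / real n powr p))"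
      by (intro mult_left_mono) auto
    moreover have "\<bar>f n\<bar> \<le> \<bar>C\<bar> * log_weight p k n"
    proof -
      have "\<bar>f n\<bar> \<le> C * log_weight p k n" using n by (intro assms) auto
      also have "\<dots> \<le> \<bar>C\<bar> * log_weight p k n"
        using log_weight_pos[of n p k] n by (intro mult_right_mono) auto
      finally show ?thesis .
    qed
    ultimately show "norm (f n) \<le> \<bar>C\<bar> * 2 ^ k * norm (ln (real n) ^ k / real n powr p)"
      using \<open>1 \<le> ln (real n)\<close> by (simp add: mult_ac)
  qed
qed

text \<open>Since x tends to 0, each x n is the limit of its telescoping sums, and the bound becomes
  a tail of the weights. The step 2 matches the recurrences of the expansions, which couple indices
  of equal parity only.\<close>

lemma norm_le_if_diff_le:
  fixes x :: "nat \<Rightarrow> complex"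
  assumes "p > 0" "x \<longlonglongrightarrow> 0" "1 \<le> n0"
    and "\<And>n. n \<ge> n0 \<Longrightarrow> norm (x n - x (n + 2)) \<le> C * log_weight (p + 1) k n"
  obtains D where "D > 0" "\<And>n. n \<ge> n0 \<Longrightarrow> norm (x n) \<le> D * log_weight p k n"
proof -
  obtain B where B: "B > 0"
    "\<And>N M. N \<ge> 1 \<Longrightarrow> (\<Sum>n\<in>{N<..M}. log_weight (p + 1) k n) \<le> B * log_weight p k N"
    using log_weight_tail[OF assms(1)] by blast
  define C' where "C' = \<bar>C\<bar> + 1"
  have C': "C' > 0" "C' \<ge> C" by (auto simp: C'_def)
  have le: "norm (x n) \<le> C' * (1 + B) * log_weight p k n" if n: "n \<ge> n0" for n
  proof -
    have diff: "norm (x n - x (n + 2 * m)) \<le> C' * (\<Sum>j\<in>{n..<n + 2 * m}. log_weight (p + 1) k j)" for m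
    proof (induction m)
      case (Suc m)
      have "norm (x n - x (n + 2 * Suc m)) \<le> norm (x n - x (n + 2 * m)) + norm (x (n + 2 * m) - x (n + 2 * m + 2))"
        by (rule order.trans[OF _ norm_triangle_ineq]) (simp add: algebra_simps)
      also have "\<dots> \<le> C' * (\<Sum>j\<in>{n..<n + 2 * m}. log_weight (p + 1) k j) + C * log_weight (p + 1) k (n + 2 * m)"
        using n by (intro add_mono Suc.IH assms) auto
      \<comment> \<open>The weight at the skipped index is added, so that the bound becomes a sum
        over consecutive indices.\<close>
      also have "\<dots> \<le> C' * (\<Sum>j\<in>{n..<n + 2 * m}. log_weight (p + 1) k j)
          + C' * (log_weight (p + 1) k (n + 2 * m) + log_weight (p + 1) k (n + 2 * m + 1))"
      proof -
        have *: "log_weight (p + 1) k (n + 2 * m) > 0" "log_weight (p + 1) k (n + 2 * m + 1) > 0"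
          using n assms(3) by (auto intro!: log_weight_pos)
        have "C * log_weight (p + 1) k (n + 2 * m) \<le> C' * log_weight (p + 1) k (n + 2 * m)"
          using C' * by (intro mult_right_mono) auto
        also have "\<dots> \<le> C' * (log_weight (p + 1) k (n + 2 * m) + log_weight (p + 1) k (n + 2 * m + 1))"
          using C' * by (intro mult_left_mono) auto
        finally show ?thesis by simp
      qed
      also have "\<dots> = C' * (\<Sum>j\<in>{n..<n + 2 * Suc m}. log_weight (p + 1) k j)"
        by (simp add: algebra_simps)
      finally show ?case .
    qed simp
    have bound: "(\<Sum>j\<in>{n..<n + 2 * m}. log_weight (p + 1) k j) \<le> (1 + B) * log_weight p k n" for m
    proof -
      have pos: "log_weight p k n > 0" using n assms(3) by (intro log_weight_pos) auto
      have "(\<Sum>j\<in>{n..<n + 2 * m}. log_weight (p + 1) k j) \<le> (\<Sum>j\<in>insert n {n<..n + 2 * m}. log_weight (p + 1) k j)"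
        using n assms(3) by (intro sum_mono2) (auto intro!: less_imp_le[OF log_weight_pos])
      also have "\<dots> = log_weight (p + 1) k n + (\<Sum>j\<in>{n<..n + 2 * m}. log_weight (p + 1) k j)" by simp
      also have "\<dots> \<le> log_weight p k n + B * log_weight p k n"
      proof (intro add_mono B)
        show "log_weight (p + 1) k n \<le> log_weight p k n"
          unfolding log_weight_def using n assms(1,3)
          by (intro divide_left_mono powr_mono) auto
      qed (use n assms(3) in auto)
      finally show ?thesis by (simp add: algebra_simps)
    qed
    have "(\<lambda>m. x (n + 2 * m)) \<longlonglongrightarrow> 0"
      by (rule filterlim_compose[OF assms(2)]) (auto intro!: filterlim_subseq simp: strict_mono_def)
    then have "(\<lambda>m. norm (x n - x (n + 2 * m))) \<longlonglongrightarrow> norm (x n - 0)"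
      by (intro tendsto_intros)
    then have "norm (x n - 0) \<le> C' * ((1 + B) * log_weight p k n)"
    proof (rule tendsto_upperbound)
      show "\<forall>\<^sub>F m in sequentially. norm (x n - x (n + 2 * m)) \<le> C' * ((1 + B) * log_weight p k n)"
        by (intro always_eventually allI order.trans[OF diff] mult_left_mono bound) (use C' in auto)
    qed simp
    then show ?thesis by simp
  qed
  show ?thesis by (rule that[of "C' * (1 + B)"]) (use le C' B in auto)
qed

section \<open>Chebyshev coefficients as cosine integrals\<close>

lemma cheb_T_cos: "cheb_T n (cos t) = cos (real n * t)"
proof (induction n rule: cheb_poly.induct)
  case (3 n)
  have "cos (real (Suc (Suc n)) * t) = 2 * cos t * cos (real (Suc n) * t) - cos (real n * t)"
  proof -
    have "real (Suc (Suc n)) * t = real (Suc n) * t + t" "real n * t = real (Suc n) * t - t"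
      by (simp_all add: algebra_simps)
    then show ?thesis by (simp only: cos_add cos_diff) (simp add: algebra_simps)
  qed
  then show ?case using 3 by simp
qed auto

lemma abs_cheb_T_le_1: "x \<in> {-1..1} \<Longrightarrow> \<bar>cheb_T n x\<bar> \<le> 1"
  using cheb_T_cos[of n "arccos x"] by (simp add: cos_arccos)

lemma cheb_T_1: "cheb_T n 1 = 1" and cheb_T_minus_1: "cheb_T n (-1) = (-1) ^ n"
  using cheb_T_cos[of n 0] cheb_T_cos[of n pi] by simp_all

text \<open>The Jacobian \<open>\<bar>- sin t\<bar>\<close> cancels the weight only for 0 < t < pi;
  at the endpoints the quotient has the default value 0. The substitution is therefore made on the
  open interval, and both integrals are then extended by null sets. The change of variables theorem
  transfers integrability together with the value.\<close>

lemma integral_arccos_substitution: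
  fixes f :: "real \<Rightarrow> complex"
  assumes "(\<lambda>t. f (cos t)) absolutely_integrable_on {0..pi}"
  shows "integral {-1..1} (\<lambda>x. f x / of_real (sqrt (1 - x\<^sup>2))) = integral {0..pi} (\<lambda>t. f (cos t))"
proof -
  have eq: "\<bar>- sin t\<bar> *\<^sub>R (f (cos t) / of_real (sqrt (1 - (cos t)\<^sup>2))) = f (cos t)" if "t \<in> {0<..<pi}" for t
  proof -
    have "sin t > 0" using that sin_gt_zero by auto
    moreover have "sqrt (1 - (cos t)\<^sup>2) = \<bar>sin t\<bar>" by (simp add: sin_squared_eq[symmetric])
    ultimately show ?thesis by (simp add: scaleR_conv_of_real)
  qed
  have img: "cos ` {0<..<pi} = {-1<..<1::real}"
  proof
    show "{-1<..<1} \<subseteq> cos ` {0<..<pi}"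
    proof
      fix x :: real assume "x \<in> {-1<..<1}"
      then have "cos (arccos x) = x" "0 < arccos x" "arccos x < pi"
        by (auto simp: cos_arccos arccos_lt_bounded)
      then show "x \<in> cos ` {0<..<pi}" by (metis greaterThanLessThan_iff imageI)
    qed
  qed (auto intro!: cos_monotone_0_pi[of 0, simplified] simp: cos_monotone_0_pi[of _ pi, simplified])
  have ai: "(\<lambda>t. f (cos t)) absolutely_integrable_on {0<..<pi}"
    by (rule absolutely_integrable_spike_set[OF assms]) (auto intro: negligible_subset[of "{0,pi}"])
  have *: "(\<lambda>t. \<bar>- sin t\<bar> *\<^sub>R (f (cos t) / of_real (sqrt (1 - (cos t)\<^sup>2)))) absolutely_integrable_on {0<..<pi} \<and>
    integral {0<..<pi} (\<lambda>t. \<bar>- sin t\<bar> *\<^sub>R (f (cos t) / of_real (sqrt (1 - (cos t)\<^sup>2)))) = b \<longleftrightarrow>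
    (\<lambda>x. f x / of_real (sqrt (1 - x\<^sup>2))) absolutely_integrable_on (cos ` {0<..<pi}) \<and>
    integral (cos ` {0<..<pi}) (\<lambda>x. f x / of_real (sqrt (1 - x\<^sup>2))) = b" for b
    by (rule has_absolute_integral_change_of_variables_real)
       (auto intro!: derivative_eq_intros inj_onI intro: cos_inj_pi)
  have "(\<lambda>t. \<bar>- sin t\<bar> *\<^sub>R (f (cos t) / of_real (sqrt (1 - (cos t)\<^sup>2)))) absolutely_integrable_on {0<..<pi}"
    using absolutely_integrable_spike[OF ai, of "{}"] eq by auto
  moreover have "integral {0<..<pi} (\<lambda>t. \<bar>- sin t\<bar> *\<^sub>R (f (cos t) / of_real (sqrt (1 - (cos t)\<^sup>2)))) = integral {0<..<pi} (\<lambda>t. f (cos t))"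
    by (intro integral_cong eq)
  ultimately have **: "(\<lambda>x. f x / of_real (sqrt (1 - x\<^sup>2))) absolutely_integrable_on {-1<..<1} \<and>
    integral {-1<..<1} (\<lambda>x. f x / of_real (sqrt (1 - x\<^sup>2))) = integral {0<..<pi} (\<lambda>t. f (cos t))"
    using *[of "integral {0<..<pi} (\<lambda>t. f (cos t))"] unfolding img by blast
  have neg: "negligible ({-1..1::real} - {-1<..<1})" "negligible ({0..pi} - {0<..<pi})"
    by (auto intro: negligible_subset[of "{-1,1}"] negligible_subset[of "{0,pi}"])
  have "integral {-1..1} (\<lambda>x. f x / of_real (sqrt (1 - x\<^sup>2))) = integral {-1<..<1} (\<lambda>x. f x / of_real (sqrt (1 - x\<^sup>2)))"
    by (rule integral_subset_negligible[symmetric]) (use neg in auto)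
  also have "\<dots> = integral {0<..<pi} (\<lambda>t. f (cos t))" using ** by simp
  also have "\<dots> = integral {0..pi} (\<lambda>t. f (cos t))"
    by (rule integral_subset_negligible) (use neg in auto)
  finally show "integral {-1..1} (\<lambda>x. f x / of_real (sqrt (1 - x\<^sup>2))) = integral {0..pi} (\<lambda>t. f (cos t))" .
qed

lemma absolutely_integrable_cos_mult:
  fixes f :: "real \<Rightarrow> complex"
  assumes "f absolutely_integrable_on {0..pi}"
  shows "(\<lambda>t. of_real (cos (a * t)) * f t) absolutely_integrable_on {0..pi}"
proof -
  have "(\<lambda>t. cos (a * t) *\<^sub>R f t) absolutely_integrable_on {0..pi}"
  proof (rule absolutely_integrable_bounded_measurable_product[where h = "(*\<^sub>R)" and f = "\<lambda>t. cos (a * t)" and g = f])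
    show "bilinear ((*\<^sub>R) :: real \<Rightarrow> complex \<Rightarrow> complex)"
      using bilinear_conv_bounded_bilinear bounded_bilinear_scaleR by blast
    show "(\<lambda>t. cos (a * t)) \<in> borel_measurable (lebesgue_on {0..pi})"
      by (intro continuous_imp_measurable_on_sets_lebesgue continuous_intros) auto
    show "bounded ((\<lambda>t. cos (a * t)) ` {0..pi})"
      by (rule boundedI[of _ 1]) auto
  qed (use assms in auto)
  then show ?thesis by (simp add: scaleR_conv_of_real)
qed

lemma cheb_coeff_eq_cos_integral:
  assumes "(\<lambda>t. f (cos t)) absolutely_integrable_on {0..pi}"
  shows "cheb_coeff f n = (if n = 0 then 1 / of_real pi else 2 / of_real pi) *
    integral {0..pi} (\<lambda>t. of_real (cos (real n * t)) * f (cos t))"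
  using integral_arccos_substitution[of "\<lambda>x. of_real (cheb_T n x) * f x"]
    absolutely_integrable_cos_mult[OF assms, of "real n"]
  by (simp add: cheb_coeff_def cheb_T_cos)

section \<open>Orthogonality and completeness of the cosines on [0, pi]\<close>

lemma integral_cos_nat_mult:
  "integral {0..pi} (\<lambda>t. cos (real n * t)) = (if n = 0 then pi else 0)"
proof (cases "n = 0")
  case False
  have "((\<lambda>t. cos (real n * t)) has_integral (sin (real n * pi) / real n - sin (real n * 0) / real n)) {0..pi}"
    using False by (intro fundamental_theorem_of_calculus)
      (auto intro!: derivative_eq_intros simp flip: has_real_derivative_iff_has_vector_derivative)
  then show ?thesis using False by (simp add: integral_unique)
qed simp

text \<open>The second index is |n - 1|: cosine is even, so n = 0 folds back to 1.\<close>

lemma cos_mult_cos_nat: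
  "cos t * cos (real n * t) = (cos (real (n + 1) * t) + cos (real (if n = 0 then 1 else n - 1) * t)) / 2"
proof (cases n)
  case (Suc m)
  have e: "real (n + 1) * t = real n * t + t" "real (n - 1) * t = real n * t - t"
    using Suc by (simp_all add: algebra_simps)
  then show ?thesis using Suc by (simp only: cos_add cos_diff e if_False nat.distinct) simp
qed simp

text \<open>Each factor cos t moves the index by one in either direction, so m factors cannot bring
  n > m down to 0, the only index with nonzero integral.\<close>

lemma integral_cos_power_eq_0:
  assumes "m < n"
  shows "integral {0..pi} (\<lambda>t. cos (real n * t) * cos t ^ m) = 0"
  using assms
proof (induction m arbitrary: n)
  case 0
  then show ?case by (simp add: integral_cos_nat_mult)
next
  case (Suc m)
  have "cos (real n * t) * cos t ^ Suc m =
     (cos (real (n + 1) * t) * cos t ^ m) / 2 + (cos (real (n - 1) * t) * cos t ^ m) / 2" for t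
  proof -
    have "cos (real n * t) * cos t ^ Suc m = (cos t * cos (real n * t)) * cos t ^ m" by simp
    then show ?thesis using Suc.prems
      by (simp only: cos_mult_cos_nat) (simp add: algebra_simps add_divide_distrib)
  qed
  then have "integral {0..pi} (\<lambda>t. cos (real n * t) * cos t ^ Suc m) =
     integral {0..pi} (\<lambda>t. (cos (real (n + 1) * t) * cos t ^ m) / 2 + (cos (real (n - 1) * t) * cos t ^ m) / 2)"
    by simp
  also have "\<dots> = integral {0..pi} (\<lambda>t. (cos (real (n + 1) * t) * cos t ^ m) / 2) + 
      integral {0..pi} (\<lambda>t. (cos (real (n - 1) * t) * cos t ^ m) / 2)"
    by (intro integral_add integrable_continuous_real continuous_intros) auto
  also have "\<dots> = 0" using Suc.IH[of "n + 1"] Suc.IH[of "n - 1"] Suc.prems by simp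
  finally show ?case .
qed

text \<open>Prepares the completeness argument: w becomes orthogonal to all polynomials in cos t. As
  multiplication by cos t shifts the index, the induction treats all n at once.\<close>

lemma integral_mult_polynomial_eq_0:
  assumes w: "continuous_on {0..pi} w"
    and "\<And>n. integral {0..pi} (\<lambda>t. cos (real n * t) * w t) = (0::real)"
  shows "integral {0..pi} (\<lambda>t. cos (real n * t) * w t * cos t ^ m) = 0"
proof (induction m arbitrary: n)
  case 0
  then show ?case using assms by simp
next
  case (Suc m)
  define n' where "n' = (if n = 0 then 1 else n - 1)"
  have "cos (real n * t) * w t * cos t ^ Suc m =
     (cos (real (n + 1) * t) * w t * cos t ^ m) / 2 + (cos (real n' * t) * w t * cos t ^ m) / 2" for t
  proof -
    have "cos (real n * t) * w t * cos t ^ Suc m = (cos t * cos (real n * t)) * (w t * cos t ^ m)" by simp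
    then show ?thesis by (simp only: cos_mult_cos_nat n'_def[symmetric]) (simp add: algebra_simps add_divide_distrib)
  qed
  then have "integral {0..pi} (\<lambda>t. cos (real n * t) * w t * cos t ^ Suc m) =
     integral {0..pi} (\<lambda>t. (cos (real (n + 1) * t) * w t * cos t ^ m) / 2 + (cos (real n' * t) * w t * cos t ^ m) / 2)"
    by simp
  also have "\<dots> = integral {0..pi} (\<lambda>t. (cos (real (n + 1) * t) * w t * cos t ^ m) / 2) + 
      integral {0..pi} (\<lambda>t. (cos (real n' * t) * w t * cos t ^ m) / 2)"
    by (intro integral_add integrable_continuous_real continuous_intros w) auto
  also have "\<dots> = 0" using Suc.IH[of "n + 1"] Suc.IH[of n'] by simp
  finally show ?case .
qed

text \<open>By Weierstrass, W is uniformly close to a polynomial p. As w is orthogonal to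
  \<open>p (cos t)\<close>, the integral of w^2 equals that of
  \<open>w t * (w t - p (cos t))\<close>, which is arbitrarily small.\<close>

lemma eq_0_if_cos_coeffs_eq_0_real:
  fixes W :: "real \<Rightarrow> real"
  assumes W: "continuous_on {-1..1} W"
    and z: "\<And>n. integral {0..pi} (\<lambda>t. cos (real n * t) * W (cos t)) = 0"
    and x: "x \<in> {-1..1}"
  shows "W x = 0"
proof -
  define w where "w = (\<lambda>t. W (cos t))"
  have w: "continuous_on {0..pi} w"
    unfolding w_def by (rule continuous_on_compose2[OF W]) (auto intro!: continuous_intros)
  obtain B where B: "B > 0" "\<And>t. t \<in> {0..pi} \<Longrightarrow> \<bar>w t\<bar> \<le> B"
    using compact_imp_bounded[OF compact_continuous_image[OF w]] by (auto simp: bounded_pos)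
  have sq: "(\<lambda>t. w t * w t) integrable_on {0..pi}"
    by (intro integrable_continuous_real continuous_intros w)
  have "integral {0..pi} (\<lambda>t. w t * w t) \<le> e" if e: "e > 0" for e
  proof -
    \<comment> \<open>The integrand will be bounded by B * d, which integrates to e over an interval
      of length pi.\<close>
    define d where "d = e / (B * pi)"
    have d: "d > 0" using e B by (simp add: d_def)
    obtain p where p: "real_polynomial_function p" "\<And>x. x \<in> {-1..1} \<Longrightarrow> \<bar>W x - p x\<bar> < d"
      using Stone_Weierstrass_real_polynomial_function[OF _ W d] by auto
    obtain a m where a: "p = (\<lambda>x. \<Sum>i\<le>m. a i * x ^ i)"
      using p(1) real_polynomial_function_iff_sum by blast
    have "integral {0..pi} (\<lambda>t. w t * p (cos t)) = (\<Sum>i\<le>m. a i * integral {0..pi} (\<lambda>t. w t * cos t ^ i))"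
      unfolding a sum_distrib_left
      by (subst integral_sum) (auto intro!: integrable_continuous_real continuous_intros w sum.cong simp: mult.left_commute)
    also have "\<dots> = 0"
      using integral_mult_polynomial_eq_0[OF w, of 0] z by (simp add: w_def)
    finally have 0: "integral {0..pi} (\<lambda>t. w t * p (cos t)) = 0" .
    have pint: "(\<lambda>t. w t * p (cos t)) integrable_on {0..pi}"
      unfolding a by (intro integrable_continuous_real continuous_intros w)
    have "integral {0..pi} (\<lambda>t. w t * w t) = integral {0..pi} (\<lambda>t. w t * w t - w t * p (cos t))"
      using 0 by (subst integral_diff[OF sq pint]) simp
    also have "\<dots> \<le> integral {0..pi} (\<lambda>t. B * d)"
    proof (rule integral_le)
      fix t assume t: "t \<in> {0..pi}"
      have "w t * w t - w t * p (cos t) \<le> \<bar>w t\<bar> * \<bar>W (cos t) - p (cos t)\<bar>"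
        by (simp add: w_def algebra_simps flip: abs_mult)
      also have "\<dots> \<le> B * d" using B t p(2)[of "cos t"] by (intro mult_mono) auto
      finally show "w t * w t - w t * p (cos t) \<le> B * d" .
    qed (use integrable_diff[OF sq pint] in auto)
    also have "\<dots> = e" using B by (simp add: d_def)
    finally show ?thesis .
  qed
  then have "integral {0..pi} (\<lambda>t. w t * w t) \<le> 0" by (rule field_le_epsilon[of _ 0, simplified])
  moreover have "integral {0..pi} (\<lambda>t. w t * w t) \<ge> 0" by (rule integral_nonneg[OF sq]) auto
  ultimately have i0: "integral {0..pi} (\<lambda>t. w t * w t) = 0" by simp
  have "w t * w t = 0" if "t \<in> {0..pi}" for t
  proof (rule has_integral_0_cbox_imp_0[of 0 pi "\<lambda>t. w t * w t"])
    show "((\<lambda>t. w t * w t) has_integral 0) (cbox 0 pi)" using sq i0 by (simp add: has_integral_integral)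
  qed (use that w pi_gt_zero in \<open>auto intro!: continuous_intros simp del: pi_gt_zero\<close>)
  from this[of "arccos x"] x show ?thesis by (simp add: w_def cos_arccos arccos_lbound arccos_ubound)
qed

section \<open>The Riemann-Lebesgue lemma for cosine integrals\<close>

text \<open>Approximating \<open>w (arccos x)\<close> by a polynomial p makes w close to a
  polynomial in cos t. For n beyond the degree of p the cosine integral sees only the
  difference.\<close>

lemma cos_coeffs_tendsto_0_continuous:
  fixes w :: "real \<Rightarrow> real"
  assumes w: "continuous_on {0..pi} w"
  shows "(\<lambda>n. integral {0..pi} (\<lambda>t. cos (real n * t) * w t)) \<longlonglongrightarrow> 0"
proof (rule LIMSEQ_I)
  fix e :: real assume e: "e > 0"
  have "continuous_on {-1..1} (\<lambda>x. w (arccos x))"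
    by (rule continuous_on_compose2[OF w]) (auto intro!: continuous_intros arccos_lbound arccos_ubound)
  then obtain p where p: "real_polynomial_function p" "\<And>x. x \<in> {-1..1} \<Longrightarrow> \<bar>w (arccos x) - p x\<bar> < e / (2 * pi)"
    using Stone_Weierstrass_real_polynomial_function[of "{-1..1}" "\<lambda>x. w (arccos x)" "e / (2 * pi)"] e by auto
  obtain a m where a: "p = (\<lambda>x. \<Sum>i\<le>m. a i * x ^ i)"
    using p(1) real_polynomial_function_iff_sum by blast
  have "norm (integral {0..pi} (\<lambda>t. cos (real n * t) * w t) - 0) < e" if n: "n \<ge> Suc m" for n
  proof -
    have wint: "(\<lambda>t. cos (real n * t) * w t) integrable_on {0..pi}"
      by (intro integrable_continuous_real continuous_intros w)
    have pint: "(\<lambda>t. cos (real n * t) * p (cos t)) integrable_on {0..pi}"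
      unfolding a by (intro integrable_continuous_real continuous_intros)
    have "integral {0..pi} (\<lambda>t. cos (real n * t) * p (cos t)) = (\<Sum>i\<le>m. a i * integral {0..pi} (\<lambda>t. cos (real n * t) * cos t ^ i))"
      unfolding a sum_distrib_left
      by (subst integral_sum) (auto intro!: integrable_continuous_real continuous_intros sum.cong simp: mult.left_commute)
    also have "\<dots> = 0" using n by (intro sum.neutral) (auto simp: integral_cos_power_eq_0)
    finally have "integral {0..pi} (\<lambda>t. cos (real n * t) * w t) =
        integral {0..pi} (\<lambda>t. cos (real n * t) * w t - cos (real n * t) * p (cos t))"
      using integral_diff[OF wint pint] by simp
    also have "norm \<dots> \<le> integral {0..pi} (\<lambda>t. e / (2 * pi))"
    proof (rule integral_norm_bound_integral)
      fix t assume t: "t \<in> {0..pi}"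
      have "norm (cos (real n * t) * w t - cos (real n * t) * p (cos t)) = \<bar>cos (real n * t)\<bar> * \<bar>w t - p (cos t)\<bar>"
        by (simp add: algebra_simps flip: abs_mult)
      also have "\<dots> \<le> 1 * (e / (2 * pi))"
        using p(2)[of "cos t"] t by (intro mult_mono) (auto simp: arccos_cos)
      finally show "norm (cos (real n * t) * w t - cos (real n * t) * p (cos t)) \<le> e / (2 * pi)" by simp
    qed (use integrable_diff[OF wint pint] in auto)
    also have "\<dots> = e / 2" by simp
    finally show ?thesis using e by simp
  qed
  then show "\<exists>no. \<forall>n\<ge>no. norm (integral {0..pi} (\<lambda>t. cos (real n * t) * w t) - 0) < e" by blast
qed

text \<open>f may be unbounded at 0 and pi. The functions \<open>h k\<close> damp it by the factor k
  sin^2 t / (1 + k sin^2 t): they are continuous because sin^2 t * f t is, and f - h k = f / (1 + k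
  sin^2 t) tends to 0 in mean by dominated convergence with majorant |f|. This reduces the claim to
  the continuous case.\<close>

lemma riemann_lebesgue_cos:
  fixes f :: "real \<Rightarrow> real"
  assumes f: "f absolutely_integrable_on {0..pi}" and "f 0 = 0" "f pi = 0"
    and sf: "continuous_on {0..pi} (\<lambda>t. (sin t)\<^sup>2 * f t)"
  shows "(\<lambda>n. integral {0..pi} (\<lambda>t. cos (real n * t) * f t)) \<longlonglongrightarrow> 0"
proof -
  define h where "h k t = (sin t)\<^sup>2 * f t * (real k / (1 + real k * (sin t)\<^sup>2))" for k t
  have pos: "1 + real k * (sin t)\<^sup>2 > 0" for k t by (rule add_pos_nonneg) auto
  have h: "continuous_on {0..pi} (h k)" for k
    unfolding h_def using pos by (intro continuous_intros sf) (auto simp: less_imp_neq[THEN not_sym])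
  have diff: "f t - h k t = f t / (1 + real k * (sin t)\<^sup>2)" for k t
    using pos[of k t] by (simp add: h_def field_simps)
  have cosf: "(\<lambda>t. cos (real n * t) * f t) absolutely_integrable_on {0..pi}" for n
  proof (rule absolutely_integrable_bounded_measurable_product_real)
    show "(\<lambda>t. cos (real n * t)) \<in> borel_measurable (lebesgue_on {0..pi})"
      by (intro continuous_imp_measurable_on_sets_lebesgue continuous_intros) auto
    show "bounded ((\<lambda>t. cos (real n * t)) ` {0..pi})" by (rule boundedI[of _ 1]) auto
  qed (use f in auto)
  have fh: "(\<lambda>t. f t - h k t) absolutely_integrable_on {0..pi}" for k
    by (intro set_integral_diff(1) f absolutely_integrable_continuous_real h)
  have lim: "(\<lambda>k. integral {0..pi} (\<lambda>t. \<bar>f t - h k t\<bar>)) \<longlonglongrightarrow> integral {0..pi} (\<lambda>t. 0)"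
  proof (rule dominated_convergence(2))
    show "(\<lambda>t. \<bar>f t - h k t\<bar>) integrable_on {0..pi}" for k
      using fh[of k] by (simp add: absolutely_integrable_on_def)
    show "(\<lambda>t. \<bar>f t\<bar>) integrable_on {0..pi}"
      using f by (simp add: absolutely_integrable_on_def)
    show "norm \<bar>f t - h k t\<bar> \<le> \<bar>f t\<bar>" for k t
    proof -
      have "1 \<le> 1 + real k * (sin t)\<^sup>2" by simp
      then have "\<bar>f t\<bar> / (1 + real k * (sin t)\<^sup>2) \<le> \<bar>f t\<bar> / 1" using pos[of k t] by (intro divide_left_mono) auto
      then show ?thesis unfolding diff using pos[of k t] by simp
    qed
    \<comment> \<open>At the endpoints sin t = 0 and the denominator stays 1, so pointwise
      convergence there rests on f 0 = f pi = 0.\<close>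
    show "(\<lambda>k. \<bar>f t - h k t\<bar>) \<longlonglongrightarrow> 0" if t: "t \<in> {0..pi}" for t
    proof (cases "t = 0 \<or> t = pi")
      case True
      then show ?thesis using assms by (auto simp: h_def)
    next
      case False
      then have "sin t > 0" using t by (intro sin_gt_zero) auto
      then have s: "(sin t)\<^sup>2 > 0" by simp
      have "(\<lambda>k. f t / (1 + real k * (sin t)\<^sup>2)) \<longlonglongrightarrow> 0"
        by (intro real_tendsto_divide_at_top[OF tendsto_const] filterlim_tendsto_add_at_top[OF tendsto_const]
            filterlim_at_top_mult_tendsto_pos[OF tendsto_const s] filterlim_real_sequentially)
      then show ?thesis unfolding diff by (rule tendsto_rabs_zero)
    qed
  qed
  show ?thesis
  proof (rule LIMSEQ_I)
    fix e :: real assume e: "e > 0"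
    have "\<forall>\<^sub>F k in sequentially. integral {0..pi} (\<lambda>t. \<bar>f t - h k t\<bar>) < e / 2"
      using order_tendstoD(2)[OF lim, of "e/2"] e by simp
    then obtain k where k: "integral {0..pi} (\<lambda>t. \<bar>f t - h k t\<bar>) < e / 2"
      by (auto simp: eventually_sequentially)
    have "\<forall>\<^sub>F n in sequentially. \<bar>integral {0..pi} (\<lambda>t. cos (real n * t) * h k t)\<bar> < e / 2"
      using order_tendstoD(2)[OF tendsto_rabs_zero[OF cos_coeffs_tendsto_0_continuous[OF h[of k]]], of "e/2"] e by simp
    then obtain n0 where n0: "\<And>n. n \<ge> n0 \<Longrightarrow> \<bar>integral {0..pi} (\<lambda>t. cos (real n * t) * h k t)\<bar> < e / 2"
      by (auto simp: eventually_sequentially)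
    have "norm (integral {0..pi} (\<lambda>t. cos (real n * t) * f t) - 0) < e" if n: "n \<ge> n0" for n
    proof -
      have hint: "(\<lambda>t. cos (real n * t) * h k t) integrable_on {0..pi}"
        by (intro integrable_continuous_real continuous_intros h)
      have fint: "(\<lambda>t. cos (real n * t) * f t) integrable_on {0..pi}"
        using cosf[of n] by (simp add: absolutely_integrable_on_def)
      have "norm (integral {0..pi} (\<lambda>t. cos (real n * t) * f t) - integral {0..pi} (\<lambda>t. cos (real n * t) * h k t)) = 
        norm (integral {0..pi} (\<lambda>t. cos (real n * t) * f t - cos (real n * t) * h k t))"
        using integral_diff[OF fint hint] by simp
      also have "\<dots> \<le> integral {0..pi} (\<lambda>t. \<bar>f t - h k t\<bar>)"
      proof (rule integral_norm_bound_integral)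
        fix t
        have "norm (cos (real n * t) * f t - cos (real n * t) * h k t) = \<bar>cos (real n * t)\<bar> * \<bar>f t - h k t\<bar>"
          by (simp add: algebra_simps flip: abs_mult)
        also have "\<dots> \<le> 1 * \<bar>f t - h k t\<bar>" by (intro mult_right_mono) auto
        finally show "norm (cos (real n * t) * f t - cos (real n * t) * h k t) \<le> \<bar>f t - h k t\<bar>" by simp
      qed (use integrable_diff[OF fint hint] fh[of k] in \<open>auto simp: absolutely_integrable_on_def\<close>)
      finally show ?thesis using k n0[OF n] by simp
    qed
    then show "\<exists>no. \<forall>n\<ge>no. norm (integral {0..pi} (\<lambda>t. cos (real n * t) * f t) - 0) < e" by blast
  qed
qed

lemma integral_cos_mult_Re_Im:
  fixes f :: "real \<Rightarrow> complex"
  assumes "f absolutely_integrable_on {0..pi}"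
  shows "Re (integral {0..pi} (\<lambda>t. of_real (cos (a * t)) * f t)) = integral {0..pi} (\<lambda>t. cos (a * t) * Re (f t))"
    and "Im (integral {0..pi} (\<lambda>t. of_real (cos (a * t)) * f t)) = integral {0..pi} (\<lambda>t. cos (a * t) * Im (f t))"
proof -
  have "(\<lambda>t. of_real (cos (a * t)) * f t) integrable_on {0..pi}"
    using absolutely_integrable_cos_mult[OF assms, of a] by (simp add: absolutely_integrable_on_def)
  from integral_linear[OF this bounded_linear_Re] integral_linear[OF this bounded_linear_Im]
  show "Re (integral {0..pi} (\<lambda>t. of_real (cos (a * t)) * f t)) = integral {0..pi} (\<lambda>t. cos (a * t) * Re (f t))"
    and "Im (integral {0..pi} (\<lambda>t. of_real (cos (a * t)) * f t)) = integral {0..pi} (\<lambda>t. cos (a * t) * Im (f t))"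
    by (simp_all add: o_def)
qed

text \<open>Intended for f = u / (1 - x^2), which may be singular at the endpoints; this is why
  continuity is demanded of the product with 1 - x^2. The endpoint values 0 are those of division by
  zero.\<close>

lemma cheb_coeff_tendsto_0:
  assumes f: "(\<lambda>t. f (cos t)) absolutely_integrable_on {0..pi}" and "f 1 = 0" "f (-1) = 0"
    and c: "continuous_on {-1..1} (\<lambda>x. of_real (1 - x\<^sup>2) * f x)"
  shows "cheb_coeff f \<longlonglongrightarrow> 0"
proof -
  have c': "continuous_on {0..pi} (\<lambda>t. of_real (1 - (cos t)\<^sup>2) * f (cos t))"
    by (rule continuous_on_compose2[OF c]) (auto intro!: continuous_intros)
  have "(\<lambda>n. integral {0..pi} (\<lambda>t. cos (real n * t) * Re (f (cos t)))) \<longlonglongrightarrow> 0"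
  proof (rule riemann_lebesgue_cos)
    have "continuous_on {0..pi} (\<lambda>t. Re (of_real (1 - (cos t)\<^sup>2) * f (cos t)))"
      by (intro continuous_intros c')
    then show "continuous_on {0..pi} (\<lambda>t. (sin t)\<^sup>2 * Re (f (cos t)))"
      by (simp add: sin_squared_eq)
  qed (use assms absolutely_integrable_component[OF f, of 1] in auto)
  moreover have "(\<lambda>n. integral {0..pi} (\<lambda>t. cos (real n * t) * Im (f (cos t)))) \<longlonglongrightarrow> 0"
  proof (rule riemann_lebesgue_cos)
    have "continuous_on {0..pi} (\<lambda>t. Im (of_real (1 - (cos t)\<^sup>2) * f (cos t)))"
      by (intro continuous_intros c')
    then show "continuous_on {0..pi} (\<lambda>t. (sin t)\<^sup>2 * Im (f (cos t)))"
      by (simp add: sin_squared_eq)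
  qed (use assms absolutely_integrable_component[OF f, of \<i>] in auto)
  ultimately have "(\<lambda>n. integral {0..pi} (\<lambda>t. of_real (cos (real n * t)) * f (cos t))) \<longlonglongrightarrow> 0"
    by (simp add: tendsto_complex_iff integral_cos_mult_Re_Im[OF f])
  then have "(\<lambda>n. 2 / of_real pi * integral {0..pi} (\<lambda>t. of_real (cos (real n * t)) * f (cos t))) \<longlonglongrightarrow> 0"
    by (rule tendsto_mult_right_zero)
  then show ?thesis
    by (rule Lim_transform_eventually)
       (intro eventually_mono[OF eventually_gt_at_top[of 0]], simp add: cheb_coeff_eq_cos_integral[OF f])
qed

lemma eq_0_if_cos_coeffs_eq_0:
  fixes W :: "real \<Rightarrow> complex"
  assumes W: "continuous_on {-1..1} W"
    and z: "\<And>n. integral {0..pi} (\<lambda>t. of_real (cos (real n * t)) * W (cos t)) = 0"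
    and x: "x \<in> {-1..1}"
  shows "W x = 0"
proof (rule complex_eqI)
  have "continuous_on {0..pi} (\<lambda>t. W (cos t))"
    by (rule continuous_on_compose2[OF W]) (auto intro!: continuous_intros)
  then have ai: "(\<lambda>t. W (cos t)) absolutely_integrable_on {0..pi}"
    by (rule absolutely_integrable_continuous_real)
  show "Re (W x) = Re 0"
    using eq_0_if_cos_coeffs_eq_0_real[of "\<lambda>x. Re (W x)" x] x
    by (simp add: continuous_intros W z flip: integral_cos_mult_Re_Im[OF ai])
  show "Im (W x) = Im 0"
    using eq_0_if_cos_coeffs_eq_0_real[of "\<lambda>x. Im (W x)" x] x
    by (simp add: continuous_intros W z flip: integral_cos_mult_Re_Im[OF ai])
qed

lemma integral_cos_mult_cos:
  "integral {0..pi} (\<lambda>t. cos (real n * t) * cos (real k * t)) =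
    (if n = k then if n = 0 then pi else pi / 2 else 0)"
proof -
  define d where "d = (if n \<le> k then k - n else n - k)"
  have d: "cos (real n * t - real k * t) = cos (real d * t)" for t
  proof (cases "n \<le> k")
    case True
    then have "real n * t - real k * t = - (real d * t)" by (simp add: d_def algebra_simps)
    then show ?thesis by simp
  next
    case False
    then have "real n * t - real k * t = real d * t" by (simp add: d_def algebra_simps)
    then show ?thesis by simp
  qed
  have "cos (real n * t) * cos (real k * t) = cos (real d * t) / 2 + cos (real (n + k) * t) / 2" for t
  proof -
    have "cos (real (n + k) * t) = cos (real n * t + real k * t)" by (simp add: algebra_simps)
    then show ?thesis by (simp add: cos_times_cos d add_divide_distrib)
  qed
  then have "integral {0..pi} (\<lambda>t. cos (real n * t) * cos (real k * t)) =
    integral {0..pi} (\<lambda>t. cos (real d * t) / 2 + cos (real (n + k) * t) / 2)"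
    by simp
  also have "\<dots> = integral {0..pi} (\<lambda>t. cos (real d * t) / 2) + integral {0..pi} (\<lambda>t. cos (real (n + k) * t) / 2)"
    by (intro integral_add integrable_continuous_real continuous_intros) auto
  also have "\<dots> = (if n = k then if n = 0 then pi else pi / 2 else 0)"
    unfolding integral_divide integral_cos_nat_mult by (auto simp: d_def)
  finally show ?thesis .
qed

text \<open>Summability makes the series converge uniformly to a continuous S, and termwise
  integration gives S the same cosine integrals as u. The difference is then continuous with
  vanishing cosine integrals, hence 0 by completeness.\<close>

lemma cheb_series_sums:
  assumes u: "continuous_on {-1..1} u" and sm: "summable (\<lambda>n. norm (cheb_coeff u n))" and x: "x \<in> {-1..1}"
  shows "(\<lambda>n. cheb_coeff u n * of_real (cheb_T n x)) sums u x"
proof -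
  define a where "a = cheb_coeff u"
  define S where "S x = (\<Sum>n. a n * of_real (cheb_T n x))" for x
  have le: "norm (a n * of_real (cheb_T n x)) \<le> norm (a n)" if "x \<in> {-1..1}" for n x
    using abs_cheb_T_le_1[OF that, of n] by (simp add: norm_mult mult_left_le)
  have unif: "uniform_limit {-1..1} (\<lambda>N x. \<Sum>n<N. a n * of_real (cheb_T n x)) S sequentially"
    unfolding S_def by (rule Weierstrass_m_test[OF le]) (use sm in \<open>auto simp: a_def\<close>)
  have S: "continuous_on {-1..1} S"
    by (rule uniform_limit_theorem[OF _ unif]) (auto intro!: always_eventually continuous_intros)
  define W where "W x = u x - S x" for x
  have W: "continuous_on {-1..1} W" unfolding W_def by (intro continuous_intros u S)
  have uc: "continuous_on {0..pi} (\<lambda>t. u (cos t))"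
    by (rule continuous_on_compose2[OF u]) (auto intro!: continuous_intros)
  have Sc: "continuous_on {0..pi} (\<lambda>t. S (cos t))"
    by (rule continuous_on_compose2[OF S]) (auto intro!: continuous_intros)
  have "integral {0..pi} (\<lambda>t. of_real (cos (real n * t)) * W (cos t)) = 0" for n
  proof -
    \<comment> \<open>The integral of \<open>cos (n * t) ^ 2\<close>, which is the reciprocal of the
      normalising factor in \<open>cheb_coeff\<close>.\<close>
    define c where "c = (if n = 0 then of_real pi else of_real pi / 2 :: complex)"
    define f where "f k t = a k * of_real (cos (real n * t) * cos (real k * t))" for k t
    have fle: "norm (f k t) \<le> norm (a k)" for k t
    proof -
      have "\<bar>cos (real n * t)\<bar> * \<bar>cos (real k * t)\<bar> \<le> 1 * 1" by (intro mult_mono) auto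
      then show ?thesis by (simp add: f_def norm_mult mult_left_le)
    qed
    have fsuminf: "(\<Sum>k. f k t) = of_real (cos (real n * t)) * S (cos t)" for t
    proof -
      have "summable (\<lambda>k. a k * of_real (cheb_T k (cos t)))"
        by (rule summable_comparison_test[OF _ sm]) (use le[of "cos t"] in \<open>auto simp: a_def\<close>)
      from suminf_mult[OF this, of "of_real (cos (real n * t))"] show ?thesis
        by (simp add: f_def S_def cheb_T_cos mult_ac)
    qed
    have flim: "uniform_limit {0..pi} (\<lambda>N t. \<Sum>k<N. f k t) (\<lambda>t. \<Sum>k. f k t) sequentially"
      by (rule Weierstrass_m_test[OF fle]) (use sm in \<open>auto simp: a_def\<close>)
    have fc: "continuous_on {0..pi} (f k)" for k
      unfolding f_def by (intro continuous_intros)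
    have fint: "integral {0..pi} (f k) = (if k = n then a n * c else 0)" for k
    proof -
      have "integral {0..pi} (f k) = a k * integral {0..pi} (\<lambda>t. of_real (cos (real n * t) * cos (real k * t)))"
        unfolding f_def by (rule integral_mult_right)
      also have "integral {0..pi} (\<lambda>t. of_real (cos (real n * t) * cos (real k * t))) =
          (of_real (integral {0..pi} (\<lambda>t. cos (real n * t) * cos (real k * t))) :: complex)"
        using integral_linear[OF _ bounded_linear_of_real, of "\<lambda>t. cos (real n * t) * cos (real k * t)" "{0..pi}"]
        by (simp add: o_def integrable_continuous_real continuous_intros)
      finally show ?thesis by (auto simp: integral_cos_mult_cos c_def)
    qed
    obtain I J where IJ: "\<And>N. ((\<lambda>t. \<Sum>k<N. f k t) has_integral I N) {0..pi}"
      "((\<lambda>t. \<Sum>k. f k t) has_integral J) {0..pi}" "I \<longlonglongrightarrow> J"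
      by (rule uniform_limit_integral[OF flim]) (auto intro!: continuous_on_sum fc)
    have "I N = a n * c" if "N > n" for N
    proof -
      have "I N = (\<Sum>k<N. integral {0..pi} (f k))"
        unfolding integral_unique[OF IJ(1)[of N], symmetric]
        by (intro integral_sum integrable_continuous_real fc) auto
      also have "\<dots> = a n * c" using that by (simp add: fint)
      finally show ?thesis .
    qed
    then have "I \<longlonglongrightarrow> a n * c"
      by (intro tendsto_eventually eventually_mono[OF eventually_gt_at_top[of n]])
    with IJ(3) have "J = a n * c" using LIMSEQ_unique by blast
    with IJ(2) have "integral {0..pi} (\<lambda>t. of_real (cos (real n * t)) * S (cos t)) = a n * c"
      by (simp add: fsuminf integral_unique)
    moreover have "integral {0..pi} (\<lambda>t. of_real (cos (real n * t)) * u (cos t)) = a n * c"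
      using cheb_coeff_eq_cos_integral[of u n] absolutely_integrable_continuous_real[OF uc]
      by (simp add: a_def c_def)
    moreover have "integral {0..pi} (\<lambda>t. of_real (cos (real n * t)) * W (cos t)) =
        integral {0..pi} (\<lambda>t. of_real (cos (real n * t)) * u (cos t)) - integral {0..pi} (\<lambda>t. of_real (cos (real n * t)) * S (cos t))"
      unfolding W_def right_diff_distrib
      by (intro integral_diff integrable_continuous_real continuous_intros uc Sc)
    ultimately show ?thesis by simp
  qed
  then have "W x = 0" by (rule eq_0_if_cos_coeffs_eq_0[OF W _ x])
  moreover have "(\<lambda>n. a n * of_real (cheb_T n x)) sums S x"
    unfolding S_def by (intro summable_sums summable_comparison_test[OF _ sm]) (use le x in \<open>auto simp: a_def\<close>)
  ultimately show ?thesis by (simp add: W_def a_def)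
qed

section \<open>The branch point singularity\<close>

text \<open>The complex continuation of the singular factor as a function of w = sin t. In the
  variable 1 - x^2 = w^2 the vertical lines through 0 and pi would lie on the cut of the principal
  branch; in w they are mapped to the imaginary axis, which meets the cut only at 0.\<close>

definition log_branch :: "real \<Rightarrow> nat \<Rightarrow> complex \<Rightarrow> complex" where
  "log_branch \<phi> \<theta> w = w powr of_real (2 * \<phi>) * (2 * Ln w) ^ \<theta>"

lemma log_branch_0 [simp]: "log_branch \<phi> \<theta> 0 = 0"
  by (simp add: log_branch_def)

lemma log_branch_of_real:
  assumes "s > 0"
  shows "log_branch \<phi> \<theta> (of_real s) = of_real ((s\<^sup>2) powr \<phi> * ln (s\<^sup>2) ^ \<theta>)"
proof -
  have "of_real s powr of_real (2 * \<phi>) = (of_real (s powr (2 * \<phi>)) :: complex)"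
    using assms by (intro powr_of_real) auto
  moreover have "s powr (2 * \<phi>) = (s\<^sup>2) powr \<phi>"
    using assms by (simp add: powr_def ln_realpow)
  moreover have "2 * Ln (of_real s) = of_real (ln (s\<^sup>2))"
    using assms by (simp add: Ln_of_real ln_realpow)
  ultimately show ?thesis by (simp add: log_branch_def)
qed

lemma norm_log_branch_le:
  assumes "w \<noteq> 0"
  shows "norm (log_branch \<phi> \<theta> w) \<le> (2 * pi) ^ \<theta> * (norm w powr (2 * \<phi>) * (1 + \<bar>ln (norm w)\<bar>) ^ \<theta>)"
proof -
  have "norm (Ln w) \<le> \<bar>Re (Ln w)\<bar> + \<bar>Im (Ln w)\<bar>" by (rule cmod_le)
  also have "\<bar>Im (Ln w)\<bar> \<le> pi" using mpi_less_Im_Ln[OF assms] Im_Ln_le_pi[OF assms] by simp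
  also have "\<bar>Re (Ln w)\<bar> + pi \<le> pi * (1 + \<bar>ln (norm w)\<bar>)"
    using assms pi_ge_two mult_right_mono[of 1 pi "\<bar>ln (norm w)\<bar>"] by (simp add: algebra_simps)
  finally have "norm ((2 * Ln w) ^ \<theta>) \<le> (2 * (pi * (1 + \<bar>ln (norm w)\<bar>))) ^ \<theta>"
    unfolding norm_power by (intro power_mono) (auto simp: norm_mult)
  moreover have "norm (w powr of_real (2 * \<phi>)) = norm w powr (2 * \<phi>)"
    by (subst norm_powr_real_powr') auto
  ultimately have "norm (log_branch \<phi> \<theta> w) \<le> norm w powr (2 * \<phi>) * (2 * (pi * (1 + \<bar>ln (norm w)\<bar>))) ^ \<theta>"
    unfolding log_branch_def norm_mult by (metis mult_left_mono powr_ge_zero)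
  also have "(2 * (pi * (1 + \<bar>ln (norm w)\<bar>))) ^ \<theta> = (2 * pi) ^ \<theta> * (1 + \<bar>ln (norm w)\<bar>) ^ \<theta>"
    by (simp only: power_mult_distrib mult.assoc)
  finally show ?thesis by (simp only: mult_ac)
qed

text \<open>With \<epsilon> = \<phi>, half of the exponent 2 \<phi> absorbs the logarithms, and a
  positive power of |w| is left.\<close>

lemma isCont_log_branch_0:
  assumes "\<phi> > 0"
  shows "isCont (log_branch \<phi> \<theta>) 0"
proof -
  obtain C where C: "C > 0" "\<And>r. r > 0 \<Longrightarrow> (1 + \<bar>ln r\<bar>) ^ \<theta> \<le> C * (r powr \<phi> + r powr (- \<phi>))"
    using one_plus_ln_power_le[OF assms] by auto
  have le: "norm (log_branch \<phi> \<theta> w) \<le> (2 * pi) ^ \<theta> * C * (norm w powr (3 * \<phi>) + norm w powr \<phi>)" if "w \<noteq> 0" for w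
  proof -
    have "norm (log_branch \<phi> \<theta> w) \<le> (2 * pi) ^ \<theta> * (norm w powr (2 * \<phi>) * (1 + \<bar>ln (norm w)\<bar>) ^ \<theta>)"
      by (rule norm_log_branch_le[OF that])
    also have "\<dots> \<le> (2 * pi) ^ \<theta> * (norm w powr (2 * \<phi>) * (C * (norm w powr \<phi> + norm w powr (- \<phi>))))"
      using that by (intro mult_left_mono C) auto
    also have "\<dots> = (2 * pi) ^ \<theta> * C * (norm w powr (2 * \<phi>) * norm w powr \<phi> + norm w powr (2 * \<phi>) * norm w powr (- \<phi>))"
      by (simp add: algebra_simps)
    also have "\<dots> = (2 * pi) ^ \<theta> * C * (norm w powr (3 * \<phi>) + norm w powr \<phi>)"
      by (simp flip: powr_add)
    finally show ?thesis .
  qed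
  have "((\<lambda>w::complex. (2 * pi) ^ \<theta> * C * (norm w powr (3 * \<phi>) + norm w powr \<phi>)) \<longlongrightarrow> (2 * pi) ^ \<theta> * C * (0 powr (3 * \<phi>) + 0 powr \<phi>)) (at 0)"
    using assms by (intro tendsto_intros tendsto_norm_zero tendsto_ident_at tendsto_powr' ) auto
  then have "((\<lambda>w::complex. (2 * pi) ^ \<theta> * C * (norm w powr (3 * \<phi>) + norm w powr \<phi>)) \<longlongrightarrow> 0) (at 0)" by simp
  then have "(log_branch \<phi> \<theta> \<longlongrightarrow> 0) (at 0)"
    by (rule Lim_null_comparison[rotated]) (use le in \<open>auto simp: eventually_at intro!: exI[of _ 1]\<close>)
  then show ?thesis by (simp add: isCont_def)
qed

lemma field_differentiable_log_branch:
  assumes "w \<notin> \<real>\<^sub>\<le>\<^sub>0"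
  shows "log_branch \<phi> \<theta> field_differentiable at w"
  unfolding log_branch_def using assms
  by (intro holomorphic_on_imp_differentiable_at[of _ "- \<real>\<^sub>\<le>\<^sub>0"] holomorphic_intros) (auto intro!: open_Compl)

lemma continuous_on_log_branch:
  assumes "\<phi> > 0"
  shows "continuous_on {w. w = 0 \<or> w \<notin> \<real>\<^sub>\<le>\<^sub>0} (log_branch \<phi> \<theta>)"
  by (intro continuous_at_imp_continuous_on ballI)
     (auto intro: isCont_log_branch_0[OF assms] field_differentiable_imp_continuous_at field_differentiable_log_branch)

lemma cnj_log_branch:
  assumes "w = 0 \<or> w \<notin> \<real>\<^sub>\<le>\<^sub>0"
  shows "cnj (log_branch \<phi> \<theta> w) = log_branch \<phi> \<theta> (cnj w)"
  using assms by (auto simp: log_branch_def powr_def cnj_Ln exp_cnj)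

lemma ii_times_nonpos_Reals: "r > 0 \<Longrightarrow> \<i> * of_real r \<notin> \<real>\<^sub>\<le>\<^sub>0" "r > 0 \<Longrightarrow> - (\<i> * of_real r) \<notin> \<real>\<^sub>\<le>\<^sub>0"
  by (auto simp: complex_nonpos_Reals_iff)

text \<open>Applied to two conjugate points of logarithmic size whose difference is bounded: one
  power of B is lost, and with it one logarithm.\<close>

lemma norm_power_diff_le:
  fixes x y :: complex
  assumes "norm x \<le> B" "norm y \<le> B"
  shows "norm (x ^ n - y ^ n) \<le> real n * B ^ (n - 1) * norm (x - y)"
proof (induction n)
  case (Suc n)
  have B: "B \<ge> 0" using assms norm_ge_zero order_trans by blast
  have "x ^ Suc n - y ^ Suc n = x * (x ^ n - y ^ n) + (x - y) * y ^ n" by (simp add: algebra_simps)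
  also have "norm \<dots> \<le> norm x * norm (x ^ n - y ^ n) + norm (x - y) * norm y ^ n"
    by (rule order.trans[OF norm_triangle_ineq]) (simp add: norm_mult norm_power)
  also have "\<dots> \<le> B * (real n * B ^ (n - 1) * norm (x - y)) + norm (x - y) * B ^ n"
    using assms B by (intro add_mono mult_mono Suc.IH power_mono) auto
  also have "\<dots> = real (Suc n) * B ^ (Suc n - 1) * norm (x - y)"
    by (cases n) (auto simp: algebra_simps)
  finally show ?case .
qed simp

definition log_exponent :: "real \<Rightarrow> nat \<Rightarrow> nat" where
  "log_exponent \<phi> \<theta> = (if \<phi> \<in> \<nat> then \<theta> - 1 else \<theta>)"

text \<open>
  For \<open>\<phi> \<in> \<nat>\<close> the phase \<open>exp (\<i> \<phi> \<pi>)\<close> is real, so that the leading powers of the logarithm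
  cancel in the jump across the cut. This is the origin of the smaller exponent.
\<close>

lemma log_branch_jump_le:
  obtains C where "C > 0"
    "\<And>r. r > 0 \<Longrightarrow> norm (log_branch \<phi> \<theta> (\<i> * of_real r) - cnj (log_branch \<phi> \<theta> (\<i> * of_real r)))
       \<le> C * (r powr (2 * \<phi>) * (1 + \<bar>ln r\<bar>) ^ log_exponent \<phi> \<theta>)"
proof (cases "\<phi> \<in> \<nat>")
  case False
  have "norm (log_branch \<phi> \<theta> (\<i> * of_real r) - cnj (log_branch \<phi> \<theta> (\<i> * of_real r)))
       \<le> (2 * (2 * pi) ^ \<theta>) * (r powr (2 * \<phi>) * (1 + \<bar>ln r\<bar>) ^ log_exponent \<phi> \<theta>)" if r: "r > 0" for r
  proof -
    have "norm (log_branch \<phi> \<theta> (\<i> * of_real r) - cnj (log_branch \<phi> \<theta> (\<i> * of_real r)))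
      \<le> 2 * norm (log_branch \<phi> \<theta> (\<i> * of_real r))"
      by (rule order.trans[OF norm_triangle_ineq4]) simp
    also have "\<dots> \<le> 2 * ((2 * pi) ^ \<theta> * (norm (\<i> * of_real r) powr (2 * \<phi>) * (1 + \<bar>ln (norm (\<i> * of_real r))\<bar>) ^ \<theta>))"
      using r by (intro mult_left_mono norm_log_branch_le) auto
    finally show ?thesis using r False by (simp add: log_exponent_def norm_mult)
  qed
  then show ?thesis by (intro that[of "2 * (2 * pi) ^ \<theta>"]) auto
next
  case True
  then obtain m :: nat where m: "\<phi> = real m" by (auto elim: Nats_cases)
  have "norm (log_branch \<phi> \<theta> (\<i> * of_real r) - cnj (log_branch \<phi> \<theta> (\<i> * of_real r)))
       \<le> (real (Suc \<theta>) * pi ^ (\<theta> - 1) * (2 * pi)) * (r powr (2 * \<phi>) * (1 + \<bar>ln r\<bar>) ^ log_exponent \<phi> \<theta>)" if r: "r > 0" for r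
  proof -
    \<comment> \<open>This is \<open>2 * Ln (\<i> * r)\<close>. Its imaginary part pi does not
      depend on r, so \<open>x - cnj x\<close> contains no logarithm.\<close>
    define x where "x = 2 * of_real (ln r) + \<i> * of_real pi"
    have Ln: "Ln (\<i> * of_real r) = of_real (ln r) + \<i> * of_real pi / 2"
      using r by (simp add: Ln_times_ii Ln_of_real)
    have "(\<i> * of_real r) powr of_real (2 * \<phi>) = (\<i> * of_real r) ^ (2 * m)"
      using r powr_complexpow[of "\<i> * of_real r" "2 * m"] by (simp add: m)
    also have "\<dots> = of_real ((-1) ^ m * r powr (2 * \<phi>))"
    proof -
      have "r powr (2 * \<phi>) = r ^ (2 * m)" using r powr_realpow[of r "2 * m"] by (simp add: m)
      then show ?thesis by (simp add: power_mult_distrib power_mult power_minus[of "(of_real r)\<^sup>2"])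
    qed
    finally have pw: "(\<i> * of_real r) powr of_real (2 * \<phi>) = of_real ((-1) ^ m * r powr (2 * \<phi>))" .
    have lb: "log_branch \<phi> \<theta> (\<i> * of_real r) = of_real ((-1) ^ m * r powr (2 * \<phi>)) * x ^ \<theta>"
      unfolding log_branch_def pw Ln x_def by (simp add: algebra_simps)
    have "norm x \<le> 2 * \<bar>ln r\<bar> + pi"
      unfolding x_def by (rule order.trans[OF norm_triangle_ineq]) (simp add: norm_mult)
    also have "\<dots> \<le> pi * (1 + \<bar>ln r\<bar>)"
      using pi_ge_two mult_right_mono[of 2 pi "\<bar>ln r\<bar>"] by (simp add: algebra_simps)
    finally have x: "norm x \<le> pi * (1 + \<bar>ln r\<bar>)" .
    have "x - cnj x = 2 * \<i> * of_real pi" by (simp add: x_def)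
    then have nx: "norm (x - cnj x) = 2 * pi" by (simp add: norm_mult)
    have "log_branch \<phi> \<theta> (\<i> * of_real r) - cnj (log_branch \<phi> \<theta> (\<i> * of_real r)) = of_real ((-1) ^ m * r powr (2 * \<phi>)) * (x ^ \<theta> - cnj x ^ \<theta>)"
      by (simp add: lb algebra_simps)
    then have "norm (log_branch \<phi> \<theta> (\<i> * of_real r) - cnj (log_branch \<phi> \<theta> (\<i> * of_real r))) = r powr (2 * \<phi>) * norm (x ^ \<theta> - cnj x ^ \<theta>)"
      by (simp add: norm_mult norm_power abs_mult power_abs)
    also have "\<dots> \<le> r powr (2 * \<phi>) * (real \<theta> * (pi * (1 + \<bar>ln r\<bar>)) ^ (\<theta> - 1) * norm (x - cnj x))"
      using x by (intro mult_left_mono norm_power_diff_le) auto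
    also have "\<dots> = real \<theta> * pi ^ (\<theta> - 1) * (2 * pi) * (r powr (2 * \<phi>) * (1 + \<bar>ln r\<bar>) ^ log_exponent \<phi> \<theta>)"
      using True by (simp add: nx log_exponent_def power_mult_distrib mult_ac)
    \<comment> \<open>\<open>Suc \<theta>\<close> keeps the constant positive also for \<theta> =
      0.\<close>
    also have "\<dots> \<le> real (Suc \<theta>) * pi ^ (\<theta> - 1) * (2 * pi) * (r powr (2 * \<phi>) * (1 + \<bar>ln r\<bar>) ^ log_exponent \<phi> \<theta>)"
      by (intro mult_right_mono) auto
    finally show ?thesis .
  qed
  then show ?thesis by (intro that[of "real (Suc \<theta>) * pi ^ (\<theta> - 1) * (2 * pi)"]) auto
qed

lemma sinh_bounds:
  fixes s :: real
  assumes "0 < s" "s \<le> \<eta>"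
  shows "s \<le> sinh s" "sinh s \<le> cosh \<eta> * s"
proof -
  have "\<exists>z>0. z < s \<and> sinh s - sinh 0 = (s - 0) * cosh z"
    using assms by (intro MVT2) (auto intro!: derivative_eq_intros)
  then obtain z where z: "0 < z" "z < s" "sinh s = s * cosh z" by auto
  have "1 \<le> cosh z" "cosh z \<le> cosh \<eta>"
    using z assms cosh_real_ge_1 cosh_real_nonneg_le_iff by auto
  then show "s \<le> sinh s" "sinh s \<le> cosh \<eta> * s"
    using z assms by (auto simp: mult_ac)
qed

text \<open>On (0, \<eta>] the ratio sinh s / s lies between 1 and cosh \<eta>, so replacing sinh s
  by s changes the logarithm by at most ln (cosh \<eta>).\<close>

lemma log_branch_sinh_jump_le:
  assumes "\<phi> > 0" "\<eta> > 0"
  obtains C where "C > 0"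
    "\<And>s. 0 < s \<Longrightarrow> s \<le> \<eta> \<Longrightarrow>
      norm (log_branch \<phi> \<theta> (\<i> * of_real (sinh s)) - cnj (log_branch \<phi> \<theta> (\<i> * of_real (sinh s))))
       \<le> C * (s powr (2 * \<phi>) * (1 + \<bar>ln s\<bar>) ^ log_exponent \<phi> \<theta>)"
proof -
  obtain C where C: "C > 0"
    "\<And>r. r > 0 \<Longrightarrow> norm (log_branch \<phi> \<theta> (\<i> * of_real r) - cnj (log_branch \<phi> \<theta> (\<i> * of_real r)))
       \<le> C * (r powr (2 * \<phi>) * (1 + \<bar>ln r\<bar>) ^ log_exponent \<phi> \<theta>)"
    using log_branch_jump_le by blast
  define K where "K = cosh \<eta>"
  define k where "k = log_exponent \<phi> \<theta>"
  have K: "K \<ge> 1" unfolding K_def by (rule cosh_real_ge_1)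
  show ?thesis
  proof (rule that[of "C * (K powr (2 * \<phi>) * (1 + ln K) ^ k)"])
    show "C * (K powr (2 * \<phi>) * (1 + ln K) ^ k) > 0"
      using C K by (auto intro!: mult_pos_pos zero_less_power add_pos_nonneg)
    fix s :: real assume s: "0 < s" "s \<le> \<eta>"
    note sb = sinh_bounds[OF s, folded K_def]
    have pos: "sinh s > 0" using s by simp
    have "ln s \<le> ln (sinh s)" "ln (sinh s) \<le> ln (K * s)"
      using sb s pos K by (auto intro!: ln_mono)
    then have "ln s \<le> ln (sinh s)" "ln (sinh s) \<le> ln s + ln K" "ln K \<ge> 0"
      using K s by (auto simp: ln_mult add_ac)
    then have "\<bar>ln (sinh s)\<bar> \<le> \<bar>ln s\<bar> + ln K" by linarith
    moreover have "0 \<le> \<bar>ln s\<bar> * ln K" using K by simp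
    ultimately have "1 + \<bar>ln (sinh s)\<bar> \<le> (1 + ln K) * (1 + \<bar>ln s\<bar>)" by (simp add: algebra_simps)
    then have l: "(1 + \<bar>ln (sinh s)\<bar>) ^ k \<le> ((1 + ln K) * (1 + \<bar>ln s\<bar>)) ^ k" by (intro power_mono) auto
    have p: "sinh s powr (2 * \<phi>) \<le> (K * s) powr (2 * \<phi>)"
      using sb pos assms by (intro powr_mono2) auto
    have "norm (log_branch \<phi> \<theta> (\<i> * of_real (sinh s)) - cnj (log_branch \<phi> \<theta> (\<i> * of_real (sinh s))))
      \<le> C * (sinh s powr (2 * \<phi>) * (1 + \<bar>ln (sinh s)\<bar>) ^ k)"
      using C(2)[OF pos] by (simp add: k_def)
    also have "\<dots> \<le> C * ((K * s) powr (2 * \<phi>) * ((1 + ln K) * (1 + \<bar>ln s\<bar>)) ^ k)"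
      using C(1) by (intro mult_left_mono mult_mono p l) auto
    also have "\<dots> = C * (K powr (2 * \<phi>) * (1 + ln K) ^ k) * (s powr (2 * \<phi>) * (1 + \<bar>ln s\<bar>) ^ k)"
      using K s by (simp add: powr_mult power_mult_distrib mult_ac)
    finally show "norm (log_branch \<phi> \<theta> (\<i> * of_real (sinh s)) - cnj (log_branch \<phi> \<theta> (\<i> * of_real (sinh s))))
       \<le> C * (K powr (2 * \<phi>) * (1 + ln K) ^ k) * (s powr (2 * \<phi>) * (1 + \<bar>ln s\<bar>) ^ log_exponent \<phi> \<theta>)"
      by (simp only: k_def)
  qed
qed

section \<open>Shift of the contour into the upper half plane\<close>

text \<open>For 0 < Re z < pi the real part of sin z is positive. On the vertical edges sin z is
  purely imaginary, hence off the cut except at the corners 0 and pi, where it vanishes.\<close>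

lemma Re_sin_upper_strip:
  assumes "0 \<le> Re z" "Re z \<le> pi" "0 \<le> Im z"
  shows "sin z = 0 \<or> sin z \<notin> \<real>\<^sub>\<le>\<^sub>0"
proof (cases "Re z = 0 \<or> Re z = pi")
  case False
  then have "Re (sin z) > 0" using assms by (intro Re_sin_pos) auto
  then show ?thesis by (auto simp: complex_nonpos_Reals_iff)
next
  case True
  show ?thesis
  proof (cases "Im z = 0")
    case False
    then have "exp (Im z) > exp (- Im z)" using assms by simp
    then have "Im (sin z) \<noteq> 0" using True by (auto simp: Im_sin)
    then show ?thesis by (auto simp: complex_nonpos_Reals_iff)
  next
    case z: True
    then have "z = of_real (Re z)" by (simp add: complex_eq_iff)
    then have "sin z = of_real (sin (Re z))" by (metis sin_of_real)
    then show ?thesis using True by auto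
  qed
qed

lemma sin_cos_ii:
  "sin (\<i> * of_real s) = \<i> * of_real (sinh s)" "cos (\<i> * of_real s) = of_real (cosh s)"
  "sin (of_real pi + \<i> * of_real s) = - (\<i> * of_real (sinh s))" "cos (of_real pi + \<i> * of_real s) = - of_real (cosh s)"
proof -
  show "sin (\<i> * of_real s) = \<i> * of_real (sinh s)" "cos (\<i> * of_real s) = of_real (cosh s)"
    by (simp_all add: sin_i_times cos_i_times sinh_field_def cosh_field_def exp_minus exp_of_real)
  then show "sin (of_real pi + \<i> * of_real s) = - (\<i> * of_real (sinh s))" "cos (of_real pi + \<i> * of_real s) = - of_real (cosh s)"
    by (simp_all only: sin_add cos_add sin_of_real cos_of_real) simp_all
qed

text \<open>Cauchy's theorem on the rectangle with vertices 0, pi, pi + i \<eta>, i \<eta>. The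
  branch points are the corners 0 and pi; continuity on the closed rectangle and differentiability
  inside it suffice. The error is the top edge, of length pi, on which the exponential has modulus
  \<open>exp (- (n * \<eta>))\<close>.\<close>

lemma exp_integral_rectangle:
  fixes g :: "complex \<Rightarrow> complex"
  assumes "\<phi> > 0" and \<eta>: "\<eta> > 0"
    and g: "\<And>z. 0 \<le> Re z \<Longrightarrow> Re z \<le> pi \<Longrightarrow> 0 \<le> Im z \<Longrightarrow> Im z \<le> \<eta> \<Longrightarrow> g field_differentiable at (cos z)"
  obtains M where "M > 0" "\<And>n.
    norm (integral {0..pi} (\<lambda>t. exp (\<i> * (of_nat n * of_real t)) * (g (cos (of_real t)) * log_branch \<phi> \<theta> (sin (of_real t))))
      - (\<i> * integral {0..\<eta>} (\<lambda>s. of_real (exp (- (real n * s))) * (g (of_real (cosh s)) * log_branch \<phi> \<theta> (\<i> * of_real (sinh s))))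
       - \<i> * (-1) ^ n * integral {0..\<eta>} (\<lambda>s. of_real (exp (- (real n * s))) * (g (- of_real (cosh s)) * cnj (log_branch \<phi> \<theta> (\<i> * of_real (sinh s)))))))
     \<le> M * exp (- (real n * \<eta>))"
proof -
  define h where "h z = g (cos z) * log_branch \<phi> \<theta> (sin z)" for z
  define S where "S = cbox 0 (Complex pi \<eta>)"
  have S: "z \<in> S \<longleftrightarrow> 0 \<le> Re z \<and> Re z \<le> pi \<and> 0 \<le> Im z \<and> Im z \<le> \<eta>" for z
    by (auto simp: S_def in_cbox_complex_iff)
  have intS: "z \<in> interior S \<longleftrightarrow> 0 < Re z \<and> Re z < pi \<and> 0 < Im z \<and> Im z < \<eta>" for z
    by (auto simp: S_def in_box_complex_iff)
  have hc: "continuous_on S h"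
    unfolding h_def
  proof (intro continuous_on_mult)
    show "continuous_on S (\<lambda>z. g (cos z))"
    proof (rule continuous_on_compose2[of "cos ` S" g])
      show "continuous_on (cos ` S) g"
        by (intro continuous_at_imp_continuous_on ballI) (auto intro!: field_differentiable_imp_continuous_at g simp: S)
    qed (auto intro!: continuous_intros)
    show "continuous_on S (\<lambda>z. log_branch \<phi> \<theta> (sin z))"
    proof (rule continuous_on_compose2[OF continuous_on_log_branch[OF assms(1)]])
      show "sin ` S \<subseteq> {w. w = 0 \<or> w \<notin> \<real>\<^sub>\<le>\<^sub>0}"
        using Re_sin_upper_strip S by blast
    qed (auto intro!: continuous_intros)
  qed
  have hd: "h field_differentiable at z" if "z \<in> interior S" for z
    unfolding h_def
  proof (intro field_differentiable_mult)
    have z: "0 < Re z" "Re z < pi" "0 < Im z" "Im z < \<eta>" using that by (auto simp: intS)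
    have "(g \<circ> cos) field_differentiable at z"
      using z by (intro field_differentiable_compose g) (auto intro: field_differentiable_at_cos)
    then show "(\<lambda>z. g (cos z)) field_differentiable at z" by (simp add: o_def)
    have "Re (sin z) > 0" using z by (intro Re_sin_pos)
    then have "sin z \<notin> \<real>\<^sub>\<le>\<^sub>0" by (auto simp: complex_nonpos_Reals_iff)
    then have "(log_branch \<phi> \<theta> \<circ> sin) field_differentiable at z"
      by (intro field_differentiable_compose field_differentiable_log_branch) (auto intro: field_differentiable_at_sin)
    then show "(\<lambda>z. log_branch \<phi> \<theta> (sin z)) field_differentiable at z" by (simp add: o_def)
  qed
  have "compact (h ` S)" by (intro compact_continuous_image hc) (simp add: S_def)
  then obtain B where B: "B > 0" "\<And>z. z \<in> S \<Longrightarrow> norm (h z) \<le> B"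
    using compact_imp_bounded[of "h ` S"] by (auto simp: bounded_pos)
  show ?thesis
  proof (rule that[of "B * pi"])
    show "B * pi > 0" using B by simp
    fix n :: nat
    define F where "F z = exp (\<i> * (of_nat n * z)) * h z" for z
    have Fc: "continuous_on S F" unfolding F_def by (intro continuous_intros hc)
    have "F field_differentiable at z" if "z \<in> interior S" for z
    proof -
      have "(\<lambda>z. exp (\<i> * (of_nat n * z))) field_differentiable at z"
        unfolding field_differentiable_def by (rule exI, (rule derivative_eq_intros refl)+)
      then show ?thesis unfolding F_def by (intro field_differentiable_mult hd that)
    qed
    note Fd = this
    define a1 a2 a3 a4 where "a1 = (0::complex)" and "a2 = Complex pi 0" and "a3 = Complex pi \<eta>" and "a4 = Complex 0 \<eta>"
    have cvx: "convex S" unfolding S_def by (rule convex_box)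
    have aS: "a1 \<in> S" "a2 \<in> S" "a3 \<in> S" "a4 \<in> S" using \<eta> by (auto simp: S a1_def a2_def a3_def a4_def)
    have seg: "continuous_on (closed_segment a b) F" if "a \<in> S" "b \<in> S" for a b
      by (rule continuous_on_subset[OF Fc closed_segment_subset[OF that cvx]])
    have rp: "rectpath a1 a3 = linepath a1 a2 +++ linepath a2 a3 +++ linepath a3 a4 +++ linepath a4 a1"
      by (simp add: rectpath_def Let_def a1_def a2_def a3_def a4_def)
    have "(F has_contour_integral 0) (rectpath a1 a3)"
    proof (rule Cauchy_theorem_convex[OF Fc cvx, of "{}"])
      show "path_image (rectpath a1 a3) \<subseteq> S"
        using path_image_rectpath_subset_cbox[of a1 a3] \<eta> by (simp add: S_def a1_def a3_def)
    qed (use Fd in auto)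
    then have "contour_integral (rectpath a1 a3) F = 0" by (rule contour_integral_unique)
    then have sum0: "contour_integral (linepath a1 a2) F + contour_integral (linepath a2 a3) F
       + contour_integral (linepath a3 a4) F + contour_integral (linepath a4 a1) F = 0"
      unfolding rp using aS
      by (simp add: seg contour_integrable_continuous_linepath add_ac)
    have c12: "contour_integral (linepath a1 a2) F = integral {0..pi} (\<lambda>t. F (of_real t))"
      using contour_integral_linepath_Reals_eq[of a1 a2 F] by (simp add: a1_def a2_def complex_is_Real_iff)
    have c23: "contour_integral (linepath a2 a3) F = \<i> * integral {0..\<eta>} (\<lambda>s. F (Complex pi s))"
      using \<eta> by (intro contour_integral_linepath_same_Re) (auto simp: a2_def a3_def)
    have "contour_integral (linepath a4 a1) F = - contour_integral (linepath a1 a4) F"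
      by (intro contour_integral_reverse_linepath seg aS)
    also have "contour_integral (linepath a1 a4) F = \<i> * integral {0..\<eta>} (\<lambda>s. F (Complex 0 s))"
      using \<eta> by (intro contour_integral_linepath_same_Re) (auto simp: a1_def a4_def)
    finally have c41: "contour_integral (linepath a4 a1) F = - (\<i> * integral {0..\<eta>} (\<lambda>s. F (Complex 0 s)))" .
    have c34: "norm (contour_integral (linepath a3 a4) F) \<le> (B * exp (- (real n * \<eta>))) * norm (a4 - a3)"
    proof (rule contour_integral_bound_linepath)
      show "F contour_integrable_on linepath a3 a4"
        using aS by (intro contour_integrable_continuous_linepath seg)
      fix z assume z: "z \<in> closed_segment a3 a4"
      then have "z \<in> S" using closed_segment_subset[OF aS(3,4) cvx] by blast
      moreover have "Im z = \<eta>" using z by (simp add: a3_def a4_def closed_segment_same_Im)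
      ultimately show "norm (F z) \<le> B * exp (- (real n * \<eta>))"
        using B by (simp add: F_def norm_mult norm_exp_eq_Re mult_ac)
    qed (use B in auto)
    have "norm (a4 - a3) = pi" by (simp add: a4_def a3_def norm_complex_def)
    note c34 = c34[unfolded this]
    have e0: "F (Complex 0 s) = of_real (exp (- (real n * s))) * (g (of_real (cosh s)) * log_branch \<phi> \<theta> (\<i> * of_real (sinh s)))" for s
    proof -
      have z: "Complex 0 s = \<i> * of_real s" by (simp add: complex_eq_iff)
      have "exp (\<i> * (of_nat n * (\<i> * of_real s))) = (of_real (exp (- (real n * s))) :: complex)"
      proof -
        have "\<i> * (of_nat n * (\<i> * of_real s)) = (of_real (- (real n * s)) :: complex)" by (simp add: algebra_simps)
        then show ?thesis by (metis exp_of_real)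
      qed
      then show ?thesis unfolding F_def h_def z sin_cos_ii by simp
    qed
    \<comment> \<open>On this edge sin z = - i sinh s is the conjugate of its value on the other
      edge, which turns the branch into its conjugate; the sign comes from
      \<open>exp (\<i> * n * pi)\<close>.\<close>
    have e1: "F (Complex pi s) = (-1) ^ n * (of_real (exp (- (real n * s))) * (g (- of_real (cosh s)) * cnj (log_branch \<phi> \<theta> (\<i> * of_real (sinh s)))))"
      if s: "s \<in> {0..\<eta>}" for s
    proof -
      have z: "Complex pi s = of_real pi + \<i> * of_real s" by (simp add: complex_eq_iff)
      have "exp (\<i> * (of_nat n * (of_real pi + \<i> * of_real s))) = (-1) ^ n * (of_real (exp (- (real n * s))) :: complex)"
      proof -
        have "\<i> * (of_nat n * (of_real pi + \<i> * of_real s)) = of_nat n * (\<i> * of_real pi) + (of_real (- (real n * s)) :: complex)"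
          by (simp add: algebra_simps)
        moreover have "exp (of_nat n * (\<i> * of_real pi)) = (-1) ^ n" by (simp add: exp_of_nat_mult)
        ultimately show ?thesis by (metis exp_add exp_of_real)
      qed
      moreover have "cnj (log_branch \<phi> \<theta> (\<i> * of_real (sinh s))) = log_branch \<phi> \<theta> (- (\<i> * of_real (sinh s)))"
        using s ii_times_nonpos_Reals(1)[of "sinh s"] by (subst cnj_log_branch) (auto simp: order_le_less)
      ultimately show ?thesis unfolding F_def h_def z sin_cos_ii by simp
    qed
    have i1: "integral {0..\<eta>} (\<lambda>s. F (Complex pi s)) =
       (-1) ^ n * integral {0..\<eta>} (\<lambda>s. of_real (exp (- (real n * s))) * (g (- of_real (cosh s)) * cnj (log_branch \<phi> \<theta> (\<i> * of_real (sinh s)))))"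
      by (subst integral_mult_right[symmetric]) (intro integral_cong e1)
    have "integral {0..pi} (\<lambda>t. F (of_real t)) - (\<i> * integral {0..\<eta>} (\<lambda>s. F (Complex 0 s)) - \<i> * integral {0..\<eta>} (\<lambda>s. F (Complex pi s)))
       = - contour_integral (linepath a3 a4) F"
      using sum0 unfolding c12 c23 c41 by (simp add: algebra_simps add_eq_0_iff)
    then have "norm (integral {0..pi} (\<lambda>t. F (of_real t)) - (\<i> * integral {0..\<eta>} (\<lambda>s. F (Complex 0 s)) - \<i> * integral {0..\<eta>} (\<lambda>s. F (Complex pi s))))
       \<le> B * pi * exp (- (real n * \<eta>))"
      using c34 by (simp add: mult_ac)
    then show "norm (integral {0..pi} (\<lambda>t. exp (\<i> * (of_nat n * of_real t)) * (g (cos (of_real t)) * log_branch \<phi> \<theta> (sin (of_real t))))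
      - (\<i> * integral {0..\<eta>} (\<lambda>s. of_real (exp (- (real n * s))) * (g (of_real (cosh s)) * log_branch \<phi> \<theta> (\<i> * of_real (sinh s))))
       - \<i> * (-1) ^ n * integral {0..\<eta>} (\<lambda>s. of_real (exp (- (real n * s))) * (g (- of_real (cosh s)) * cnj (log_branch \<phi> \<theta> (\<i> * of_real (sinh s)))))))
     \<le> B * pi * exp (- (real n * \<eta>))"
      unfolding i1 e0 by (simp add: F_def h_def mult_ac)
  qed
qed

lemma exp_decay_le_log_weight:
  assumes "p > 0" "\<eta> > 0"
  obtains C where "C > 0" "\<And>n. n \<ge> 1 \<Longrightarrow> exp (- (real n * \<eta>)) \<le> C * log_weight p k n"
proof -
  obtain C where C: "C > 0" "\<And>r. r > 0 \<Longrightarrow> r powr p \<le> C * exp (\<eta> * r)"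
    using powr_le_exp[OF assms] by blast
  show ?thesis
  proof (rule that[OF C(1)])
    fix n :: nat assume n: "n \<ge> 1"
    have "exp (- (real n * \<eta>)) \<le> C * (1 / real n powr p)"
      using C(2)[of "real n"] n by (simp add: exp_minus field_simps)
    also have "\<dots> \<le> C * log_weight p k n"
      unfolding log_weight_def using n C by (intro mult_left_mono divide_right_mono one_le_power) auto
    finally show "exp (- (real n * \<eta>)) \<le> C * log_weight p k n" .
  qed
qed

lemma integral_exp_decay_le:
  fixes a \<eta> :: real
  assumes "a > 0" "\<eta> \<ge> 0"
  shows "integral {0..\<eta>} (\<lambda>s. exp (- (a * s))) \<le> 1 / a"
proof -
  have "((\<lambda>s. exp (- (a * s))) has_integral (- exp (- (a * \<eta>)) / a - - exp (- (a * 0)) / a)) {0..\<eta>}"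
    using assms by (intro fundamental_theorem_of_calculus[where f = "\<lambda>s. - exp (- (a * s)) / a"])
      (auto intro!: derivative_eq_intros simp flip: has_real_derivative_iff_has_vector_derivative)
  then have "integral {0..\<eta>} (\<lambda>s. exp (- (a * s))) = 1 / a - exp (- (a * \<eta>)) / a"
    by (simp add: integral_unique)
  then show ?thesis using assms by simp
qed

text \<open>Twice the cosine is \<open>exp (\<i> n t)\<close> plus its conjugate. The part with
  \<open>exp (- \<i> n t)\<close> is the conjugate of an integral of the first kind for the
  reflection of g. On each vertical line the two contributions then carry the same values of g and
  conjugate values of the branch with opposite signs, so that only the jump
  \<open>E s - cnj (E s)\<close> remains.\<close>

lemma cos_integral_le_log_weight:
  fixes g :: "complex \<Rightarrow> complex"
  assumes \<phi>: "\<phi> > 0" and \<eta>: "\<eta> > 0"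
    and g: "\<And>z. 0 \<le> Re z \<Longrightarrow> Re z \<le> pi \<Longrightarrow> \<bar>Im z\<bar> \<le> \<eta> \<Longrightarrow> g field_differentiable at (cos z)"
  obtains C where "C > 0" "\<And>n. n \<ge> 1 \<Longrightarrow>
    norm (integral {0..pi} (\<lambda>t. of_real (cos (real n * t)) * (g (of_real (cos t)) * log_branch \<phi> \<theta> (of_real (sin t)))))
      \<le> C * log_weight (2 * \<phi> + 1) (log_exponent \<phi> \<theta>) n"
proof -
  define k where "k = log_exponent \<phi> \<theta>"
  \<comment> \<open>The Schwarz reflection of g; it is differentiable at the conjugate points, and
    the strip is symmetric.\<close>
  define gc where "gc = (\<lambda>z. cnj (g (cnj z)))"
  have gcd: "gc field_differentiable at (cos z)" if "0 \<le> Re z" "Re z \<le> pi" "\<bar>Im z\<bar> \<le> \<eta>" for z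
  proof -
    have "g field_differentiable at (cos (cnj z))" using that by (intro g) auto
    then have "g field_differentiable at (cnj (cos z))" by (simp add: cnj_cos)
    from field_differentiable_cnj_cnj[OF this] show ?thesis by (simp add: gc_def o_def)
  qed
  define E where "E s = log_branch \<phi> \<theta> (\<i> * of_real (sinh s))" for s :: real
  define e where "e n s = (of_real (exp (- (real n * s))) :: complex)" for n :: nat and s :: real
  obtain M1 where M1: "M1 > 0" "\<And>n.
    norm (integral {0..pi} (\<lambda>t. exp (\<i> * (of_nat n * of_real t)) * (g (cos (of_real t)) * log_branch \<phi> \<theta> (sin (of_real t))))
      - (\<i> * integral {0..\<eta>} (\<lambda>s. e n s * (g (of_real (cosh s)) * E s))
       - \<i> * (-1) ^ n * integral {0..\<eta>} (\<lambda>s. e n s * (g (- of_real (cosh s)) * cnj (E s)))))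
     \<le> M1 * exp (- (real n * \<eta>))"
    unfolding e_def E_def by (rule exp_integral_rectangle[OF \<phi> \<eta>, of g \<theta>]) (use g in auto)
  obtain M2 where M2: "M2 > 0" "\<And>n.
    norm (integral {0..pi} (\<lambda>t. exp (\<i> * (of_nat n * of_real t)) * (gc (cos (of_real t)) * log_branch \<phi> \<theta> (sin (of_real t))))
      - (\<i> * integral {0..\<eta>} (\<lambda>s. e n s * (gc (of_real (cosh s)) * E s))
       - \<i> * (-1) ^ n * integral {0..\<eta>} (\<lambda>s. e n s * (gc (- of_real (cosh s)) * cnj (E s)))))
     \<le> M2 * exp (- (real n * \<eta>))"
    unfolding e_def E_def by (rule exp_integral_rectangle[OF \<phi> \<eta>, of gc \<theta>]) (use gcd in auto)
  define G where "G = (\<lambda>t. g (of_real (cos t)) * log_branch \<phi> \<theta> (of_real (sin t)))"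
  have gcont: "continuous_on A (\<lambda>x. g (f x))"
    if cf: "continuous_on A f" and ex: "\<And>x. x \<in> A \<Longrightarrow> \<exists>z. f x = cos z \<and> 0 \<le> Re z \<and> Re z \<le> pi \<and> \<bar>Im z\<bar> \<le> \<eta>"
    for A :: "real set" and f
  proof (rule continuous_on_compose2[of "f ` A" g])
    show "continuous_on (f ` A) g"
    proof (intro continuous_at_imp_continuous_on ballI)
      fix w assume "w \<in> f ` A"
      then obtain z where "w = cos z" "0 \<le> Re z" "Re z \<le> pi" "\<bar>Im z\<bar> \<le> \<eta>" using ex by blast
      then show "isCont g w" using field_differentiable_imp_continuous_at[OF g[of z]] by simp
    qed
  qed (use cf in auto)
  have lbcont: "continuous_on A (\<lambda>x. log_branch \<phi> \<theta> (f x))"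
    if "continuous_on A f" "\<And>x. x \<in> A \<Longrightarrow> f x = 0 \<or> f x \<notin> \<real>\<^sub>\<le>\<^sub>0" for A :: "real set" and f
    by (rule continuous_on_compose2[OF continuous_on_log_branch[OF \<phi>]]) (use that in auto)
  have Gc: "continuous_on {0..pi} G"
    unfolding G_def
  proof (intro continuous_on_mult gcont lbcont continuous_intros)
    fix t assume t: "t \<in> {0..pi}"
    show "\<exists>z. of_real (cos t) = cos z \<and> 0 \<le> Re z \<and> Re z \<le> pi \<and> \<bar>Im z\<bar> \<le> \<eta>"
      using t \<eta> by (intro exI[of _ "of_real t"]) (auto simp: cos_of_real)
    show "complex_of_real (sin t) = 0 \<or> complex_of_real (sin t) \<notin> \<real>\<^sub>\<le>\<^sub>0"
      using t sin_ge_zero[of t] by auto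
  qed
  have Ec: "continuous_on {0..\<eta>} E"
    unfolding E_def
  proof (intro lbcont continuous_intros)
    fix s :: real assume "s \<in> {0..\<eta>}"
    then show "\<i> * of_real (sinh s) = 0 \<or> \<i> * of_real (sinh s) \<notin> \<real>\<^sub>\<le>\<^sub>0"
      using ii_times_nonpos_Reals(1)[of "sinh s"] by (cases "s = 0") auto
  qed
  have gp: "continuous_on {0..\<eta>} (\<lambda>s. g (of_real (cosh s)))"
  proof (intro gcont continuous_intros)
    fix s :: real assume "s \<in> {0..\<eta>}"
    then show "\<exists>z. of_real (cosh s) = cos z \<and> 0 \<le> Re z \<and> Re z \<le> pi \<and> \<bar>Im z\<bar> \<le> \<eta>"
      by (intro exI[of _ "\<i> * of_real s"]) (auto simp: sin_cos_ii)
  qed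
  have gm: "continuous_on {0..\<eta>} (\<lambda>s. g (- of_real (cosh s)))"
  proof (intro gcont continuous_intros)
    fix s :: real assume "s \<in> {0..\<eta>}"
    then show "\<exists>z. - of_real (cosh s) = cos z \<and> 0 \<le> Re z \<and> Re z \<le> pi \<and> \<bar>Im z\<bar> \<le> \<eta>"
      by (intro exI[of _ "of_real pi + \<i> * of_real s"]) (auto simp: sin_cos_ii)
  qed
  obtain B where B: "B > 0" "\<And>s. s \<in> {0..\<eta>} \<Longrightarrow> norm (g (of_real (cosh s))) \<le> B"
    using compact_imp_bounded[OF compact_continuous_image[OF gp]] by (auto simp: bounded_pos)
  obtain B' where B': "B' > 0" "\<And>s. s \<in> {0..\<eta>} \<Longrightarrow> norm (g (- of_real (cosh s))) \<le> B'"
    using compact_imp_bounded[OF compact_continuous_image[OF gm]] by (auto simp: bounded_pos)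
  obtain CE where CE: "CE > 0" "\<And>s. 0 < s \<Longrightarrow> s \<le> \<eta> \<Longrightarrow>
      norm (E s - cnj (E s)) \<le> CE * (s powr (2 * \<phi>) * (1 + \<bar>ln s\<bar>) ^ k)"
    using log_branch_sinh_jump_le[OF \<phi> \<eta>, of \<theta>] unfolding E_def k_def by blast
  obtain CL where CL: "CL > 0" "\<And>n s. n \<ge> 1 \<Longrightarrow> s > 0 \<Longrightarrow>
       exp (- (real n * s)) * s powr (2 * \<phi>) * (1 + \<bar>ln s\<bar>) ^ k \<le> CL * log_weight (2 * \<phi>) k n * exp (- (real n * s / 2))"
    using laplace_log_integrand_le[of "2 * \<phi>" k] \<phi> by auto
  obtain CX where CX: "CX > 0" "\<And>n. n \<ge> 1 \<Longrightarrow> exp (- (real n * \<eta>)) \<le> CX * log_weight (2 * \<phi> + 1) k n"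
    using exp_decay_le_log_weight[of "2 * \<phi> + 1" \<eta> k] \<phi> \<eta> by auto
  have jump: "norm (integral {0..\<eta>} (\<lambda>s. e n s * (c s * (E s - cnj (E s))))) \<le> 2 * D * CE * CL * log_weight (2 * \<phi> + 1) k n"
    if n: "n \<ge> 1" and c: "continuous_on {0..\<eta>} c" and D: "D > 0" "\<And>s. s \<in> {0..\<eta>} \<Longrightarrow> norm (c s) \<le> D" for n c D
  proof -
    have "norm (integral {0..\<eta>} (\<lambda>s. e n s * (c s * (E s - cnj (E s))))) \<le>
       integral {0..\<eta>} (\<lambda>s. D * CE * CL * log_weight (2 * \<phi>) k n * exp (- (real n / 2 * s)))"
    proof (rule integral_norm_bound_integral)
      show "(\<lambda>s. e n s * (c s * (E s - cnj (E s)))) integrable_on {0..\<eta>}"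
        unfolding e_def by (intro integrable_continuous_real continuous_intros c Ec)
      show "(\<lambda>s. D * CE * CL * log_weight (2 * \<phi>) k n * exp (- (real n / 2 * s))) integrable_on {0..\<eta>}"
        by (intro integrable_continuous_real continuous_intros)
      fix s assume s: "s \<in> {0..\<eta>}"
      show "norm (e n s * (c s * (E s - cnj (E s)))) \<le> D * CE * CL * log_weight (2 * \<phi>) k n * exp (- (real n / 2 * s))"
      proof (cases "s = 0")
        case True
        then show ?thesis using D CE CL log_weight_pos[OF n, of "2 * \<phi>" k] by (simp add: E_def)
      next
        case False
        then have s': "s > 0" "s \<le> \<eta>" using s by auto
        have "norm (e n s * (c s * (E s - cnj (E s)))) = norm (c s) * (exp (- (real n * s)) * norm (E s - cnj (E s)))"
          by (simp add: e_def norm_mult)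
        also have "\<dots> \<le> D * (exp (- (real n * s)) * (CE * (s powr (2 * \<phi>) * (1 + \<bar>ln s\<bar>) ^ k)))"
          using D s s' CE(2) by (intro mult_mono mult_left_mono) auto
        also have "\<dots> = D * CE * (exp (- (real n * s)) * s powr (2 * \<phi>) * (1 + \<bar>ln s\<bar>) ^ k)" by (simp add: mult_ac)
        also have "\<dots> \<le> D * CE * (CL * log_weight (2 * \<phi>) k n * exp (- (real n * s / 2)))"
          using D CE s' n by (intro mult_left_mono CL) auto
        finally show ?thesis by (simp add: mult_ac)
      qed
    qed
    also have "\<dots> = D * CE * CL * log_weight (2 * \<phi>) k n * integral {0..\<eta>} (\<lambda>s. exp (- (real n / 2 * s)))"
      by (rule integral_mult_right)
    also have "\<dots> \<le> D * CE * CL * log_weight (2 * \<phi>) k n * (1 / (real n / 2))"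
      using D CE CL log_weight_pos[OF n, of "2 * \<phi>" k] n \<eta> by (intro mult_left_mono integral_exp_decay_le) auto
    \<comment> \<open>The factor 1/n from integrating the exponential raises the exponent from 2
      \<phi> to 2 \<phi> + 1.\<close>
    also have "\<dots> = 2 * D * CE * CL * log_weight (2 * \<phi> + 1) k n"
      using n by (simp add: log_weight_def powr_add)
    finally show ?thesis .
  qed
  have main: "norm (integral {0..pi} (\<lambda>t. of_real (cos (real n * t)) * G t)) \<le>
     (2 * B * CE * CL + 2 * B' * CE * CL + (M1 + M2) * CX) * log_weight (2 * \<phi> + 1) k n" if n: "n \<ge> 1" for n
  proof -
    define ex where "ex t = exp (\<i> * (of_nat n * of_real t))" for t :: real
    have exc: "continuous_on A ex" for A unfolding ex_def by (intro continuous_intros)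
    define I1 where "I1 = integral {0..pi} (\<lambda>t. ex t * G t)"
    define I2 where "I2 = integral {0..pi} (\<lambda>t. ex t * (gc (of_real (cos t)) * log_branch \<phi> \<theta> (of_real (sin t))))"
    define P where "P = integral {0..\<eta>} (\<lambda>s. e n s * (g (of_real (cosh s)) * E s))"
    define Q where "Q = integral {0..\<eta>} (\<lambda>s. e n s * (g (- of_real (cosh s)) * cnj (E s)))"
    define P' where "P' = integral {0..\<eta>} (\<lambda>s. e n s * (gc (of_real (cosh s)) * E s))"
    define Q' where "Q' = integral {0..\<eta>} (\<lambda>s. e n s * (gc (- of_real (cosh s)) * cnj (E s)))"
    have 1: "norm (I1 - (\<i> * P - \<i> * (-1) ^ n * Q)) \<le> M1 * exp (- (real n * \<eta>))"
      using M1(2)[of n] by (simp add: I1_def P_def Q_def ex_def G_def sin_of_real cos_of_real)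
    have 2: "norm (I2 - (\<i> * P' - \<i> * (-1) ^ n * Q')) \<le> M2 * exp (- (real n * \<eta>))"
      using M2(2)[of n] by (simp add: I2_def P'_def Q'_def ex_def sin_of_real cos_of_real)
    have cI2: "cnj I2 = integral {0..pi} (\<lambda>t. cnj (ex t) * G t)"
    proof -
      have "cnj I2 = integral {0..pi} (\<lambda>t. cnj (ex t * (gc (of_real (cos t)) * log_branch \<phi> \<theta> (of_real (sin t)))))"
        unfolding I2_def by (rule Henstock_Kurzweil_Integration.integral_cnj)
      also have "\<dots> = integral {0..pi} (\<lambda>t. cnj (ex t) * G t)"
      proof (rule integral_cong)
        fix t assume "t \<in> {0..pi}"
        then have "complex_of_real (sin t) = 0 \<or> complex_of_real (sin t) \<notin> \<real>\<^sub>\<le>\<^sub>0"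
          using sin_ge_zero[of t] by auto
        from cnj_log_branch[OF this, of \<phi> \<theta>]
        show "cnj (ex t * (gc (of_real (cos t)) * log_branch \<phi> \<theta> (of_real (sin t)))) = cnj (ex t) * G t"
          by (simp add: gc_def G_def)
      qed
      finally show ?thesis .
    qed
    have cP: "cnj P' = integral {0..\<eta>} (\<lambda>s. e n s * (g (of_real (cosh s)) * cnj (E s)))"
      unfolding P'_def by (subst Henstock_Kurzweil_Integration.integral_cnj) (simp add: gc_def e_def)
    have cQ: "cnj Q' = integral {0..\<eta>} (\<lambda>s. e n s * (g (- of_real (cosh s)) * E s))"
      unfolding Q'_def by (subst Henstock_Kurzweil_Integration.integral_cnj) (simp add: gc_def e_def)
    have "P - cnj P' = integral {0..\<eta>} (\<lambda>s. e n s * (g (of_real (cosh s)) * E s) - e n s * (g (of_real (cosh s)) * cnj (E s)))"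
      unfolding P_def cP e_def
      by (intro integral_diff[symmetric] integrable_continuous_real continuous_intros gp Ec)
    then have dP: "P - cnj P' = integral {0..\<eta>} (\<lambda>s. e n s * (g (of_real (cosh s)) * (E s - cnj (E s))))"
      by (simp add: algebra_simps)
    have "cnj Q' - Q = integral {0..\<eta>} (\<lambda>s. e n s * (g (- of_real (cosh s)) * E s) - e n s * (g (- of_real (cosh s)) * cnj (E s)))"
      unfolding Q_def cQ e_def
      by (intro integral_diff[symmetric] integrable_continuous_real continuous_intros gm Ec)
    then have dQ: "cnj Q' - Q = integral {0..\<eta>} (\<lambda>s. e n s * (g (- of_real (cosh s)) * (E s - cnj (E s))))"
      by (simp add: algebra_simps)
    have nP: "norm (P - cnj P') \<le> 2 * B * CE * CL * log_weight (2 * \<phi> + 1) k n"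
      unfolding dP by (intro jump n gp B)
    have nQ: "norm (cnj Q' - Q) \<le> 2 * B' * CE * CL * log_weight (2 * \<phi> + 1) k n"
      unfolding dQ by (intro jump n gm B')
    have "I1 + cnj I2 = integral {0..pi} (\<lambda>t. ex t * G t + cnj (ex t) * G t)"
      unfolding I1_def cI2
      by (intro integral_add[symmetric] integrable_continuous_real continuous_intros exc Gc)
    also have "\<dots> = integral {0..pi} (\<lambda>t. 2 * (of_real (cos (real n * t)) * G t))"
    proof (rule integral_cong)
      fix t
      have "ex t = cis (real n * t)" by (simp add: ex_def cis_conv_exp)
      then have "ex t + cnj (ex t) = 2 * of_real (cos (real n * t))" by (simp add: complex_eq_iff)
      then show "ex t * G t + cnj (ex t) * G t = 2 * (of_real (cos (real n * t)) * G t)"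
        by (metis distrib_right mult.assoc)
    qed
    also have "\<dots> = 2 * integral {0..pi} (\<lambda>t. of_real (cos (real n * t)) * G t)" by (rule integral_mult_right)
    finally have "2 * norm (integral {0..pi} (\<lambda>t. of_real (cos (real n * t)) * G t)) = norm (I1 + cnj I2)"
      by (simp add: norm_mult)
    \<comment> \<open>The errors of both contour shifts are split off; the remaining terms are the
      jump integrals on the lines through 0 and through pi.\<close>
    also have "I1 + cnj I2 = (I1 - (\<i> * P - \<i> * (-1) ^ n * Q)) + cnj (I2 - (\<i> * P' - \<i> * (-1) ^ n * Q'))
        + \<i> * (P - cnj P') + \<i> * (-1) ^ n * (cnj Q' - Q)"
      by (simp add: algebra_simps)
    also have "norm \<dots> \<le> norm (I1 - (\<i> * P - \<i> * (-1) ^ n * Q)) + norm (cnj (I2 - (\<i> * P' - \<i> * (-1) ^ n * Q')))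
        + norm (\<i> * (P - cnj P')) + norm (\<i> * (-1) ^ n * (cnj Q' - Q))"
      by (intro norm_triangle_mono order_refl)
    also have "\<dots> \<le> M1 * exp (- (real n * \<eta>)) + M2 * exp (- (real n * \<eta>)) + 2 * B * CE * CL * log_weight (2 * \<phi> + 1) k n
       + 2 * B' * CE * CL * log_weight (2 * \<phi> + 1) k n"
      using 1 2 nP nQ unfolding complex_mod_cnj norm_mult norm_power by (intro add_mono) auto
    also have "\<dots> \<le> (M1 + M2) * (CX * log_weight (2 * \<phi> + 1) k n) + 2 * B * CE * CL * log_weight (2 * \<phi> + 1) k n
       + 2 * B' * CE * CL * log_weight (2 * \<phi> + 1) k n"
      unfolding distrib_right[symmetric, of M1 _ M2]
      using M1 M2 n by (intro add_mono mult_left_mono CX order_refl) auto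
    finally have "2 * norm (integral {0..pi} (\<lambda>t. of_real (cos (real n * t)) * G t)) \<le>
       (2 * B * CE * CL + 2 * B' * CE * CL + (M1 + M2) * CX) * log_weight (2 * \<phi> + 1) k n"
      by (simp add: algebra_simps)
    then show ?thesis using norm_ge_zero[of "integral {0..pi} (\<lambda>t. of_real (cos (real n * t)) * G t)"] by linarith
  qed
  show ?thesis
  proof (rule that)
    show "2 * B * CE * CL + 2 * B' * CE * CL + (M1 + M2) * CX > 0"
      using B B' CE CL M1 M2 CX by (intro add_pos_pos mult_pos_pos) auto
  qed (use main in \<open>simp add: G_def k_def\<close>)
qed

section \<open>Truncation errors from the decay of the coefficients\<close>

text \<open>Here b ranges over all sequences dominated by a, so that one constant D serves the
  series with terms a_n T_n(x) for every x at once; this makes the tail estimate uniform in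
  x.\<close>

lemma sum_tail_le:
  fixes a :: "nat \<Rightarrow> complex"
  assumes p: "p > 0" and a: "\<And>n. n \<ge> 1 \<Longrightarrow> norm (a n) \<le> C * log_weight (p + 1) k n"
  obtains D where "summable (\<lambda>n. norm (a n))" "D > 0"
    "\<And>N b S. N \<ge> 1 \<Longrightarrow> (\<And>n. norm (b n :: complex) \<le> norm (a n)) \<Longrightarrow> b sums S \<Longrightarrow>
       norm (S - (\<Sum>n\<le>N. b n)) \<le> D * log_weight p k N"
proof -
  obtain B where B: "B > 0"
    "\<And>N M. N \<ge> 1 \<Longrightarrow> (\<Sum>n\<in>{N<..M}. log_weight (p + 1) k n) \<le> B * log_weight p k N"
    using log_weight_tail[OF p] by blast
  define C' where "C' = \<bar>C\<bar> + 1"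
  have C': "C' > 0" by (simp add: C'_def)
  have tail: "(\<Sum>n\<in>{N<..M}. norm (a n)) \<le> C' * B * log_weight p k N" if N: "N \<ge> 1" for N M
  proof -
    have "(\<Sum>n\<in>{N<..M}. norm (a n)) \<le> (\<Sum>n\<in>{N<..M}. C' * log_weight (p + 1) k n)"
    proof (rule sum_mono)
      fix n assume n: "n \<in> {N<..M}"
      then have "norm (a n) \<le> C * log_weight (p + 1) k n" by (intro a) auto
      also have "\<dots> \<le> C' * log_weight (p + 1) k n"
        using log_weight_pos[of n "p + 1" k] n by (intro mult_right_mono) (auto simp: C'_def)
      finally show "norm (a n) \<le> C' * log_weight (p + 1) k n" .
    qed
    also have "\<dots> = C' * (\<Sum>n\<in>{N<..M}. log_weight (p + 1) k n)" by (simp add: sum_distrib_left)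
    also have "\<dots> \<le> C' * (B * log_weight p k N)" using C' by (intro mult_left_mono B N) auto
    finally show ?thesis by simp
  qed
  have sm: "summable (\<lambda>n. norm (a n))"
  proof (rule summableI_nonneg_bounded)
    fix M
    have "(\<Sum>i<M. norm (a i)) \<le> (\<Sum>i\<in>{..1} \<union> {1<..M}. norm (a i))"
      by (intro sum_mono2) auto
    also have "\<dots> = (\<Sum>i\<in>{..1}. norm (a i)) + (\<Sum>i\<in>{1<..M}. norm (a i))"
      by (intro sum.union_disjoint) auto
    also have "\<dots> \<le> (\<Sum>i\<in>{..1}. norm (a i)) + C' * B * log_weight p k 1"
      by (intro add_left_mono tail) auto
    finally show "(\<Sum>i<M. norm (a i)) \<le> (\<Sum>i\<in>{..1}. norm (a i)) + C' * B * log_weight p k 1" .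
  qed simp
  have "norm (S - (\<Sum>n\<le>N. b n)) \<le> (C' * B) * log_weight p k N"
    if N: "N \<ge> 1" and b: "\<And>n. norm (b n) \<le> norm (a n)" "b sums S" for N b and S :: complex
  proof -
    have "(\<lambda>M. \<Sum>n\<le>M. b n) \<longlonglongrightarrow> S"
      using b(2) by (simp add: sums_def_le)
    then have "(\<lambda>M. norm ((\<Sum>n\<le>M. b n) - (\<Sum>n\<le>N. b n))) \<longlonglongrightarrow> norm (S - (\<Sum>n\<le>N. b n))"
      by (intro tendsto_intros)
    then show ?thesis
    proof (rule tendsto_upperbound)
      show "\<forall>\<^sub>F M in sequentially. norm ((\<Sum>n\<le>M. b n) - (\<Sum>n\<le>N. b n)) \<le> C' * B * log_weight p k N"
        using eventually_ge_at_top[of N]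
      proof eventually_elim
        fix M assume M: "N \<le> M"
        have "{..M} = {..N} \<union> {N<..M}" using M by auto
        then have "(\<Sum>n\<le>M. b n) = (\<Sum>n\<in>{..N} \<union> {N<..M}. b n)" by simp
        also have "\<dots> = (\<Sum>n\<le>N. b n) + (\<Sum>n\<in>{N<..M}. b n)"
          by (intro sum.union_disjoint) auto
        finally have "(\<Sum>n\<le>M. b n) = (\<Sum>n\<le>N. b n) + (\<Sum>n\<in>{N<..M}. b n)" .
        then have "norm ((\<Sum>n\<le>M. b n) - (\<Sum>n\<le>N. b n)) \<le> (\<Sum>n\<in>{N<..M}. norm (b n))"
          by (simp add: norm_sum)
        also have "\<dots> \<le> (\<Sum>n\<in>{N<..M}. norm (a n))" by (intro sum_mono b)
        also have "\<dots> \<le> C' * B * log_weight p k N" by (rule tail[OF N])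
        finally show "norm ((\<Sum>n\<le>M. b n) - (\<Sum>n\<le>N. b n)) \<le> C' * B * log_weight p k N" .
      qed
    qed simp
  qed
  then show ?thesis
    using C' B sm by (intro that[of "C' * B"]) auto
qed

text \<open>Nonnegativity relies on the bound B: a supremum is above the value at x = 1 once the set
  is known to be bounded.\<close>

lemma max_err_bounds:
  assumes "\<And>x. x \<in> {-1..1} \<Longrightarrow> norm (f x - p x) \<le> B"
  shows "0 \<le> max_err f p" "max_err f p \<le> B"
proof -
  show "max_err f p \<le> B" unfolding max_err_def by (rule cSUP_least) (use assms in auto)
  have "bdd_above ((\<lambda>x. norm (f x - p x)) ` {-1..1})"
    by (rule bdd_aboveI2[of _ _ B]) (use assms in auto)
  then have "norm (f 1 - p 1) \<le> max_err f p"
    unfolding max_err_def by (intro cSUP_upper) auto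
  then show "0 \<le> max_err f p" using norm_ge_zero order_trans by blast
qed

section \<open>Boundary terms of the difference basis\<close>

text \<open>Collecting equal T_n gives b_{n-2} - b_n = a_n, except that for the two top indices N -
  1 and N the part - b_n is absent and has to be added back. For N = 1 the left side is empty, and
  b_0 = - a_0, b_1 = - a_1 cancel the Chebyshev part.\<close>

lemma diff_trunc_eq:
  assumes "N \<ge> 1"
  shows "diff_trunc u N x = cheb_trunc u N x + diff_coeff u (N - 1) * of_real (cheb_T (N - 1) x)
           + diff_coeff u N * of_real (cheb_T N x)"
proof -
  have "diff_trunc u (Suc m) x = cheb_trunc u (Suc m) x + diff_coeff u m * of_real (cheb_T m x)
           + diff_coeff u (Suc m) * of_real (cheb_T (Suc m) x)" for m
  proof (induction m)
    case 0
    then show ?case by (simp add: diff_trunc_def cheb_trunc_def)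
  next
    case (Suc m)
    have "diff_trunc u (Suc (Suc m)) x = diff_trunc u (Suc m) x + diff_coeff u m * of_real (cheb_T (Suc (Suc m)) x - cheb_T m x)"
      by (simp only: diff_trunc_def) (simp del: cheb_poly.simps)
    then show ?case unfolding Suc by (simp add: cheb_trunc_def algebra_simps del: cheb_poly.simps)
  qed
  from this[of "N - 1"] assms show ?thesis by (simp del: cheb_poly.simps)
qed

text \<open>As T_k(1) = 1 and T_k(-1) = (-1)^k, the right-hand sides are, up to sign, truncated
  Chebyshev series at 1 and -1. Where u vanishes, these are truncation errors.\<close>

lemma diff_coeff_partial_sums:
  "diff_coeff u (Suc n) + diff_coeff u n = - (\<Sum>k\<le>Suc n. cheb_coeff u k)"
  "diff_coeff u (Suc n) - diff_coeff u n = (-1) ^ n * (\<Sum>k\<le>Suc n. cheb_coeff u k * (-1) ^ k)"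
  by (induction n) (simp_all add: algebra_simps)

text \<open>The sum and the difference of two consecutive coefficients are the errors at 1 and -1 up
  to sign; both coefficients are recovered as half of the sum and half of the difference of
  these.\<close>

lemma norm_diff_coeff_le:
  assumes "n \<ge> 1" "u 1 = 0" "u (-1) = 0"
    and "norm (u 1 - cheb_trunc u n 1) \<le> B" "norm (u (-1) - cheb_trunc u n (-1)) \<le> B"
  shows "norm (diff_coeff u n) \<le> B" "norm (diff_coeff u (n - 1)) \<le> B"
proof -
  obtain m where m: "n = Suc m" using assms(1) by (cases n) auto
  define s d where "s = diff_coeff u (Suc m) + diff_coeff u m" and "d = diff_coeff u (Suc m) - diff_coeff u m"
  have "norm s \<le> B"
    using assms(2,4) unfolding s_def diff_coeff_partial_sums by (simp add: m cheb_trunc_def cheb_T_1 del: sum.atMost_Suc)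
  moreover have "norm d \<le> B"
    using assms(3,5) unfolding d_def diff_coeff_partial_sums by (simp add: m cheb_trunc_def cheb_T_minus_1 norm_mult norm_power del: sum.atMost_Suc)
  ultimately have sd: "norm (s + d) \<le> 2 * B" "norm (s - d) \<le> 2 * B"
    using norm_triangle_ineq[of s d] norm_triangle_ineq4[of s d] by linarith+
  have "s + d = 2 * diff_coeff u n" "s - d = 2 * diff_coeff u (n - 1)"
    by (simp_all add: s_def d_def m)
  then show "norm (diff_coeff u n) \<le> B" "norm (diff_coeff u (n - 1)) \<le> B"
    using sd by (simp_all add: norm_mult)
qed

section \<open>Recurrence between Chebyshev and quadratic factor coefficients\<close>

text \<open>With x = cos t this is sin^2 t = (1 - cos (2 t)) / 2 and the product formula for
  cosines. In the first two cases the lower index is negative and folds back by T_{-k} =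
  T_k.\<close>

lemma one_minus_square_mult_cheb_T:
  "(1 - x\<^sup>2) * cheb_T 0 x = (cheb_T 0 x - cheb_T 2 x) / 2"
  "(1 - x\<^sup>2) * cheb_T 1 x = (cheb_T 1 x - cheb_T 3 x) / 4"
  "(1 - x\<^sup>2) * cheb_T (n + 2) x = (2 * cheb_T (n + 2) x - cheb_T n x - cheb_T (n + 4) x) / 4"
proof -
  show "(1 - x\<^sup>2) * cheb_T 0 x = (cheb_T 0 x - cheb_T 2 x) / 2"
    by (simp add: numeral_2_eq_2 power2_eq_square algebra_simps)
  show "(1 - x\<^sup>2) * cheb_T 1 x = (cheb_T 1 x - cheb_T 3 x) / 4"
    by (simp add: numeral_3_eq_3 power2_eq_square algebra_simps)
  have T4: "cheb_T (n + 4) x = 2 * x * (2 * x * cheb_T (n + 2) x - cheb_T (n + 1) x) - cheb_T (n + 2) x"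
    by (simp add: numeral_eq_Suc algebra_simps)
  have "cheb_T (n + 2) x = 2 * x * cheb_T (n + 1) x - cheb_T n x" by simp
  then have T0: "cheb_T n x = 2 * x * cheb_T (n + 1) x - cheb_T (n + 2) x" by linarith
  have "(1 - x\<^sup>2) * b = (2 * b - (2 * x * a - b) - (2 * x * (2 * x * b - a) - b)) / 4" for a b :: real
    by (simp add: power2_eq_square algebra_simps)
  then show "(1 - x\<^sup>2) * cheb_T (n + 2) x = (2 * cheb_T (n + 2) x - cheb_T n x - cheb_T (n + 4) x) / 4"
    unfolding T4 T0 .
qed

context
  fixes u :: "real \<Rightarrow> complex"
  assumes v_int: "(\<lambda>t. u (cos t) / of_real (1 - (cos t)\<^sup>2)) absolutely_integrable_on {0..pi}"
    and u_ends: "u 1 = 0" "u (-1) = 0"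
begin

text \<open>The cosine integral of u / (1 - x^2) without the normalising factor, which is different
  at n = 0. Product formulas transfer to these integrals without distinguishing that case.\<close>

definition quad_int :: "nat \<Rightarrow> complex" where
  "quad_int n = integral {0..pi} (\<lambda>t. of_real (cos (real n * t)) * (u (cos t) / of_real (1 - (cos t)\<^sup>2)))"

lemma quad_coeff_eq: "quad_coeff u n = (if n = 0 then 1 / of_real pi else 2 / of_real pi) * quad_int n"
  unfolding quad_coeff_def quad_int_def by (rule cheb_coeff_eq_cos_integral[OF v_int])

text \<open>Where 1 - (cos t)^2 = 0 the quotient has the default value 0, and the identity survives
  because u vanishes at 1 and -1.\<close>

lemma u_eq_v: "t \<in> {0..pi} \<Longrightarrow> u (cos t) = of_real (1 - (cos t)\<^sup>2) * (u (cos t) / of_real (1 - (cos t)\<^sup>2))"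
proof (cases "(cos t)\<^sup>2 = 1")
  case True
  then have "cos t = 1 \<or> cos t = -1" by (simp add: power2_eq_1_iff)
  then show ?thesis using u_ends by auto
next
  case False
  then have "of_real (1 - (cos t)\<^sup>2) \<noteq> (0::complex)" by (metis eq_iff_diff_eq_0 of_real_eq_0_iff)
  then show ?thesis by simp
qed

lemma u_int: "(\<lambda>t. u (cos t)) absolutely_integrable_on {0..pi}"
proof -
  have c: "(1 - (cos t)\<^sup>2) = 1/2 - 1/2 * cos (2 * t)" for t :: real
    by (simp add: cos_double_cos diff_divide_distrib)
  have "(\<lambda>t. (1/2) *\<^sub>R (u (cos t) / of_real (1 - (cos t)\<^sup>2)) - (1/2) *\<^sub>R (of_real (cos (2 * t)) * (u (cos t) / of_real (1 - (cos t)\<^sup>2))))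
     absolutely_integrable_on {0..pi}"
    by (intro set_integral_diff(1) absolutely_integrable_scaleR_left absolutely_integrable_cos_mult v_int)
  then show ?thesis
  proof (rule absolutely_integrable_spike[of _ _ "{}"])
    fix t assume t: "t \<in> {0..pi} - {}"
    define w where "w = u (cos t) / of_real (1 - (cos t)\<^sup>2)"
    have "u (cos t) = of_real (1 - (cos t)\<^sup>2) * w"
      unfolding w_def using t by (intro u_eq_v) auto
    then have "u (cos t) = of_real (1/2 - 1/2 * cos (2 * t)) * w" unfolding c .
    then show "u (cos t) = (1/2) *\<^sub>R (u (cos t) / of_real (1 - (cos t)\<^sup>2)) - (1/2) *\<^sub>R (of_real (cos (2 * t)) * (u (cos t) / of_real (1 - (cos t)\<^sup>2)))"
      unfolding w_def[symmetric] by (simp add: scaleR_conv_of_real algebra_simps)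
  qed simp
qed

text \<open>Three free coefficients cover all shapes of the product formula for (1 - x^2) T_n; a
  term that does not occur gets coefficient 0.\<close>

lemma cos_int_combination:
  assumes "\<And>x. (1 - x\<^sup>2) * cheb_T n x = (c0 * cheb_T n0 x - c1 * cheb_T n1 x - c2 * cheb_T n2 x) / 4"
  shows "integral {0..pi} (\<lambda>t. of_real (cos (real n * t)) * u (cos t)) = (of_real c0 * quad_int n0 - of_real c1 * quad_int n1 - of_real c2 * quad_int n2) / 4"
proof -
  define w where "w t = u (cos t) / of_real (1 - (cos t)\<^sup>2)" for t
  have wi: "(\<lambda>t. of_real (cos (real m * t)) * w t) integrable_on {0..pi}" for m
    using absolutely_integrable_cos_mult[OF v_int, of "real m"] by (simp add: w_def absolutely_integrable_on_def)
  have "integral {0..pi} (\<lambda>t. of_real (cos (real n * t)) * u (cos t)) =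
     integral {0..pi} (\<lambda>t. of_real (c0 / 4) * (of_real (cos (real n0 * t)) * w t) - of_real (c1 / 4) * (of_real (cos (real n1 * t)) * w t)
        - of_real (c2 / 4) * (of_real (cos (real n2 * t)) * w t))"
  proof (rule integral_cong)
    fix t assume t: "t \<in> {0..pi}"
    have uw: "u (cos t) = of_real (1 - (cos t)\<^sup>2) * w t"
      using u_eq_v[OF t] by (simp only: w_def)
    have "of_real (cos (real n * t)) * u (cos t) = of_real ((1 - (cos t)\<^sup>2) * cheb_T n (cos t)) * w t"
      unfolding uw cheb_T_cos by (simp add: mult_ac)
    also have "\<dots> = of_real (c0 / 4) * (of_real (cos (real n0 * t)) * w t) - of_real (c1 / 4) * (of_real (cos (real n1 * t)) * w t)
        - of_real (c2 / 4) * (of_real (cos (real n2 * t)) * w t)"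
      unfolding assms unfolding cheb_T_cos by (simp add: algebra_simps diff_divide_distrib)
    finally show "of_real (cos (real n * t)) * u (cos t) = of_real (c0 / 4) * (of_real (cos (real n0 * t)) * w t) - of_real (c1 / 4) * (of_real (cos (real n1 * t)) * w t)
        - of_real (c2 / 4) * (of_real (cos (real n2 * t)) * w t)" .
  qed
  also have "\<dots> = integral {0..pi} (\<lambda>t. of_real (c0 / 4) * (of_real (cos (real n0 * t)) * w t) - of_real (c1 / 4) * (of_real (cos (real n1 * t)) * w t))
      - integral {0..pi} (\<lambda>t. of_real (c2 / 4) * (of_real (cos (real n2 * t)) * w t))"
    by (intro integral_diff integrable_diff integrable_on_mult_right wi)
  also have "integral {0..pi} (\<lambda>t. of_real (c0 / 4) * (of_real (cos (real n0 * t)) * w t) - of_real (c1 / 4) * (of_real (cos (real n1 * t)) * w t))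
     = integral {0..pi} (\<lambda>t. of_real (c0 / 4) * (of_real (cos (real n0 * t)) * w t)) - integral {0..pi} (\<lambda>t. of_real (c1 / 4) * (of_real (cos (real n1 * t)) * w t))"
    by (intro integral_diff integrable_on_mult_right wi)
  also have "\<dots> - integral {0..pi} (\<lambda>t. of_real (c2 / 4) * (of_real (cos (real n2 * t)) * w t)) =
      of_real (c0 / 4) * quad_int n0 - of_real (c1 / 4) * quad_int n1 - of_real (c2 / 4) * quad_int n2"
    unfolding quad_int_def w_def[symmetric] integral_mult_right ..
  finally show ?thesis by (simp add: diff_divide_distrib)
qed

text \<open>The irregular weights stem from the normalisation 1 / pi instead of 2 / pi at index 0:
  it halves the term with index 2 in the first equation and doubles the term with index 0 in the
  third.\<close>

lemma cheb_coeff_quad_coeff: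
  "cheb_coeff u 0 = quad_coeff u 0 / 2 - quad_coeff u 2 / 4"
  "cheb_coeff u 1 = (quad_coeff u 1 - quad_coeff u 3) / 4"
  "cheb_coeff u 2 = quad_coeff u 2 / 2 - quad_coeff u 0 / 2 - quad_coeff u 4 / 4"
  "cheb_coeff u (n + 3) = (2 * quad_coeff u (n + 3) - quad_coeff u (n + 1) - quad_coeff u (n + 5)) / 4"
proof -
  have eq: "cheb_coeff u m = (if m = 0 then 1 / of_real pi else 2 / of_real pi) *
     ((of_real c0 * quad_int n0 - of_real c1 * quad_int n1 - of_real c2 * quad_int n2) / 4)"
    if "\<And>x. (1 - x\<^sup>2) * cheb_T m x = (c0 * cheb_T n0 x - c1 * cheb_T n1 x - c2 * cheb_T n2 x) / 4" for m c0 n0 c1 n1 c2 n2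
    unfolding cos_int_combination[OF that, symmetric] by (rule cheb_coeff_eq_cos_integral[OF u_int])
  have p: "(1 - x\<^sup>2) * cheb_T 0 x = (2 * cheb_T 0 x - 2 * cheb_T 2 x - 0 * cheb_T 0 x) / 4"
    "(1 - x\<^sup>2) * cheb_T 1 x = (1 * cheb_T 1 x - 1 * cheb_T 3 x - 0 * cheb_T 0 x) / 4"
    "(1 - x\<^sup>2) * cheb_T 2 x = (2 * cheb_T 2 x - 1 * cheb_T 0 x - 1 * cheb_T 4 x) / 4"
    "(1 - x\<^sup>2) * cheb_T (n + 3) x = (2 * cheb_T (n + 3) x - 1 * cheb_T (n + 1) x - 1 * cheb_T (n + 5) x) / 4" for x
  proof -
    have n: "n + 1 + 2 = n + 3" "n + 1 + 4 = n + 5" by simp_all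
    show "(1 - x\<^sup>2) * cheb_T 0 x = (2 * cheb_T 0 x - 2 * cheb_T 2 x - 0 * cheb_T 0 x) / 4"
      unfolding one_minus_square_mult_cheb_T(1) by (simp only: diff_divide_distrib mult_zero_left)
    show "(1 - x\<^sup>2) * cheb_T 1 x = (1 * cheb_T 1 x - 1 * cheb_T 3 x - 0 * cheb_T 0 x) / 4"
      unfolding one_minus_square_mult_cheb_T(2) mult_1 mult_zero_left diff_zero ..
    show "(1 - x\<^sup>2) * cheb_T 2 x = (2 * cheb_T 2 x - 1 * cheb_T 0 x - 1 * cheb_T 4 x) / 4"
      unfolding one_minus_square_mult_cheb_T(3)[of x 0, unfolded add_0] mult_1 ..
    show "(1 - x\<^sup>2) * cheb_T (n + 3) x = (2 * cheb_T (n + 3) x - 1 * cheb_T (n + 1) x - 1 * cheb_T (n + 5) x) / 4"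
      unfolding one_minus_square_mult_cheb_T(3)[of x "n + 1", unfolded n] mult_1 ..
  qed
  show "cheb_coeff u 0 = quad_coeff u 0 / 2 - quad_coeff u 2 / 4"
    unfolding eq[OF p(1)] by (simp add: quad_coeff_eq diff_divide_distrib)
  show "cheb_coeff u 1 = (quad_coeff u 1 - quad_coeff u 3) / 4"
    unfolding eq[OF p(2)] by (simp add: quad_coeff_eq diff_divide_distrib right_diff_distrib)
  show "cheb_coeff u 2 = quad_coeff u 2 / 2 - quad_coeff u 0 / 2 - quad_coeff u 4 / 4"
    unfolding eq[OF p(3)] by (simp add: quad_coeff_eq diff_divide_distrib right_diff_distrib)
  show "cheb_coeff u (n + 3) = (2 * quad_coeff u (n + 3) - quad_coeff u (n + 1) - quad_coeff u (n + 5)) / 4"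
    unfolding eq[OF p(4)] by (simp add: quad_coeff_eq diff_divide_distrib right_diff_distrib)
qed

end

context
  fixes u :: "real \<Rightarrow> complex"
  assumes v_int: "(\<lambda>t. u (cos t) / of_real (1 - (cos t)\<^sup>2)) absolutely_integrable_on {0..pi}"
    and u_ends: "u 1 = 0" "u (-1) = 0"
begin

text \<open>Summation by parts moves the second difference from the T_n to the coefficients. What
  remains crosses the upper end: the terms with c_{m+3} and c_{m+4} enter the a_n but not the left
  side, those with T_{m+3} and T_{m+4} only the left side.\<close>

lemma quad_partial_sum_eq:
  "(\<Sum>n\<le>m + 2. quad_coeff u n * of_real ((1 - x\<^sup>2) * cheb_T n x)) = (\<Sum>n\<le>m + 2. cheb_coeff u n * of_real (cheb_T n x))
     + (quad_coeff u (m + 3) * of_real (cheb_T (m + 1) x) + quad_coeff u (m + 4) * of_real (cheb_T (m + 2) x)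
        - quad_coeff u (m + 1) * of_real (cheb_T (m + 3) x) - quad_coeff u (m + 2) * of_real (cheb_T (m + 4) x)) / 4"
proof (induction m)
  case 0
  have s: "(\<Sum>n\<le>0 + 2. f n) = f 0 + f 1 + f 2" for f :: "nat \<Rightarrow> complex" by (simp add: numeral_2_eq_2)
  show ?case
    unfolding s one_minus_square_mult_cheb_T(1,2) one_minus_square_mult_cheb_T(3)[of x 0, unfolded add_0] cheb_coeff_quad_coeff[OF v_int u_ends]
    by (simp add: algebra_simps add_divide_distrib diff_divide_distrib numeral_2_eq_2 del: cheb_poly.simps)
next
  case (Suc m)
  have n: "Suc m + 2 = Suc (m + 2)" "Suc (m + 2) = m + 3" "Suc m + 3 = m + 4" "Suc m + 4 = m + 5" "Suc m + 1 = m + 2" by simp_all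
  have e: "m + 1 + 2 = m + 3" "m + 1 + 4 = m + 5" by simp_all
  have T: "(1 - x\<^sup>2) * cheb_T (m + 3) x = (2 * cheb_T (m + 3) x - cheb_T (m + 1) x - cheb_T (m + 5) x) / 4"
    using one_minus_square_mult_cheb_T(3)[of x "m + 1"] unfolding e .
  have key: "(S + (q3 * of_real t1 + q4 * of_real t2 - q1 * of_real t3 - q2 * of_real t4) / 4) + q3 * of_real ((2 * t3 - t1 - t5) / 4)
     = (S + (2 * q3 - q1 - q5) / 4 * of_real t3) + (q4 * of_real t2 + q5 * of_real t3 - q2 * of_real t4 - q3 * of_real t5) / 4"
    for S q1 q2 q3 q4 q5 :: complex and t1 t2 t3 t4 t5 :: real
    by (simp add: algebra_simps add_divide_distrib diff_divide_distrib)
  show ?case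
    unfolding n(1) sum.atMost_Suc Suc.IH unfolding n T cheb_coeff_quad_coeff(4)[OF v_int u_ends]
    by (rule key)
qed

lemma norm_quad_coeff_le:
  assumes p: "p > 1"
    and a: "\<And>n. n \<ge> 1 \<Longrightarrow> norm (cheb_coeff u n) \<le> C * log_weight (p + 1) k n"
    and c: "continuous_on {-1..1} u"
  obtains D where "D > 0" "\<And>n. n \<ge> 1 \<Longrightarrow> norm (quad_coeff u n) \<le> D * log_weight (p - 1) k n"
proof -
  define q where "q = quad_coeff u"
  have q0: "q \<longlonglongrightarrow> 0"
    unfolding q_def quad_coeff_def[abs_def]
  proof (rule cheb_coeff_tendsto_0)
    have "continuous_on {-1..1} (\<lambda>x. of_real (1 - x\<^sup>2) * (u x / of_real (1 - x\<^sup>2))) = continuous_on {-1..1} u"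
    proof (rule continuous_on_cong[OF refl])
      fix x :: real
      show "of_real (1 - x\<^sup>2) * (u x / of_real (1 - x\<^sup>2)) = u x"
      proof (cases "x\<^sup>2 = 1")
        case True
        then have "x = 1 \<or> x = -1" by (simp add: power2_eq_1_iff)
        then show ?thesis using u_ends by auto
      next
        case False
        then have "of_real (1 - x\<^sup>2) \<noteq> (0::complex)" by (metis eq_iff_diff_eq_0 of_real_eq_0_iff)
        then show ?thesis by simp
      qed
    qed
    then show "continuous_on {-1..1} (\<lambda>x. of_real (1 - x\<^sup>2) * (u x / of_real (1 - x\<^sup>2)))"
      using c by simp
  qed (use v_int u_ends in auto)
  define d where "d n = q n - q (n + 2)" for n
  have d0: "d \<longlonglongrightarrow> 0"
    unfolding d_def using tendsto_diff[OF q0 LIMSEQ_ignore_initial_segment[OF q0, of 2]] by simp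
  define C' where "C' = 4 * \<bar>C\<bar> * (1 + ln (1 + real 2)) ^ k"
  have "norm (d n - d (n + 2)) \<le> C' * log_weight (p + 1) k n" if n: "n \<ge> 1" for n
  proof -
    obtain m where m: "n = m + 1" using n by (metis add.commute le_Suc_ex)
    \<comment> \<open>The second difference of the c with step 2 is -4 times the Chebyshev
      coefficient at the middle index n + 2 = m + 3.\<close>
    have "d n - d (n + 2) = - (4 * cheb_coeff u (m + 3))"
      unfolding cheb_coeff_quad_coeff(4)[OF v_int u_ends] d_def q_def m by (simp add: numeral_eq_Suc diff_divide_distrib)
    then have "norm (d n - d (n + 2)) = 4 * norm (cheb_coeff u (n + 2))"
      by (simp add: m norm_mult numeral_eq_Suc)
    also have "\<dots> \<le> 4 * (\<bar>C\<bar> * log_weight (p + 1) k (n + 2))"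
    proof -
      have "C * log_weight (p + 1) k (n + 2) \<le> \<bar>C\<bar> * log_weight (p + 1) k (n + 2)"
        using log_weight_pos[of "n + 2" "p + 1" k] by (intro mult_right_mono) auto
      with a[of "n + 2"] show ?thesis by auto
    qed
    also have "\<dots> \<le> 4 * (\<bar>C\<bar> * ((1 + ln (1 + real 2)) ^ k * log_weight (p + 1) k n))"
      using n p by (intro mult_left_mono log_weight_shift_le) auto
    finally show ?thesis by (simp add: C'_def mult_ac)
  qed
  then obtain D1 where D1: "D1 > 0" "\<And>n. n \<ge> 1 \<Longrightarrow> norm (d n) \<le> D1 * log_weight p k n"
    using norm_le_if_diff_le[of p d 1 C' k] d0 p by auto
  have "norm (q n - q (n + 2)) \<le> D1 * log_weight (p - 1 + 1) k n" if "n \<ge> 1" for n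
    using D1(2)[OF that] by (simp add: d_def)
  \<comment> \<open>The second summation needs a positive exponent p - 1; for p = 2 \<phi> this is
    \<phi> > 1/2.\<close>
  then obtain D where "D > 0" "\<And>n. n \<ge> 1 \<Longrightarrow> norm (q n) \<le> D * log_weight (p - 1) k n"
    using norm_le_if_diff_le[of "p - 1" q 1 D1 k] q0 p by auto
  then show ?thesis using that by (simp add: q_def)
qed

lemma truncation_errors_le:
  assumes p: "p > 1"
    and a: "\<And>n. n \<ge> 1 \<Longrightarrow> norm (cheb_coeff u n) \<le> C * log_weight (p + 1) k n"
    and c: "continuous_on {-1..1} u"
  obtains D where
    "\<And>N. N \<ge> 4 \<Longrightarrow> \<bar>max_err u (cheb_trunc u N)\<bar> \<le> D * log_weight p k N"
    "\<And>N. N \<ge> 4 \<Longrightarrow> \<bar>max_err u (diff_trunc u N)\<bar> \<le> D * log_weight p k N"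
    "\<And>N. N \<ge> 4 \<Longrightarrow> \<bar>max_err u (quad_trunc u N)\<bar> \<le> D * log_weight (p - 1) k N"
proof -
  have p0: "p > 0" using p by simp
  obtain D1 where sm: "summable (\<lambda>n. norm (cheb_coeff u n))"
    and D1: "D1 > 0" "\<And>N b S. N \<ge> 1 \<Longrightarrow> (\<And>n. norm (b n :: complex) \<le> norm (cheb_coeff u n)) \<Longrightarrow> b sums S \<Longrightarrow>
      norm (S - (\<Sum>n\<le>N. b n)) \<le> D1 * log_weight p k N"
  proof (rule sum_tail_le[OF p0 a])
    fix D
    assume D: "summable (\<lambda>n. norm (cheb_coeff u n))" "D > 0"
      "\<And>N b S. N \<ge> 1 \<Longrightarrow> (\<And>n. norm (b n :: complex) \<le> norm (cheb_coeff u n)) \<Longrightarrow> b sums S \<Longrightarrow>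
         norm (S - (\<Sum>n\<le>N. b n)) \<le> D * log_weight p k N"
    show thesis by (rule that[OF D])
  qed auto
  obtain D2 where D2: "D2 > 0" "\<And>n. n \<ge> 1 \<Longrightarrow> norm (quad_coeff u n) \<le> D2 * log_weight (p - 1) k n"
    using norm_quad_coeff_le[OF p a c] by blast
  have T1: "norm (z * of_real (cheb_T n x)) \<le> norm z" if "x \<in> {-1..1}" for z :: complex and n x
    using abs_cheb_T_le_1[OF that, of n] by (simp add: norm_mult mult_left_le)
  have E: "norm (u x - cheb_trunc u N x) \<le> D1 * log_weight p k N" if N: "N \<ge> 1" and x: "x \<in> {-1..1}" for N x
    unfolding cheb_trunc_def using x by (intro D1 N T1 cheb_series_sums[OF c sm]) auto
  have Ed: "norm (u x - diff_trunc u N x) \<le> 3 * D1 * log_weight p k N" if N: "N \<ge> 1" and x: "x \<in> {-1..1}" for N x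
  proof -
    have b: "norm (diff_coeff u N) \<le> D1 * log_weight p k N" "norm (diff_coeff u (N - 1)) \<le> D1 * log_weight p k N"
      using norm_diff_coeff_le[OF N u_ends] E[OF N] by auto
    have "norm (u x - diff_trunc u N x) = norm ((u x - cheb_trunc u N x) - diff_coeff u (N - 1) * of_real (cheb_T (N - 1) x)
           - diff_coeff u N * of_real (cheb_T N x))"
      unfolding diff_trunc_eq[OF N] by (simp add: algebra_simps)
    also have "\<dots> \<le> norm (u x - cheb_trunc u N x) + norm (diff_coeff u (N - 1) * of_real (cheb_T (N - 1) x))
        + norm (diff_coeff u N * of_real (cheb_T N x))"
      by (rule order.trans[OF norm_triangle_ineq4 add_right_mono[OF norm_triangle_ineq4]])
    also have "\<dots> \<le> D1 * log_weight p k N + D1 * log_weight p k N + D1 * log_weight p k N"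
      by (intro add_mono E N x order.trans[OF T1[OF x]] b)
    finally show ?thesis by simp
  qed
  \<comment> \<open>Bounds the cost of moving an index back by at most three, for any exponent
    between 0 and p.\<close>
  define K where "K = (1 + real 3) powr p"
  have K: "K > 0" by (simp add: K_def)
  have mono: "log_weight p' k (N - j) \<le> K * log_weight p' k N" if "0 \<le> p'" "p' \<le> p" "N \<ge> 4" "j \<le> 3" for p' j N
  proof -
    have "log_weight p' k (N - j) \<le> (1 + real j) powr p' * log_weight p' k (N - j + j)"
      using that by (intro log_weight_le_shift) auto
    also have "N - j + j = N" using that by simp
    also have "(1 + real j) powr p' \<le> (1 + real 3) powr p'" using that by (intro powr_mono2) auto
    also have "\<dots> \<le> K" unfolding K_def using that by (intro powr_mono) auto
    finally show ?thesis using that log_weight_pos[of N p' k] by (simp add: mult_right_mono)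
  qed
  have Eq: "norm (u x - quad_trunc u N x) \<le> (D1 * K + D2 * K) * log_weight (p - 1) k N" if N: "N \<ge> 4" and x: "x \<in> {-1..1}" for N x
  proof -
    obtain m where m: "N = m + 4" using N by (metis add.commute le_Suc_ex)
    define q where "q = quad_coeff u"
    have q: "norm (q (N - j)) \<le> D2 * (K * log_weight (p - 1) k N)" if "j \<le> 3" for j
    proof -
      have "norm (q (N - j)) \<le> D2 * log_weight (p - 1) k (N - j)" unfolding q_def using N that by (intro D2) auto
      also have "\<dots> \<le> D2 * (K * log_weight (p - 1) k N)" using D2(1) N p that by (intro mult_left_mono mono) auto
      finally show ?thesis .
    qed
    have qT: "norm (q (m + 3) * of_real (cheb_T (m + 1) x)) \<le> D2 * (K * log_weight (p - 1) k N)"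
      "norm (q (m + 4) * of_real (cheb_T (m + 2) x)) \<le> D2 * (K * log_weight (p - 1) k N)"
      "norm (q (m + 1) * of_real (cheb_T (m + 3) x)) \<le> D2 * (K * log_weight (p - 1) k N)"
      "norm (q (m + 2) * of_real (cheb_T (m + 4) x)) \<le> D2 * (K * log_weight (p - 1) k N)"
    proof -
      have nj: "N - 1 = m + 3" "N - 0 = m + 4" "N - 3 = m + 1" "N - 2 = m + 2" by (simp_all add: m)
      show "norm (q (m + 3) * of_real (cheb_T (m + 1) x)) \<le> D2 * (K * log_weight (p - 1) k N)"
        "norm (q (m + 4) * of_real (cheb_T (m + 2) x)) \<le> D2 * (K * log_weight (p - 1) k N)"
        "norm (q (m + 1) * of_real (cheb_T (m + 3) x)) \<le> D2 * (K * log_weight (p - 1) k N)"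
        "norm (q (m + 2) * of_real (cheb_T (m + 4) x)) \<le> D2 * (K * log_weight (p - 1) k N)"
        using q[of 1] q[of 0] q[of 3] q[of 2] unfolding nj by (auto intro!: order.trans[OF T1[OF x]] simp del: cheb_poly.simps)
    qed
    define r where "r = q (m + 3) * of_real (cheb_T (m + 1) x) + q (m + 4) * of_real (cheb_T (m + 2) x)
        - q (m + 1) * of_real (cheb_T (m + 3) x) - q (m + 2) * of_real (cheb_T (m + 4) x)"
    have "norm r \<le> norm (q (m + 3) * of_real (cheb_T (m + 1) x)) + norm (q (m + 4) * of_real (cheb_T (m + 2) x))
        + norm (q (m + 1) * of_real (cheb_T (m + 3) x)) + norm (q (m + 2) * of_real (cheb_T (m + 4) x))"
      unfolding r_def
      by (rule order.trans[OF norm_triangle_ineq4 add_right_mono[OF order.trans[OF norm_triangle_ineq4 add_right_mono[OF norm_triangle_ineq]]]])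
    then have r: "norm r \<le> 4 * (D2 * (K * log_weight (p - 1) k N))" using qT by linarith
    \<comment> \<open>With N = m + 4 the last index N - 2 is m + 2, and all four boundary
      coefficients have index at least 1, where their decay bound applies.\<close>
    have "{..<N - 1} = {..m + 2}" by (auto simp: m)
    then have "quad_trunc u N x = cheb_trunc u (m + 2) x + r / 4"
      unfolding quad_trunc_def cheb_trunc_def r_def q_def using quad_partial_sum_eq[of x m] by simp
    then have "norm (u x - quad_trunc u N x) = norm ((u x - cheb_trunc u (m + 2) x) - r / 4)"
      by (simp add: algebra_simps)
    also have "\<dots> \<le> norm (u x - cheb_trunc u (m + 2) x) + norm r / 4"
      by (rule order.trans[OF norm_triangle_ineq4]) simp
    also have "norm (u x - cheb_trunc u (m + 2) x) \<le> D1 * log_weight p k (m + 2)"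
      by (intro E x) auto
    \<comment> \<open>The Chebyshev error is smaller by a whole power and is weakened to the order
      of the boundary terms.\<close>
    also have "log_weight p k (m + 2) \<le> log_weight (p - 1) k (m + 2)"
      unfolding log_weight_def by (intro divide_left_mono powr_mono) auto
    also have "log_weight (p - 1) k (m + 2) \<le> K * log_weight (p - 1) k N"
      using mono[of "p - 1" N 2] p N by (simp add: m)
    finally show ?thesis using r D1(1) by (simp add: algebra_simps)
  qed
  define D where "D = 3 * D1 + D1 * K + D2 * K"
  have D: "D1 \<le> D" "3 * D1 \<le> D" "D1 * K + D2 * K \<le> D" using D1(1) D2(1) K by (auto simp: D_def)
  show ?thesis
  proof (rule that[of D])
    fix N :: nat assume N: "N \<ge> 4"
    have le: "D' * log_weight p' k N \<le> D * log_weight p' k N" if "D' \<le> D" for D' p'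
      using that log_weight_pos[of N p' k] N by (intro mult_right_mono) auto
    show "\<bar>max_err u (cheb_trunc u N)\<bar> \<le> D * log_weight p k N"
      using max_err_bounds[OF E[of N]] le[OF D(1), of p] N by force
    show "\<bar>max_err u (diff_trunc u N)\<bar> \<le> D * log_weight p k N"
      using max_err_bounds[OF Ed[of N]] le[OF D(2), of p] N by force
    show "\<bar>max_err u (quad_trunc u N)\<bar> \<le> D * log_weight (p - 1) k N"
      using max_err_bounds[OF Eq[of N]] le[OF D(3), of "p - 1"] N by force
  qed
qed

end

section \<open>The slowly varying factor\<close>

lemma Digamma_plus_nat_le:
  fixes x :: real
  assumes "x \<ge> 1"
  shows "Digamma (x + real K) \<le> Digamma x + real K"
proof (induction K)
  case (Suc K)
  have "Digamma (x + real (Suc K)) = Digamma (x + real K) + 1 / (x + real K)"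
    using Digamma_plus1[of "x + real K"] assms by (simp add: add_ac)
  moreover have "1 / (x + real K) \<le> 1" using assms by simp
  ultimately show ?case using Suc by simp
qed simp

text \<open>At an integer n the Digamma function is the harmonic number of n - 1 minus Euler's
  constant, and harmonic numbers differ boundedly from the logarithm. A real shift a is enclosed
  between integer shifts by monotonicity; the threshold |a| + 2 keeps n - K above 1.\<close>

lemma Digamma_minus_ln_bounded:
  fixes a :: real
  obtains C where "\<And>n. real n \<ge> \<bar>a\<bar> + 2 \<Longrightarrow> \<bar>Digamma (real n + a) - ln (real n)\<bar> \<le> C"
proof -
  have "convergent (\<lambda>n. harm n - of_real (ln (of_nat n)) :: real)"
    using euler_mascheroni_convergent by simp
  then obtain B where B: "\<And>n. \<bar>harm n - ln (real n)\<bar> \<le> B"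
    using convergent_imp_Bseq[of "\<lambda>n. harm n - ln (real n) :: real"] by (auto simp: Bseq_def)
  define K where "K = nat \<lceil>\<bar>a\<bar>\<rceil>"
  have K: "\<bar>a\<bar> \<le> real K" "real K < \<bar>a\<bar> + 1" unfolding K_def by linarith+
  show ?thesis
  proof (rule that[of "B + \<bar>euler_mascheroni\<bar> + 1 + real K"])
    fix n :: nat assume n: "real n \<ge> \<bar>a\<bar> + 2"
    then obtain m where m: "n = Suc m" by (cases n) auto
    have "Digamma (real n) = harm m - euler_mascheroni" using Digamma_of_nat[of m, where 'a = real] by (simp add: m)
    moreover have "harm n = harm m + inverse (real n)" by (simp add: m harm_Suc)
    moreover have "inverse (real n) \<le> 1" "inverse (real n) \<ge> 0" using n by (auto simp: field_simps)
    ultimately have 1: "\<bar>Digamma (real n) - ln (real n)\<bar> \<le> B + \<bar>euler_mascheroni\<bar> + 1"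
      using B[of n] by linarith
    have "Digamma (real n + a) \<le> Digamma (real n + real K)" using K n by (intro Digamma_real_mono) auto
    also have "\<dots> \<le> Digamma (real n) + real K" using n by (intro Digamma_plus_nat_le) auto
    finally have 2: "Digamma (real n + a) \<le> Digamma (real n) + real K" .
    have "Digamma (real n) \<le> Digamma ((real n - real K) + real K)" by simp
    also have "\<dots> \<le> Digamma (real n - real K) + real K" using n K by (intro Digamma_plus_nat_le) auto
    also have "Digamma (real n - real K) \<le> Digamma (real n + a)" using K n by (intro Digamma_real_mono) auto
    finally have "Digamma (real n) \<le> Digamma (real n + a) + real K" by simp
    with 1 2 show "\<bar>Digamma (real n + a) - ln (real n)\<bar> \<le> B + \<bar>euler_mascheroni\<bar> + 1 + real K" by linarith
  qed
qed

text \<open>For odd order the function is positive and decreasing, for even order negative and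
  increasing, so its modulus decreases in both cases.\<close>

lemma abs_Polygamma_le:
  fixes x :: real
  assumes "x \<ge> 1" "i \<ge> 1"
  shows "\<bar>Polygamma i x\<bar> \<le> \<bar>Polygamma i 1\<bar>"
proof (cases "even i")
  case True
  then have "Polygamma i 1 \<le> Polygamma i x" "Polygamma i x < 0"
    using assms by (auto intro!: Polygamma_real_mono Polygamma_real_even_neg)
  then show ?thesis by linarith
next
  case False
  then have "Polygamma i x \<le> Polygamma i 1" "Polygamma i x > 0"
    using assms Polygamma_real_strict_antimono[of 1 x i] by (cases "x = 1"; auto intro!: Polygamma_real_odd_pos)+
  then show ?thesis by linarith
qed

text \<open>The i-th derivative of the logarithmic derivative of Gamma (2 t + 1) Gamma (n - t) /
  Gamma (n + t + 1), the Beta factor; the powers of 2 and -1 come from the chain rule.\<close>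

definition beta_log_deriv :: "nat \<Rightarrow> nat \<Rightarrow> real \<Rightarrow> real" where
  "beta_log_deriv n i t = 2 ^ Suc i * Polygamma i (2 * t + 1) - (-1) ^ i * Polygamma i (real n - t) - Polygamma i (real n + t + 1)"

lemma gamma1_eq: "gamma1 \<phi> n = beta_log_deriv n 0 \<phi>"
  and gamma2_eq: "gamma2 \<phi> n = beta_log_deriv n 1 \<phi>"
  by (simp_all add: gamma1_def gamma2_def beta_log_deriv_def)

lemma has_field_derivative_beta_log_deriv:
  assumes "t \<in> {0<..<real n}"
  shows "(beta_log_deriv n i has_field_derivative beta_log_deriv n (Suc i) t) (at t)"
proof -
  have nn: "2 * t + 1 \<notin> \<int>\<^sub>\<le>\<^sub>0" "real n - t \<notin> \<int>\<^sub>\<le>\<^sub>0" "real n + t + 1 \<notin> \<int>\<^sub>\<le>\<^sub>0"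
    using assms by (auto elim!: nonpos_Ints_cases)
  show ?thesis
    unfolding beta_log_deriv_def[abs_def]
    by (rule derivative_eq_intros nn refl | simp)+
qed

lemma has_field_derivative_Beta_shift:
  assumes "t \<in> {0<..<real n}"
  shows "((\<lambda>t. Beta (2 * t + 1) (real n - t)) has_field_derivative Beta (2 * t + 1) (real n - t) * beta_log_deriv n 0 t) (at t)"
proof -
  have nn: "2 * t + 1 \<notin> \<int>\<^sub>\<le>\<^sub>0" "real n - t \<notin> \<int>\<^sub>\<le>\<^sub>0" "real n + t + 1 \<notin> \<int>\<^sub>\<le>\<^sub>0"
    using assms by (auto elim!: nonpos_Ints_cases)
  have B: "Beta (2 * t + 1) (real n - t) = Gamma (2 * t + 1) * Gamma (real n - t) / Gamma (real n + t + 1)" for t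
  proof -
    have "2 * t + 1 + (real n - t) = real n + t + 1" by simp
    then show ?thesis by (simp only: Beta_def)
  qed
  have "Gamma (real n + t + 1) \<noteq> 0" using nn by (simp add: Gamma_eq_zero_iff)
  then show ?thesis
    unfolding B
  proof (intro DERIV_cong[OF DERIV_divide[OF DERIV_mult]])
    have G: "((\<lambda>t. Gamma (f t)) has_field_derivative Gamma (f t) * Digamma (f t) * f') (at t)"
      if "(f has_field_derivative f') (at t)" "f t \<notin> \<int>\<^sub>\<le>\<^sub>0" for f f'
      by (rule DERIV_chain2[OF _ that(1)]) (rule has_field_derivative_Gamma[OF that(2)])
    show "((\<lambda>t. Gamma (2 * t + 1)) has_field_derivative Gamma (2 * t + 1) * Digamma (2 * t + 1) * 2) (at t)"
      by (rule G[where f = "\<lambda>t. 2 * t + 1"]) (use nn in \<open>auto intro!: derivative_eq_intros\<close>)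
    show "((\<lambda>t. Gamma (real n - t)) has_field_derivative Gamma (real n - t) * Digamma (real n - t) * (- 1)) (at t)"
      by (rule G[where f = "\<lambda>t. real n - t"]) (use nn in \<open>auto intro!: derivative_eq_intros\<close>)
    show "((\<lambda>t. Gamma (real n + t + 1)) has_field_derivative Gamma (real n + t + 1) * Digamma (real n + t + 1) * 1) (at t)"
      by (rule G[where f = "\<lambda>t. real n + t + 1"]) (use nn in \<open>auto intro!: derivative_eq_intros\<close>)
  qed (simp_all add: beta_log_deriv_def field_simps)
qed

section \<open>Derivatives of the Beta factor of arbitrary order\<close>

text \<open>The Leibniz rule for f' = f * D 0. Differentiability of the m-th derivative is not known
  beforehand: it follows from the formula expressing it by lower derivatives, so both claims are
  proved in one strong induction.\<close>

lemma higher_deriv_log_deriv: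
  fixes f :: "real \<Rightarrow> real" and D :: "nat \<Rightarrow> real \<Rightarrow> real"
  assumes U: "open U"
    and f: "\<And>t. t \<in> U \<Longrightarrow> (f has_field_derivative f t * D 0 t) (at t)"
    and D: "\<And>i t. t \<in> U \<Longrightarrow> (D i has_field_derivative D (Suc i) t) (at t)"
    and t: "t \<in> U"
  shows "(deriv ^^ Suc m) f t = (\<Sum>i\<le>m. real (m choose i) * (deriv ^^ (m - i)) f t * D i t)"
proof -
  define G where "G m = (deriv ^^ m) f" for m
  have GS: "G (Suc m) t = deriv (G m) t" for m t by (simp add: G_def)
  have "\<forall>t\<in>U. (G m has_field_derivative G (Suc m) t) (at t) \<and> G (Suc m) t = (\<Sum>i\<le>m. real (m choose i) * G (m - i) t * D i t)"
  proof (induction m rule: less_induct)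
    case (less m)
    show ?case
    proof (cases m)
      case 0
      have "G (Suc 0) t = f t * D 0 t" if "t \<in> U" for t
        using DERIV_imp_deriv[OF f[OF that]] by (simp add: G_def)
      then show ?thesis using f by (simp add: 0 G_def)
    next
      case (Suc l)
      show ?thesis
      proof (rule ballI)
        fix t assume t: "t \<in> U"
        have IH: "(G j has_field_derivative G (Suc j) t) (at t)" if "j \<le> l" for j
          using less.IH[of j] that t Suc by auto
        have "((\<lambda>t. \<Sum>i\<le>l. real (l choose i) * G (l - i) t * D i t) has_field_derivative
            (\<Sum>i\<le>l. real (l choose i) * G (Suc (l - i)) t * D i t + real (l choose i) * G (l - i) t * D (Suc i) t)) (at t)"
          using t by (auto intro!: derivative_eq_intros DERIV_sum IH D)
        then have der: "(G m has_field_derivative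
            (\<Sum>i\<le>l. real (l choose i) * G (Suc (l - i)) t * D i t + real (l choose i) * G (l - i) t * D (Suc i) t)) (at t)"
          by (rule has_field_derivative_transform_within_open[OF _ U t]) (use less.IH[of l] Suc in auto)
        have "(\<Sum>i\<le>l. real (l choose i) * G (Suc (l - i)) t * D i t + real (l choose i) * G (l - i) t * D (Suc i) t)
           = (\<Sum>i\<le>l. real (l choose i) * G (Suc l - i) t * D i t) + (\<Sum>i\<le>l. real (l choose i) * G (l - i) t * D (Suc i) t)"
          by (simp add: sum.distrib Suc_diff_le)
        also have "(\<Sum>i\<le>l. real (l choose i) * G (Suc l - i) t * D i t) = G (Suc l) t * D 0 t + (\<Sum>i<l. real (l choose Suc i) * G (l - i) t * D (Suc i) t)"
          unfolding lessThan_Suc_atMost[symmetric] sum.lessThan_Suc_shift by simp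
        \<comment> \<open>The added summand i = l vanishes because
          \<open>l choose Suc l = 0\<close>; with equal ranges Pascal's rule joins the two
          sums.\<close>
        also have "(\<Sum>i<l. real (l choose Suc i) * G (l - i) t * D (Suc i) t) = (\<Sum>i\<le>l. real (l choose Suc i) * G (l - i) t * D (Suc i) t)"
          unfolding lessThan_Suc_atMost[symmetric] by simp
        also have "G (Suc l) t * D 0 t + (\<Sum>i\<le>l. real (l choose Suc i) * G (l - i) t * D (Suc i) t) + (\<Sum>i\<le>l. real (l choose i) * G (l - i) t * D (Suc i) t)
          = G (Suc l) t * D 0 t + (\<Sum>i\<le>l. real (Suc l choose Suc i) * G (l - i) t * D (Suc i) t)"
          by (simp add: sum.distrib[symmetric] algebra_simps)
        also have "\<dots> = (\<Sum>i\<le>Suc l. real (Suc l choose i) * G (Suc l - i) t * D i t)"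
          unfolding sum.atMost_Suc_shift by simp
        finally have "(\<Sum>i\<le>l. real (l choose i) * G (Suc (l - i)) t * D i t + real (l choose i) * G (l - i) t * D (Suc i) t)
          = (\<Sum>i\<le>m. real (m choose i) * G (m - i) t * D i t)" by (simp only: Suc)
        note der = der[unfolded this]
        have "G (Suc m) t = (\<Sum>i\<le>m. real (m choose i) * G (m - i) t * D i t)"
          using DERIV_imp_deriv[OF der] by (simp only: GS)
        with der show "(G m has_field_derivative G (Suc m) t) (at t) \<and> G (Suc m) t = (\<Sum>i\<le>m. real (m choose i) * G (m - i) t * D i t)"
          by simp
      qed
    qed
  qed
  with t show "(deriv ^^ Suc m) f t = (\<Sum>i\<le>m. real (m choose i) * (deriv ^^ (m - i)) f t * D i t)"
    by (auto simp: G_def)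
qed

lemma filterlim_ln_real_at_top: "filterlim (\<lambda>n. ln (real n)) at_top sequentially"
  by (rule filterlim_compose[OF ln_at_top filterlim_real_sequentially])

lemma eventually_ln_real_pos: "\<forall>\<^sub>F n in sequentially. ln (real n) > 0"
  using eventually_gt_at_top[of 1] by eventually_elim simp

lemma bounded_over_ln_power:
  assumes "\<forall>\<^sub>F n in sequentially. \<bar>f n\<bar> \<le> (C::real)" "k \<ge> 1"
  shows "(\<lambda>n. f n / ln (real n) ^ k) \<longlonglongrightarrow> 0"
proof (rule Lim_null_comparison)
  have "filterlim (\<lambda>n. ln (real n) ^ k) at_top sequentially"
    using assms(2) by (intro filterlim_pow_at_top filterlim_ln_real_at_top) auto
  then show "(\<lambda>n. C / ln (real n) ^ k) \<longlonglongrightarrow> 0"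
    by (intro real_tendsto_divide_at_top[OF tendsto_const])
  show "\<forall>\<^sub>F n in sequentially. norm (f n / ln (real n) ^ k) \<le> C / ln (real n) ^ k"
    using assms(1) eventually_ln_real_pos by eventually_elim (simp add: divide_right_mono power_abs)
qed

text \<open>At order 0 the two Digamma terms in n contribute - ln n each. At higher orders all terms
  are bounded, so division by a power of ln n removes them.\<close>

lemma beta_log_deriv_tendsto:
  assumes "\<phi> > 0"
  shows "(\<lambda>n. beta_log_deriv n i \<phi> / ln (real n) ^ Suc i) \<longlonglongrightarrow> (if i = 0 then - 2 else 0)"
proof (cases "i = 0")
  case True
  obtain C1 where C1: "\<And>n. real n \<ge> \<bar>- \<phi>\<bar> + 2 \<Longrightarrow> \<bar>Digamma (real n + - \<phi>) - ln (real n)\<bar> \<le> C1"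
    using Digamma_minus_ln_bounded by blast
  obtain C2 where C2: "\<And>n. real n \<ge> \<bar>\<phi> + 1\<bar> + 2 \<Longrightarrow> \<bar>Digamma (real n + (\<phi> + 1)) - ln (real n)\<bar> \<le> C2"
    using Digamma_minus_ln_bounded by blast
  have "\<forall>\<^sub>F n in sequentially. real n \<ge> \<phi> + 3"
    by (rule eventually_compose_filterlim[OF eventually_ge_at_top filterlim_real_sequentially])
  then have "\<forall>\<^sub>F n in sequentially. \<bar>beta_log_deriv n 0 \<phi> + 2 * ln (real n)\<bar> \<le> 2 * \<bar>Digamma (2 * \<phi> + 1)\<bar> + C1 + C2"
  proof eventually_elim
    case (elim n)
    have "\<bar>Digamma (real n - \<phi>) - ln (real n)\<bar> \<le> C1" "\<bar>Digamma (real n + \<phi> + 1) - ln (real n)\<bar> \<le> C2"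
      using C1[of n] C2[of n] elim assms by (auto simp: add_ac)
    then show ?case unfolding beta_log_deriv_def power_Suc power_0 by linarith
  qed
  from bounded_over_ln_power[OF this, of 1]
  have "(\<lambda>n. (beta_log_deriv n 0 \<phi> + 2 * ln (real n)) / ln (real n) - 2) \<longlonglongrightarrow> 0 - 2"
    by (intro tendsto_intros) simp
  moreover have "\<forall>\<^sub>F n in sequentially. (beta_log_deriv n 0 \<phi> + 2 * ln (real n)) / ln (real n) - 2 = beta_log_deriv n 0 \<phi> / ln (real n)"
    using eventually_ln_real_pos by eventually_elim (simp add: field_simps)
  ultimately have "(\<lambda>n. beta_log_deriv n 0 \<phi> / ln (real n)) \<longlonglongrightarrow> - 2"
    using Lim_transform_eventually by fastforce
  then show ?thesis using True by simp
next
  case False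
  have "\<forall>\<^sub>F n in sequentially. real n \<ge> \<phi> + 1"
    by (rule eventually_compose_filterlim[OF eventually_ge_at_top filterlim_real_sequentially])
  then have "\<forall>\<^sub>F n in sequentially. \<bar>beta_log_deriv n i \<phi>\<bar> \<le> \<bar>2 ^ Suc i * Polygamma i (2 * \<phi> + 1)\<bar> + \<bar>Polygamma i 1\<bar> + \<bar>Polygamma i 1\<bar>"
  proof eventually_elim
    case (elim n)
    have "\<bar>Polygamma i (real n - \<phi>)\<bar> \<le> \<bar>Polygamma i 1\<bar>" "\<bar>Polygamma i (real n + \<phi> + 1)\<bar> \<le> \<bar>Polygamma i 1\<bar>"
      using elim assms False by (auto intro!: abs_Polygamma_le)
    moreover have "\<bar>(-1) ^ i * Polygamma i (real n - \<phi>)\<bar> = \<bar>Polygamma i (real n - \<phi>)\<bar>"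
      by (simp add: abs_mult)
    ultimately show ?case unfolding beta_log_deriv_def by linarith
  qed
  from bounded_over_ln_power[OF this, of "Suc i"] show ?thesis using False by simp
qed

text \<open>Dividing by the Beta factor leaves only logarithmic growth in n; the decay of the Beta
  factor is compensated separately by \<open>n powr (2 * \<phi> + 1)\<close>.\<close>

definition beta_deriv_ratio :: "real \<Rightarrow> nat \<Rightarrow> nat \<Rightarrow> real" where
  "beta_deriv_ratio \<phi> m n = (deriv ^^ m) (\<lambda>t. Beta (2 * t + 1) (real n - t)) \<phi> / Beta (2 * \<phi> + 1) (real n - \<phi>)"

lemma Beta_shift_pos: "0 < \<phi> \<Longrightarrow> \<phi> < real n \<Longrightarrow> Beta (2 * \<phi> + 1) (real n - \<phi>) > (0::real)"
  by (simp add: Beta_def Gamma_real_pos)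

lemma beta_deriv_ratio_Suc:
  assumes "\<phi> > 0" "real n > \<phi>"
  shows "beta_deriv_ratio \<phi> (Suc m) n = (\<Sum>i\<le>m. real (m choose i) * beta_deriv_ratio \<phi> (m - i) n * beta_log_deriv n i \<phi>)"
proof -
  have "(deriv ^^ Suc m) (\<lambda>t. Beta (2 * t + 1) (real n - t)) \<phi> =
    (\<Sum>i\<le>m. real (m choose i) * (deriv ^^ (m - i)) (\<lambda>t. Beta (2 * t + 1) (real n - t)) \<phi> * beta_log_deriv n i \<phi>)"
    by (rule higher_deriv_log_deriv[of "{0<..<real n}"])
       (use assms in \<open>auto intro!: has_field_derivative_Beta_shift has_field_derivative_beta_log_deriv\<close>)
  then show ?thesis unfolding beta_deriv_ratio_def by (simp only: sum_divide_distrib) (simp add: mult_ac)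
qed

text \<open>After division by ln^m n only the summand i = 0 of the Leibniz formula survives, and
  each differentiation contributes the factor -2.\<close>

lemma beta_deriv_ratio_tendsto:
  assumes "\<phi> > 0"
  shows "(\<lambda>n. beta_deriv_ratio \<phi> m n / ln (real n) ^ m) \<longlonglongrightarrow> (- 2) ^ m"
proof (induction m rule: less_induct)
  case (less m)
  have ev: "\<forall>\<^sub>F n in sequentially. real n > \<phi>"
    by (rule eventually_compose_filterlim[OF eventually_gt_at_top filterlim_real_sequentially])
  show ?case
  proof (cases m)
    case 0
    have "\<forall>\<^sub>F n in sequentially. beta_deriv_ratio \<phi> m n / ln (real n) ^ m = (-2) ^ m"
      using ev 
    proof eventually_elim
      case (elim n)
      then show ?case using Beta_shift_pos[OF assms elim] by (simp add: 0 beta_deriv_ratio_def)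
    qed
    then show ?thesis by (rule tendsto_eventually)
  next
    case (Suc l)
    have "(\<lambda>n. \<Sum>i\<le>l. real (l choose i) * (beta_deriv_ratio \<phi> (l - i) n / ln (real n) ^ (l - i)) * (beta_log_deriv n i \<phi> / ln (real n) ^ Suc i))
       \<longlonglongrightarrow> (\<Sum>i\<le>l. real (l choose i) * (- 2) ^ (l - i) * (if i = 0 then - 2 else 0))"
      using Suc by (intro tendsto_sum tendsto_mult tendsto_const less.IH beta_log_deriv_tendsto assms) auto
    also have "(\<Sum>i\<le>l. real (l choose i) * (- 2) ^ (l - i) * (if i = 0 then - 2 else 0)) = (- 2) ^ m"
      by (simp add: Suc sum.delta if_distrib cong: if_cong)
    finally show ?thesis
    proof (rule Lim_transform_eventually)
      show "\<forall>\<^sub>F n in sequentially. (\<Sum>i\<le>l. real (l choose i) * (beta_deriv_ratio \<phi> (l - i) n / ln (real n) ^ (l - i)) * (beta_log_deriv n i \<phi> / ln (real n) ^ Suc i))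
         = beta_deriv_ratio \<phi> m n / ln (real n) ^ m"
        using ev eventually_ln_real_pos
      proof eventually_elim
        case (elim n)
        have "ln (real n) ^ (l - i) * ln (real n) ^ Suc i = ln (real n) ^ m" if "i \<le> l" for i
          using that by (simp add: Suc flip: power_add power_Suc)
        then have "(\<Sum>i\<le>l. real (l choose i) * (beta_deriv_ratio \<phi> (l - i) n / ln (real n) ^ (l - i)) * (beta_log_deriv n i \<phi> / ln (real n) ^ Suc i))
          = (\<Sum>i\<le>l. real (l choose i) * beta_deriv_ratio \<phi> (l - i) n * beta_log_deriv n i \<phi> / ln (real n) ^ m)"
          by (intro sum.cong refl) (metis (no_types, lifting) atMost_iff times_divide_eq_left times_divide_eq_right times_divide_times_eq)
        also have "\<dots> = beta_deriv_ratio \<phi> m n / ln (real n) ^ m"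
          unfolding Suc beta_deriv_ratio_Suc[OF assms elim(1)] by (simp only: sum_divide_distrib)
        finally show ?case .
      qed
    qed
  qed
qed

text \<open>The quotient of the two Gamma values in n is controlled by the mean value theorem for
  \<open>ln_Gamma\<close> on an interval of length 2 \<phi> + 1, with slope Digamma z at most ln n +
  C. This length is the exponent of n being compensated.\<close>

lemma Beta_shift_lower_bound:
  assumes "\<phi> > 0"
  obtains c where "c > 0" "\<forall>\<^sub>F n in sequentially. c \<le> real n powr (2 * \<phi> + 1) * Beta (2 * \<phi> + 1) (real n - \<phi>)"
proof -
  obtain C where C: "\<And>n. real n \<ge> \<bar>\<phi> + 1\<bar> + 2 \<Longrightarrow> \<bar>Digamma (real n + (\<phi> + 1)) - ln (real n)\<bar> \<le> C"
    using Digamma_minus_ln_bounded by blast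
  have pos: "Gamma (2 * \<phi> + 1) > 0" using assms by (intro Gamma_real_pos) auto
  have ev: "\<forall>\<^sub>F n in sequentially. real n \<ge> \<phi> + 3"
    by (rule eventually_compose_filterlim[OF eventually_ge_at_top filterlim_real_sequentially])
  show ?thesis
  proof (rule that[of "Gamma (2 * \<phi> + 1) * exp (- ((2 * \<phi> + 1) * C))"])
    show "Gamma (2 * \<phi> + 1) * exp (- ((2 * \<phi> + 1) * C)) > 0" using pos by simp
    show "\<forall>\<^sub>F n in sequentially. Gamma (2 * \<phi> + 1) * exp (- ((2 * \<phi> + 1) * C)) \<le> real n powr (2 * \<phi> + 1) * Beta (2 * \<phi> + 1) (real n - \<phi>)"
      using ev
    proof eventually_elim
      case (elim n)
      have "\<exists>z>real n - \<phi>. z < real n + \<phi> + 1 \<and> ln_Gamma (real n + \<phi> + 1) - ln_Gamma (real n - \<phi>) = (real n + \<phi> + 1 - (real n - \<phi>)) * Digamma z"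
        using assms elim by (intro MVT2) (auto intro!: derivative_eq_intros)
      then obtain z where z: "z > real n - \<phi>" "z < real n + \<phi> + 1"
        "ln_Gamma (real n + \<phi> + 1) - ln_Gamma (real n - \<phi>) = (2 * \<phi> + 1) * Digamma z" by auto
      have "Digamma z \<le> Digamma (real n + \<phi> + 1)" using z elim by (intro Digamma_real_mono) auto
      also have "\<dots> \<le> ln (real n) + C" using C[of n] elim assms by (auto simp: add_ac)
      finally have "(2 * \<phi> + 1) * Digamma z \<le> (2 * \<phi> + 1) * (ln (real n) + C)"
        using assms by (intro mult_left_mono) auto
      then have "- ((2 * \<phi> + 1) * C) \<le> (2 * \<phi> + 1) * ln (real n) + (ln_Gamma (real n - \<phi>) - ln_Gamma (real n + \<phi> + 1))"
        using z(3) by (simp add: algebra_simps)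
      then have "exp (- ((2 * \<phi> + 1) * C)) \<le> exp ((2 * \<phi> + 1) * ln (real n) + (ln_Gamma (real n - \<phi>) - ln_Gamma (real n + \<phi> + 1)))"
        by simp
      also have "\<dots> = real n powr (2 * \<phi> + 1) * (Gamma (real n - \<phi>) / Gamma (real n + \<phi> + 1))"
        using elim assms by (simp add: exp_add exp_diff powr_def Gamma_real_pos_exp)
      finally have "Gamma (2 * \<phi> + 1) * exp (- ((2 * \<phi> + 1) * C)) \<le> Gamma (2 * \<phi> + 1) * (real n powr (2 * \<phi> + 1) * (Gamma (real n - \<phi>) / Gamma (real n + \<phi> + 1)))"
        using pos by (intro mult_left_mono) auto
      moreover have sum: "2 * \<phi> + 1 + (real n - \<phi>) = real n + \<phi> + 1" by simp
      ultimately show ?case unfolding Beta_def sum by (simp only: times_divide_eq_right mult_ac)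
    qed
  qed
qed

lemma eventually_ge_ln_power:
  assumes "(\<lambda>n. X n / ln (real n) ^ k) \<longlonglongrightarrow> L" "L \<noteq> (0::real)"
  obtains c where "c > 0" "\<forall>\<^sub>F n in sequentially. c * ln (real n) ^ k \<le> \<bar>X n\<bar>"
proof (rule that[of "\<bar>L\<bar> / 2"])
  have "(\<lambda>n. \<bar>X n / ln (real n) ^ k\<bar>) \<longlonglongrightarrow> \<bar>L\<bar>" by (intro tendsto_rabs assms)
  then have "\<forall>\<^sub>F n in sequentially. \<bar>L\<bar> / 2 < \<bar>X n / ln (real n) ^ k\<bar>"
    using assms(2) by (intro order_tendstoD(1)) auto
  then show "\<forall>\<^sub>F n in sequentially. \<bar>L\<bar> / 2 * ln (real n) ^ k \<le> \<bar>X n\<bar>"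
    using eventually_ln_real_pos
    by eventually_elim (simp add: abs_mult power_abs field_simps)
qed (use assms in auto)


section \<open>Lower bounds for the admissible forms of the slow factor\<close>

text \<open>The value depends only on the parity of N, so there are at most two nonzero moduli to
  bound from below. A vanishing one is replaced by 1 in the minimum.\<close>

lemma gamma3_lower_bound:
  obtains c where "c > 0" "\<And>N. gamma3 g N \<noteq> 0 \<Longrightarrow> c \<le> norm (gamma3 g N)"
proof -
  define a b where "a = norm (g (-1) + g 1)" and "b = norm (- g (-1) + g 1)"
  define c where "c = min (if a = 0 then 1 else a) (if b = 0 then 1 else b)"
  have "c > 0" by (auto simp: c_def a_def b_def)
  moreover have "c \<le> norm (gamma3 g N)" if "gamma3 g N \<noteq> 0" for N
  proof -
    have "norm (gamma3 g N) = a \<or> norm (gamma3 g N) = b"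
      by (cases "even N") (auto simp: gamma3_def a_def b_def)
    then show ?thesis using that by (auto simp: c_def)
  qed
  ultimately show ?thesis using that by blast
qed

lemma sin_phi_pi:
  assumes "\<phi> > (0::real)"
  shows "\<phi> \<notin> \<nat> \<Longrightarrow> sin (\<phi> * pi) \<noteq> 0" "\<phi> \<in> \<nat> \<Longrightarrow> sin (\<phi> * pi) = 0" "\<phi> \<in> \<nat> \<Longrightarrow> cos (\<phi> * pi) \<noteq> 0"
proof -
  show "\<phi> \<notin> \<nat> \<Longrightarrow> sin (\<phi> * pi) \<noteq> 0"
    using assms by (auto simp: sin_times_pi_eq_0 Nats_altdef2)
  assume "\<phi> \<in> \<nat>"
  then obtain m where "\<phi> = real m" by (auto elim: Nats_cases)
  then show "sin (\<phi> * pi) = 0" "cos (\<phi> * pi) \<noteq> 0" by (simp_all add: mult.commute)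
qed

text \<open>The k-th summand has order at most ln^(\<theta> - k) n times the Beta factor, so the
  first k with nonzero trigonometric sum \<open>S k\<close> dominates. This is k = 0 with
  \<open>S 0 = sin (\<phi> * pi)\<close>, unless \<phi> is natural; then the sine vanishes and
  \<open>S 1 = pi * cos (\<phi> * pi)\<close> takes over. For the weight
  \<open>\<theta> choose k\<close>, \<open>w 1 = \<theta>\<close> is nonzero.\<close>

lemma factor_gen_lower_bound:
  assumes \<phi>: "\<phi> > 0" and "\<theta> \<ge> 1" and w: "w 0 \<noteq> 0" "w 1 \<noteq> 0"
  obtains c where "c > 0" "\<forall>\<^sub>F N in sequentially. c * log_order \<phi> \<theta> N * norm (gamma3 g N) \<le> norm (factor_gen w \<phi> \<theta> g N)"
proof -
  define S where "S k = (\<Sum>j\<le>k. real (k choose j) * pi ^ j * sin (real j / 2 * pi + \<phi> * pi) * ln (1 / 2) ^ (k - j))" for k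
  \<comment> \<open>The index of the dominant summand; \<open>\<theta> - k0\<close> is the exponent
    in \<open>log_order\<close>.\<close>
  define k0 where "k0 = (if \<phi> \<in> \<nat> then 1 else 0 :: nat)"
  have k0: "k0 \<le> \<theta>" "w k0 \<noteq> 0" using assms by (auto simp: k0_def)
  have lo: "log_order \<phi> \<theta> n = ln (real n) ^ (\<theta> - k0)" for n by (simp add: log_order_def k0_def)
  have S0: "S k = 0" if "k < k0" for k
    using that sin_phi_pi(2)[OF \<phi>] by (auto simp: k0_def S_def split: if_splits)
  have Sk0: "S k0 \<noteq> 0"
  proof (cases "\<phi> \<in> \<nat>")
    case True
    have "S 1 = sin (\<phi> * pi) * ln (1 / 2) + pi * cos (\<phi> * pi)"
      by (simp add: S_def sin_add)
    then show ?thesis using True sin_phi_pi[OF \<phi>] by (simp add: k0_def)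
  next
    case False
    then show ?thesis using sin_phi_pi[OF \<phi>] by (simp add: k0_def S_def)
  qed
  define Z where "Z n = (\<Sum>k\<le>\<theta>. w k * S k * beta_deriv_ratio \<phi> (\<theta> - k) n)" for n
  have "(\<lambda>n. Z n / ln (real n) ^ (\<theta> - k0)) \<longlonglongrightarrow> w k0 * S k0 * (- 2) ^ (\<theta> - k0)"
  proof -
    have "(\<lambda>n. w k * S k * beta_deriv_ratio \<phi> (\<theta> - k) n / ln (real n) ^ (\<theta> - k0))
       \<longlonglongrightarrow> (if k = k0 then w k0 * S k0 * (- 2) ^ (\<theta> - k0) else 0)" if "k \<le> \<theta>" for k
    proof (cases "k < k0")
      case True
      then show ?thesis using S0 by simp
    next
      case False
      have one: "(\<lambda>n. 1 / ln (real n) ^ (k - k0)) \<longlonglongrightarrow> (if k = k0 then 1 else 0)"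
        using False bounded_over_ln_power[of "\<lambda>n. 1" 1 "k - k0"] by auto
      have "(\<lambda>n. w k * S k * (beta_deriv_ratio \<phi> (\<theta> - k) n / ln (real n) ^ (\<theta> - k)) * (1 / ln (real n) ^ (k - k0)))
         \<longlonglongrightarrow> w k * S k * (- 2) ^ (\<theta> - k) * (if k = k0 then 1 else 0)"
        by (intro tendsto_mult tendsto_const beta_deriv_ratio_tendsto \<phi> one)
      moreover have "(\<theta> - k) + (k - k0) = \<theta> - k0" using False that by simp
      then have "ln (real n) ^ (\<theta> - k) * ln (real n) ^ (k - k0) = ln (real n) ^ (\<theta> - k0)" for n
        by (simp flip: power_add)
      then have "w k * S k * (beta_deriv_ratio \<phi> (\<theta> - k) n / ln (real n) ^ (\<theta> - k)) * (1 / ln (real n) ^ (k - k0))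
         = w k * S k * beta_deriv_ratio \<phi> (\<theta> - k) n / ln (real n) ^ (\<theta> - k0)" for n
        by simp
      ultimately have "(\<lambda>n. w k * S k * beta_deriv_ratio \<phi> (\<theta> - k) n / ln (real n) ^ (\<theta> - k0))
         \<longlonglongrightarrow> w k * S k * (- 2) ^ (\<theta> - k) * (if k = k0 then 1 else 0)"
        by (simp only:)
      then show ?thesis by (cases "k = k0") simp_all
    qed
    then have "(\<lambda>n. \<Sum>k\<le>\<theta>. w k * S k * beta_deriv_ratio \<phi> (\<theta> - k) n / ln (real n) ^ (\<theta> - k0))
       \<longlonglongrightarrow> (\<Sum>k\<le>\<theta>. if k = k0 then w k0 * S k0 * (- 2) ^ (\<theta> - k0) else 0)"
      by (intro tendsto_sum) auto
    then show ?thesis using k0 by (simp add: Z_def sum_divide_distrib)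
  qed
  then obtain c1 where c1: "c1 > 0" "\<forall>\<^sub>F n in sequentially. c1 * ln (real n) ^ (\<theta> - k0) \<le> \<bar>Z n\<bar>"
    by (rule eventually_ge_ln_power) (use k0 Sk0 in auto)
  obtain c2 where c2: "c2 > 0" "\<forall>\<^sub>F n in sequentially. c2 \<le> real n powr (2 * \<phi> + 1) * Beta (2 * \<phi> + 1) (real n - \<phi>)"
    using Beta_shift_lower_bound[OF \<phi>] by blast
  have ev: "\<forall>\<^sub>F n in sequentially. real n > \<phi>"
    by (rule eventually_compose_filterlim[OF eventually_gt_at_top filterlim_real_sequentially])
  show ?thesis
  proof (rule that[of "2 / pi * (c2 * c1)"])
    show "2 / pi * (c2 * c1) > 0" using c1 c2 by simp
    show "\<forall>\<^sub>F N in sequentially. 2 / pi * (c2 * c1) * log_order \<phi> \<theta> N * norm (gamma3 g N) \<le> norm (factor_gen w \<phi> \<theta> g N)"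
      using c1(2) c2(2) ev eventually_ln_real_pos
    proof eventually_elim
      case (elim n)
      define b where "b = Beta (2 * \<phi> + 1) (real n - \<phi>)"
      have b: "b > 0" using Beta_shift_pos[OF \<phi> elim(3)] by (simp add: b_def)
      have "(\<Sum>k\<le>\<theta>. w k * (\<Sum>j\<le>k. real (k choose j) * pi ^ j * sin (real j / 2 * pi + \<phi> * pi) * ln (1 / 2) ^ (k - j)
           * (deriv ^^ (\<theta> - k)) (\<lambda>t. Beta (2 * t + 1) (real n - t)) \<phi>)) = b * Z n"
      proof -
        have "(deriv ^^ m) (\<lambda>t. Beta (2 * t + 1) (real n - t)) \<phi> = b * beta_deriv_ratio \<phi> m n" for m
          using b by (simp add: beta_deriv_ratio_def b_def)
        then show ?thesis
          by (simp add: Z_def S_def sum_distrib_left sum_distrib_right mult_ac)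
      qed
      then have fg: "norm (factor_gen w \<phi> \<theta> g n) = 2 / pi * norm (gamma3 g n) * ((real n powr (2 * \<phi> + 1) * b) * \<bar>Z n\<bar>)"
        unfolding factor_gen_def norm_mult norm_minus_cancel norm_of_real using b by (simp add: abs_mult)
      have "2 / pi * norm (gamma3 g n) * (c2 * (c1 * ln (real n) ^ (\<theta> - k0))) \<le> 2 / pi * norm (gamma3 g n) * ((real n powr (2 * \<phi> + 1) * b) * \<bar>Z n\<bar>)"
        using elim c1 c2 b by (intro mult_left_mono mult_mono) (auto simp: b_def)
      then show ?case unfolding fg lo by (simp add: mult_ac)
    qed
  qed
qed

lemma gamma1_over_ln_tendsto:
  assumes "\<phi> > 0"
  shows "(\<lambda>n. (gamma1 \<phi> n - ln 2) / ln (real n)) \<longlonglongrightarrow> - 2"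
proof -
  have "(\<lambda>n. beta_log_deriv n 0 \<phi> / ln (real n) ^ Suc 0 - ln 2 / ln (real n) ^ 1) \<longlonglongrightarrow> (if (0::nat) = 0 then - 2 else 0) - 0"
    by (intro tendsto_diff beta_log_deriv_tendsto assms bounded_over_ln_power[of _ "ln 2"]) auto
  then show ?thesis by (simp add: gamma1_eq diff_divide_distrib)
qed

text \<open>The two explicit expressions share their prefactor. They differ in the real factor X,
  for which a nonzero limit relative to \<open>log_order\<close> is all that is asked.\<close>

lemma factor_one_two_lower_bound:
  assumes \<phi>: "\<phi> > 0"
    and A: "\<And>N. A N = - of_real (2 * Gamma (2 * \<phi> + 1) / pi) * gamma3 g N * of_real (X N)"
    and X: "(\<lambda>n. X n / log_order \<phi> \<theta> n) \<longlonglongrightarrow> L" "L \<noteq> 0"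
  obtains c where "c > 0" "\<forall>\<^sub>F N in sequentially. c * log_order \<phi> \<theta> N * norm (gamma3 g N) \<le> norm (A N)"
proof -
  obtain c where c: "c > 0" "\<forall>\<^sub>F n in sequentially. c * log_order \<phi> \<theta> n \<le> \<bar>X n\<bar>"
    using eventually_ge_ln_power[OF X[unfolded log_order_def]] unfolding log_order_def by blast
  have G: "Gamma (2 * \<phi> + 1) > 0" using \<phi> by (intro Gamma_real_pos) auto
  show ?thesis
  proof (rule that[of "2 * Gamma (2 * \<phi> + 1) / pi * c"])
    show "2 * Gamma (2 * \<phi> + 1) / pi * c > 0" using c G by simp
    show "\<forall>\<^sub>F N in sequentially. 2 * Gamma (2 * \<phi> + 1) / pi * c * log_order \<phi> \<theta> N * norm (gamma3 g N) \<le> norm (A N)"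
      using c(2)
    proof eventually_elim
      case (elim N)
      have "norm (A N) = 2 * Gamma (2 * \<phi> + 1) / pi * norm (gamma3 g N) * \<bar>X N\<bar>"
        unfolding A norm_mult norm_minus_cancel norm_of_real using G by simp
      moreover have "2 * Gamma (2 * \<phi> + 1) / pi * norm (gamma3 g N) * (c * log_order \<phi> \<theta> N) \<le> 2 * Gamma (2 * \<phi> + 1) / pi * norm (gamma3 g N) * \<bar>X N\<bar>"
        using elim G by (intro mult_left_mono) auto
      ultimately show ?case by (simp add: mult_ac)
    qed
  qed
qed

lemma slow_factor_lower_bound:
  assumes \<phi>: "\<phi> > 0" and \<theta>: "\<theta> \<ge> 1" and A: "is_slow_factor \<phi> \<theta> g A"
  obtains c where "c > 0" "\<forall>\<^sub>F N in sequentially. gamma3 g N \<noteq> 0 \<longrightarrow> c * log_order \<phi> \<theta> N \<le> norm (A N)"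
proof -
  have "\<exists>c>0. \<forall>\<^sub>F N in sequentially. c * log_order \<phi> \<theta> N * norm (gamma3 g N) \<le> norm (A N)"
    using A unfolding is_slow_factor_def
  proof (elim disjE conjE)
    assume "A = factor_gen (\<lambda>k. 1) \<phi> \<theta> g"
    then show ?thesis using factor_gen_lower_bound[OF \<phi> \<theta>, of "\<lambda>k. 1" g] by auto
  next
    assume "A = factor_gen (\<lambda>k. real (\<theta> choose k)) \<phi> \<theta> g"
    then show ?thesis using factor_gen_lower_bound[OF \<phi> \<theta>, of "\<lambda>k. real (\<theta> choose k)" g] \<theta> by auto
  next
    assume 1: "\<theta> = 1" "A = factor_one \<phi> g"
    define X where "X n = (gamma1 \<phi> n - ln 2) * sin (\<phi> * pi) + pi * cos (\<phi> * pi)" for n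
    obtain L where "(\<lambda>n. X n / log_order \<phi> \<theta> n) \<longlonglongrightarrow> L" "L \<noteq> 0"
    proof (cases "\<phi> \<in> \<nat>")
      case True
      \<comment> \<open>The exponent in \<open>log_order\<close> is 0 here, and X is the constant pi
        * cos (\<phi> pi).\<close>
      then show ?thesis using sin_phi_pi[OF \<phi>] that[of "pi * cos (\<phi> * pi)"] by (simp add: X_def log_order_def 1)
    next
      case False
      have "(\<lambda>n. (gamma1 \<phi> n - ln 2) / ln (real n) * sin (\<phi> * pi) + pi * cos (\<phi> * pi) / ln (real n) ^ 1) \<longlonglongrightarrow> - 2 * sin (\<phi> * pi) + 0"
        by (intro tendsto_add tendsto_mult tendsto_const gamma1_over_ln_tendsto \<phi> bounded_over_ln_power[of _ "\<bar>pi * cos (\<phi> * pi)\<bar>"]) auto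
      then show ?thesis using False sin_phi_pi[OF \<phi>] that[of "- 2 * sin (\<phi> * pi)"]
        by (simp add: X_def log_order_def 1 add_divide_distrib)
    qed
    from factor_one_two_lower_bound[OF \<phi> _ this, of A g] show ?thesis
      by (auto simp: 1 factor_one_def X_def)
  next
    assume 2: "\<theta> = 2" "A = factor_two \<phi> g"
    define X where "X n = ((gamma1 \<phi> n)\<^sup>2 + gamma2 \<phi> n - 2 * ln 2 * gamma1 \<phi> n + (ln 2)\<^sup>2 - pi\<^sup>2) * sin (\<phi> * pi)
              + 2 * pi * (gamma1 \<phi> n - ln 2) * cos (\<phi> * pi)" for n
    obtain L where "(\<lambda>n. X n / log_order \<phi> \<theta> n) \<longlonglongrightarrow> L" "L \<noteq> 0"
    proof (cases "\<phi> \<in> \<nat>")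
      case True
      \<comment> \<open>The sine vanishes and the cosine term, of order ln n, is left.\<close>
      have "(\<lambda>n. 2 * pi * ((gamma1 \<phi> n - ln 2) / ln (real n)) * cos (\<phi> * pi)) \<longlonglongrightarrow> 2 * pi * - 2 * cos (\<phi> * pi)"
        by (intro tendsto_mult tendsto_const gamma1_over_ln_tendsto \<phi>)
      then show ?thesis using True sin_phi_pi[OF \<phi>] that[of "2 * pi * - 2 * cos (\<phi> * pi)"]
        by (simp add: X_def log_order_def 2)
    next
      case False
      \<comment> \<open>Completing the square joins the terms in \<open>gamma1\<close> and
        \<open>ln 2\<close> to \<open>(gamma1 \<phi> n - ln 2)\<^sup>2\<close>, asymptotic to 4 ln^2
        n. The terms with \<open>gamma2\<close> and pi^2 and the cosine term are of lower
        order.\<close>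
      have "(\<lambda>n. (((gamma1 \<phi> n - ln 2) / ln (real n)) ^ 2 + (gamma2 \<phi> n / ln (real n) ^ 2 - pi\<^sup>2 / ln (real n) ^ 2)) * sin (\<phi> * pi)
          + 2 * pi * ((gamma1 \<phi> n - ln 2) / ln (real n)) * cos (\<phi> * pi) * (1 / ln (real n) ^ 1)) \<longlonglongrightarrow>
          ((- 2) ^ 2 + (0 - 0)) * sin (\<phi> * pi) + 2 * pi * - 2 * cos (\<phi> * pi) * 0"
        using beta_log_deriv_tendsto[OF \<phi>, of 1]
        by (intro tendsto_add tendsto_mult tendsto_diff tendsto_power tendsto_const gamma1_over_ln_tendsto \<phi>
            bounded_over_ln_power[of "\<lambda>n. pi\<^sup>2" "pi\<^sup>2"] bounded_over_ln_power[of "\<lambda>n. 1" 1])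
           (auto simp: gamma2_eq numeral_2_eq_2)
      moreover have "\<forall>\<^sub>F n in sequentially. (((gamma1 \<phi> n - ln 2) / ln (real n)) ^ 2 + (gamma2 \<phi> n / ln (real n) ^ 2 - pi\<^sup>2 / ln (real n) ^ 2)) * sin (\<phi> * pi)
          + 2 * pi * ((gamma1 \<phi> n - ln 2) / ln (real n)) * cos (\<phi> * pi) * (1 / ln (real n) ^ 1) = X n / log_order \<phi> \<theta> n"
        using eventually_ln_real_pos
      proof eventually_elim
        case (elim n)
        have "X n = ((gamma1 \<phi> n - ln 2)\<^sup>2 + (gamma2 \<phi> n - pi\<^sup>2)) * sin (\<phi> * pi) + 2 * pi * (gamma1 \<phi> n - ln 2) * cos (\<phi> * pi)"
          by (simp add: X_def power2_diff algebra_simps)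
        moreover have "((a / l) ^ 2 + (b / l ^ 2 - p / l ^ 2)) * s + 2 * pi * (a / l) * c * (1 / l ^ 1)
          = ((a\<^sup>2 + (b - p)) * s + 2 * pi * a * c) / l ^ 2" if "l > 0" for a b p s c l :: real
          using that by (simp add: field_simps power2_eq_square)
        ultimately show ?case using elim False by (simp only: 2 log_order_def if_False)
      qed
      ultimately have "(\<lambda>n. X n / log_order \<phi> \<theta> n) \<longlonglongrightarrow> ((- 2) ^ 2 + (0 - 0)) * sin (\<phi> * pi) + 2 * pi * - 2 * cos (\<phi> * pi) * 0"
        by (rule Lim_transform_eventually)
      then show ?thesis using False sin_phi_pi[OF \<phi>] that[of "4 * sin (\<phi> * pi)"] by simp
    qed
    from factor_one_two_lower_bound[OF \<phi> _ this, of A g] show ?thesis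
      by (auto simp: 2 factor_two_def X_def)
  qed
  then obtain c where c: "c > 0" "\<forall>\<^sub>F N in sequentially. c * log_order \<phi> \<theta> N * norm (gamma3 g N) \<le> norm (A N)" by blast
  obtain c3 where c3: "c3 > 0" "\<And>N. gamma3 g N \<noteq> 0 \<Longrightarrow> c3 \<le> norm (gamma3 g N)"
    using gamma3_lower_bound by blast
  show ?thesis
  proof (rule that[of "c * c3"])
    show "c * c3 > 0" using c c3 by simp
    show "\<forall>\<^sub>F N in sequentially. gamma3 g N \<noteq> 0 \<longrightarrow> c * c3 * log_order \<phi> \<theta> N \<le> norm (A N)"
      using c(2) eventually_ln_real_pos
    proof eventually_elim
      case (elim N)
      have "c * log_order \<phi> \<theta> N * c3 \<le> c * log_order \<phi> \<theta> N * norm (gamma3 g N)" if "gamma3 g N \<noteq> 0"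
        using c c3 elim that by (intro mult_left_mono) (auto simp: log_order_def)
      then show ?case using elim by (auto simp: mult_ac)
    qed
  qed
qed

section \<open>Decay of the coefficients and the truncation errors of u\<close>

text \<open>In sin t = 2 sin (t/2) cos (t/2) the mean value theorem replaces sin (t/2) by (t/2) cos
  z. Both cosines are taken on [0, pi/4] and are at least sqrt 2 / 2.\<close>

lemma sin_ge_half:
  assumes "0 \<le> t" "t \<le> pi / 2"
  shows "t / 2 \<le> sin (t::real)"
proof (cases "t = 0")
  case False
  have "\<exists>z>0. z < t / 2 \<and> sin (t / 2) - sin 0 = (t / 2 - 0) * cos z"
    using assms False by (intro MVT2) (auto intro!: derivative_eq_intros)
  then obtain z where z: "z > 0" "z < t / 2" "sin (t / 2) = t / 2 * cos z" by auto
  have c: "sqrt 2 / 2 \<le> cos x" if "0 \<le> x" "x \<le> pi / 4" for x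
    using cos_monotone_0_pi_le[of x "pi / 4"] that by (simp add: cos_45)
  have "t / 2 = 2 * (t / 2 * (sqrt 2 / 2)) * (sqrt 2 / 2)" by simp
  also have "\<dots> \<le> 2 * sin (t / 2) * cos (t / 2)"
    unfolding z(3) using assms z by (intro mult_mono mult_left_mono c) (auto intro!: mult_nonneg_nonneg cos_ge_zero)
  also have "\<dots> = sin t" using sin_double[of "t / 2"] by simp
  finally show ?thesis .
qed simp

text \<open>Nonpositive powers of sin t may blow up at both ends. Each half of the interval is
  controlled by one summand, by the symmetry t -> pi - t.\<close>

lemma sin_powr_le:
  assumes "0 < t" "t < pi" "a \<le> 0"
  shows "sin t powr a \<le> 2 powr (- a) * (t powr a + (pi - t) powr a)"
proof -
  have *: "sin s powr a \<le> 2 powr (- a) * s powr a" if "0 < s" "s \<le> pi / 2" for s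
  proof -
    have "sin s powr a \<le> (s / 2) powr a"
      using that sin_ge_half[of s] assms by (intro powr_mono2') auto
    also have "\<dots> = 2 powr (- a) * s powr a" using that by (simp add: powr_divide powr_minus_divide)
    finally show ?thesis .
  qed
  show ?thesis
  proof (cases "t \<le> pi / 2")
    case True
    have "sin t powr a \<le> 2 powr (- a) * t powr a" using True assms by (intro *) auto
    also have "\<dots> \<le> 2 powr (- a) * (t powr a + (pi - t) powr a)" by (intro mult_left_mono) auto
    finally show ?thesis .
  next
    case False
    have "sin (pi - t) powr a \<le> 2 powr (- a) * (pi - t) powr a" using False assms by (intro *) auto
    also have "\<dots> \<le> 2 powr (- a) * (t powr a + (pi - t) powr a)" by (intro mult_left_mono) auto
    finally show ?thesis by simp
  qed
qed

lemma integrable_on_reflected_powr: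
  assumes "a > - 1"
  shows "(\<lambda>t. (pi - t) powr a) integrable_on {0..pi}"
proof -
  have "((\<lambda>t. (pi - t) powr a) has_integral (- ((pi - pi) powr (a + 1) / (a + 1)) - - ((pi - 0) powr (a + 1) / (a + 1)))) {0..pi}"
    using assms
  proof (intro fundamental_theorem_of_calculus_interior[where f = "\<lambda>t. - ((pi - t) powr (a + 1) / (a + 1))"])
    show "continuous_on {0..pi} (\<lambda>t. - ((pi - t) powr (a + 1) / (a + 1)))"
      using assms by (intro continuous_on_minus continuous_on_divide continuous_on_powr' continuous_intros) auto
    show "((\<lambda>t. - ((pi - t) powr (a + 1) / (a + 1))) has_vector_derivative (pi - t) powr a) (at t)"
      if "t \<in> {0<..<pi}" for t
      unfolding has_real_derivative_iff_has_vector_derivative[symmetric]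
      using that assms by (auto intro!: derivative_eq_intros)
  qed simp
  then show ?thesis by blast
qed

text \<open>The preimage under cos of an open domain of g is an open neighbourhood of the compact
  segment [0, pi], hence contains a closed strip of positive height around it.\<close>

lemma analytic_strip:
  assumes "g analytic_on (complex_of_real ` {-1..1})"
  obtains \<eta> where "\<eta> > 0"
    "\<And>z. 0 \<le> Re z \<Longrightarrow> Re z \<le> pi \<Longrightarrow> \<bar>Im z\<bar> \<le> \<eta> \<Longrightarrow> g field_differentiable at (cos z)"
proof -
  obtain S where S: "open S" "complex_of_real ` {-1..1} \<subseteq> S" "g holomorphic_on S"
    using assms analytic_on_holomorphic by metis
  have "compact (complex_of_real ` {0..pi})" by (intro compact_continuous_image continuous_intros) auto
  moreover have "open (cos -` S)" using S(1) by (intro open_vimage continuous_intros)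
  moreover have "complex_of_real ` {0..pi} \<subseteq> cos -` S" by (auto simp: cos_of_real intro!: subsetD[OF S(2)])
  ultimately obtain e where e: "e > 0" "(\<Union>x\<in>complex_of_real ` {0..pi}. ball x e) \<subseteq> cos -` S"
    by (rule compact_subset_open_imp_ball_epsilon_subset)
  show ?thesis
  proof (rule that[of "e / 2"])
    fix z assume z: "0 \<le> Re z" "Re z \<le> pi" "\<bar>Im z\<bar> \<le> e / 2"
    have "of_real (Re z) - z = - (\<i> * of_real (Im z))" by (simp add: complex_eq_iff)
    then have "dist (of_real (Re z)) z = \<bar>Im z\<bar>" by (simp add: dist_norm norm_mult)
    then have "z \<in> ball (of_real (Re z)) e" using z e by simp
    then have "z \<in> (\<Union>x\<in>complex_of_real ` {0..pi}. ball x e)" using z by auto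
    then have "cos z \<in> S" using e(2) by blast
    then show "g field_differentiable at (cos z)"
      using S holomorphic_on_imp_differentiable_at by blast
  qed (use e in simp)
qed

lemma u_eq_log_branch:
  fixes u :: "real \<Rightarrow> complex"
  assumes "\<And>x. -1 < x \<Longrightarrow> x < 1 \<Longrightarrow>
           u x = g (of_real x) * of_real ((1 - x\<^sup>2) powr \<phi> * ln (1 - x\<^sup>2) ^ \<theta>)"
    and "u (-1) = 0" "u 1 = 0" and x: "x \<in> {-1..1}"
  shows "u x = g (of_real x) * log_branch \<phi> \<theta> (of_real (sqrt (1 - x\<^sup>2)))"
proof (cases "x = 1 \<or> x = -1")
  case False
  then have x': "-1 < x" "x < 1" using x by auto
  then have "x\<^sup>2 < 1" by (simp add: abs_square_less_1)
  then have "sqrt (1 - x\<^sup>2) > 0" "(sqrt (1 - x\<^sup>2))\<^sup>2 = 1 - x\<^sup>2" by auto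
  then show ?thesis using assms(1)[OF x'] log_branch_of_real[of "sqrt (1 - x\<^sup>2)" \<phi> \<theta>] by simp
qed (use assms in auto)

context
  fixes \<phi> :: real and \<theta> :: nat and g :: "complex \<Rightarrow> complex" and u :: "real \<Rightarrow> complex"
  assumes \<phi>: "\<phi> > 1 / 2"
    and g: "g analytic_on (complex_of_real ` {-1..1})"
    and u: "\<And>x. x \<in> {-1..1} \<Longrightarrow> u x = g (of_real x) * log_branch \<phi> \<theta> (of_real (sqrt (1 - x\<^sup>2)))"
begin

lemma u_cos: "t \<in> {0..pi} \<Longrightarrow> u (cos t) = g (of_real (cos t)) * log_branch \<phi> \<theta> (of_real (sin t))"
  using u[of "cos t"] sin_ge_zero[of t] by (simp flip: sin_squared_eq)

lemma g_continuous: "continuous_on {-1..1} (\<lambda>x. g (of_real x))"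
  by (rule continuous_on_compose2[OF holomorphic_on_imp_continuous_on[OF analytic_imp_holomorphic[OF g]]])
     (auto intro!: continuous_intros)

lemma u_continuous: "continuous_on {-1..1} u"
proof -
  have "continuous_on {-1..1} (\<lambda>x. g (of_real x) * log_branch \<phi> \<theta> (of_real (sqrt (1 - x\<^sup>2))))"
  proof (intro continuous_on_mult g_continuous)
    show "continuous_on {-1..1} (\<lambda>x. log_branch \<phi> \<theta> (of_real (sqrt (1 - x\<^sup>2))))"
    proof (rule continuous_on_compose2[OF continuous_on_log_branch, where f = "\<lambda>x. complex_of_real (sqrt (1 - x\<^sup>2))"])
      show "(\<lambda>x. complex_of_real (sqrt (1 - x\<^sup>2))) ` {-1..1} \<subseteq> {w. w = 0 \<or> w \<notin> \<real>\<^sub>\<le>\<^sub>0}"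
      proof (rule image_subsetI)
        fix x :: real assume "x \<in> {-1..1}"
        then have "x\<^sup>2 \<le> 1" by (simp add: abs_square_le_1 abs_le_iff)
        then have "sqrt (1 - x\<^sup>2) \<ge> 0" by simp
        then show "complex_of_real (sqrt (1 - x\<^sup>2)) \<in> {w. w = 0 \<or> w \<notin> \<real>\<^sub>\<le>\<^sub>0}"
          by (cases "sqrt (1 - x\<^sup>2) = 0") auto
      qed
    qed (use \<phi> in \<open>auto intro!: continuous_intros\<close>)
  qed
  then show ?thesis by (rule continuous_on_eq) (simp add: u)
qed

text \<open>In the variable t the function is bounded by sin t to the power 2 \<phi> - 2 times
  logarithms. As \<phi> > 1/2 the exponent exceeds -1, and part of the excess pays for the
  logarithms.\<close>

lemma v_absolutely_integrable: "(\<lambda>t. u (cos t) / of_real (1 - (cos t)\<^sup>2)) absolutely_integrable_on {0..pi}"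
proof -
  \<comment> \<open>Half of the excess 2 \<phi> - 1 ensures
    \<open>2 * \<phi> - 2 - \<epsilon> \<ge> \<epsilon> - 1 = a\<close>, so that a > -1 still holds;
    the cap 1/2 keeps a nonpositive, as \<open>sin_powr_le\<close> requires.\<close>
  define \<epsilon> where "\<epsilon> = min ((2 * \<phi> - 1) / 2) (1 / 2)"
  have "\<epsilon> \<le> (2 * \<phi> - 1) / 2" unfolding \<epsilon>_def by (rule min.cobounded1)
  then have \<epsilon>: "\<epsilon> > 0" "\<epsilon> \<le> 1 / 2" "2 * \<epsilon> \<le> 2 * \<phi> - 1" using \<phi> by (auto simp: \<epsilon>_def)
  define a where "a = \<epsilon> - 1"
  have a: "a > -1" "a \<le> 0" using \<epsilon> by (auto simp: a_def)
  obtain C where C: "C > 0" "\<And>r. r > 0 \<Longrightarrow> (1 + \<bar>ln r\<bar>) ^ \<theta> \<le> C * (r powr \<epsilon> + r powr (- \<epsilon>))"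
    using one_plus_ln_power_le[OF \<epsilon>(1)] by blast
  obtain B where B: "B > 0" "\<And>x. x \<in> {-1..1} \<Longrightarrow> norm (g (of_real x)) \<le> B"
    using compact_imp_bounded[OF compact_continuous_image[OF g_continuous]] by (auto simp: bounded_pos)
  define M where "M = B * (2 * pi) ^ \<theta> * C * 2 * 2 powr (- a)"
  have bound: "norm (u (cos t) / of_real (1 - (cos t)\<^sup>2)) \<le> M * (t powr a + (pi - t) powr a)" if t: "t \<in> {0<..<pi}" for t
  proof -
    define s where "s = sin t"
    have s: "0 < s" "s \<le> 1" using t by (auto simp: s_def sin_gt_zero)
    have "norm (u (cos t) / of_real (1 - (cos t)\<^sup>2)) = norm (g (of_real (cos t))) * norm (log_branch \<phi> \<theta> (of_real s)) / s powr 2"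
      using t s u_cos[of t] by (simp add: norm_divide norm_mult norm_power s_def flip: sin_squared_eq)
    also have "\<dots> \<le> B * ((2 * pi) ^ \<theta> * (norm (complex_of_real s) powr (2 * \<phi>) * (1 + \<bar>ln (norm (complex_of_real s))\<bar>) ^ \<theta>)) / s powr 2"
      using s B by (intro divide_right_mono mult_mono norm_log_branch_le B) auto
    also have "\<dots> \<le> B * ((2 * pi) ^ \<theta> * (s powr (2 * \<phi>) * (C * (s powr \<epsilon> + s powr (- \<epsilon>))))) / s powr 2"
      using s B C(2)[of s] by (intro divide_right_mono mult_left_mono) auto
    also have "\<dots> \<le> B * ((2 * pi) ^ \<theta> * (s powr (2 * \<phi>) * (C * (s powr (- \<epsilon>) + s powr (- \<epsilon>))))) / s powr 2"
      using s B C \<epsilon> by (intro divide_right_mono mult_left_mono add_right_mono powr_mono') auto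
    also have "\<dots> = B * (2 * pi) ^ \<theta> * C * 2 * s powr (2 * \<phi> - 2 - \<epsilon>)"
    proof -
      have "s powr (2 * \<phi>) * s powr (- \<epsilon>) / s powr 2 = s powr (2 * \<phi> - 2 - \<epsilon>)"
        by (simp add: algebra_simps flip: powr_add powr_diff)
      then have "B * (2 * pi) ^ \<theta> * C * 2 * (s powr (2 * \<phi>) * s powr (- \<epsilon>) / s powr 2) = B * (2 * pi) ^ \<theta> * C * 2 * s powr (2 * \<phi> - 2 - \<epsilon>)"
        by simp
      then show ?thesis by (simp add: mult_ac)
    qed
    also have "\<dots> \<le> B * (2 * pi) ^ \<theta> * C * 2 * s powr a"
      using s B C \<epsilon> by (intro mult_left_mono powr_mono') (auto simp: a_def)
    also have "\<dots> \<le> B * (2 * pi) ^ \<theta> * C * 2 * (2 powr (- a) * (t powr a + (pi - t) powr a))"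
      unfolding s_def using t B C a by (intro mult_left_mono sin_powr_le) auto
    finally show ?thesis by (simp add: M_def mult_ac)
  qed
  have int: "(\<lambda>t. M * (t powr a + (pi - t) powr a)) integrable_on {0..pi}"
    using a by (intro integrable_on_mult_right integrable_add integrable_on_powr_from_0 integrable_on_reflected_powr) auto
  have "(\<lambda>t. u (cos t) / of_real (1 - (cos t)\<^sup>2)) absolutely_integrable_on {0<..<pi}"
  proof (rule measurable_bounded_by_integrable_imp_absolutely_integrable)
    have "continuous_on {0<..<pi} (\<lambda>t. u (cos t) / of_real (1 - (cos t)\<^sup>2))"
    proof (intro continuous_intros)
      show "continuous_on {0<..<pi} (\<lambda>t. u (cos t))"
        by (rule continuous_on_compose2[OF u_continuous]) (auto intro!: continuous_intros)
      show "\<forall>t\<in>{0<..<pi}. complex_of_real (1 - (cos t)\<^sup>2) \<noteq> 0"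
      proof
        fix t assume "t \<in> {0<..<pi}"
        then have "sin t > 0" by (auto intro: sin_gt_zero)
        then have "1 - (cos t)\<^sup>2 \<noteq> 0" by (simp flip: sin_squared_eq)
        then show "complex_of_real (1 - (cos t)\<^sup>2) \<noteq> 0" unfolding of_real_eq_0_iff .
      qed
    qed
    then show "(\<lambda>t. u (cos t) / of_real (1 - (cos t)\<^sup>2)) \<in> borel_measurable (lebesgue_on {0<..<pi})"
      by (intro continuous_imp_measurable_on_sets_lebesgue) auto
    show "(\<lambda>t. M * (t powr a + (pi - t) powr a)) integrable_on {0<..<pi}"
      using int by (simp add: integrable_on_Icc_iff_Ioo)
  qed (use bound in auto)
  then show ?thesis
    by (rule absolutely_integrable_spike_set) (auto intro: negligible_subset[of "{0,pi}"])
qed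

lemma norm_cheb_coeff_le:
  obtains C where "\<And>n. n \<ge> 1 \<Longrightarrow> norm (cheb_coeff u n) \<le> C * log_weight (2 * \<phi> + 1) (log_exponent \<phi> \<theta>) n"
proof -
  obtain \<eta> where \<eta>: "\<eta> > 0"
    "\<And>z. 0 \<le> Re z \<Longrightarrow> Re z \<le> pi \<Longrightarrow> \<bar>Im z\<bar> \<le> \<eta> \<Longrightarrow> g field_differentiable at (cos z)"
    using analytic_strip[OF g] by blast
  have "\<phi> > 0" using \<phi> by simp
  then obtain C where C: "C > 0" "\<And>n. n \<ge> 1 \<Longrightarrow>
    norm (integral {0..pi} (\<lambda>t. of_real (cos (real n * t)) * (g (of_real (cos t)) * log_branch \<phi> \<theta> (of_real (sin t)))))
      \<le> C * log_weight (2 * \<phi> + 1) (log_exponent \<phi> \<theta>) n"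
    using cos_integral_le_log_weight[of \<phi> \<eta> g \<theta>] \<eta> by blast
  have "continuous_on {0..pi} (\<lambda>t. u (cos t))"
    by (rule continuous_on_compose2[OF u_continuous]) (auto intro!: continuous_intros)
  then have ai: "(\<lambda>t. u (cos t)) absolutely_integrable_on {0..pi}"
    by (rule absolutely_integrable_continuous_real)
  have "norm (cheb_coeff u n) \<le> (2 / pi * C) * log_weight (2 * \<phi> + 1) (log_exponent \<phi> \<theta>) n" if n: "n \<ge> 1" for n
  proof -
    have "integral {0..pi} (\<lambda>t. of_real (cos (real n * t)) * u (cos t)) =
      integral {0..pi} (\<lambda>t. of_real (cos (real n * t)) * (g (of_real (cos t)) * log_branch \<phi> \<theta> (of_real (sin t))))"
      by (intro integral_cong) (simp add: u_cos)
    then have "norm (cheb_coeff u n) = 2 / pi * norm (integral {0..pi} (\<lambda>t. of_real (cos (real n * t)) * (g (of_real (cos t)) * log_branch \<phi> \<theta> (of_real (sin t)))))"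
      using n by (simp add: cheb_coeff_eq_cos_integral[OF ai] norm_mult norm_divide)
    also have "\<dots> \<le> 2 / pi * (C * log_weight (2 * \<phi> + 1) (log_exponent \<phi> \<theta>) n)"
      by (intro mult_left_mono C n) auto
    finally show ?thesis by simp
  qed
  then show ?thesis by (rule that)
qed

end

text \<open>A bound along all N passes to the finer filter, along which \<open>gamma3\<close> is
  nonzero and the logarithmic order is at most 1 / c times the modulus of A.\<close>

lemma bigo_slow_factor:
  assumes "c > 0" "\<forall>\<^sub>F N in sequentially. gamma3 g N \<noteq> 0 \<longrightarrow> c * log_order \<phi> \<theta> N \<le> norm (A N)"
    and f: "f \<in> O(\<lambda>N. log_order \<phi> \<theta> N / real N powr q)"
  shows "f \<in> O[nondegenerate g](\<lambda>N. cmod (A N) / real N powr q)"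
proof (rule landau_o.big_trans)
  show "f \<in> O[nondegenerate g](\<lambda>N. log_order \<phi> \<theta> N / real N powr q)"
    by (rule landau_o.big.filter_mono[OF _ f]) (simp add: nondegenerate_def)
  have "\<forall>\<^sub>F N in nondegenerate g. norm (log_order \<phi> \<theta> N / real N powr q) \<le> 1 / c * norm (cmod (A N) / real N powr q)"
    unfolding nondegenerate_def eventually_inf_principal
    using assms(2) eventually_ln_real_pos
  proof eventually_elim
    case (elim N)
    have "log_order \<phi> \<theta> N \<ge> 0" using elim by (simp add: log_order_def)
    moreover have "log_order \<phi> \<theta> N / real N powr q \<le> 1 / c * norm (A N) / real N powr q" if "gamma3 g N \<noteq> 0"
      using elim(1) that assms(1) by (intro divide_right_mono) (auto simp: field_simps)
    ultimately show ?case by simp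
  qed
  then show "(\<lambda>N. log_order \<phi> \<theta> N / real N powr q) \<in> O[nondegenerate g](\<lambda>N. cmod (A N) / real N powr q)"
    by (rule bigoI)
qed

text \<open>The bounds by the explicit logarithmic order hold along all N and thus cover the indices
  left out by \<open>nondegenerate g\<close>. If g vanishes at both endpoints, that filter is
  trivial and these bounds carry the content.\<close>

theorem theorem2:
  fixes \<phi> :: real and \<theta> :: nat and g :: "complex \<Rightarrow> complex"
    and u :: "real \<Rightarrow> complex" and A :: "nat \<Rightarrow> complex"
  assumes "\<phi> > 1 / 2" and "\<theta> \<ge> 1"
    and "g analytic_on (complex_of_real ` {-1..1})"
    and "\<And>x. -1 < x \<Longrightarrow> x < 1 \<Longrightarrow>
           u x = g (of_real x) * of_real ((1 - x\<^sup>2) powr \<phi> * ln (1 - x\<^sup>2) ^ \<theta>)"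
    and "u (-1) = 0" and "u 1 = 0"
    and "is_slow_factor \<phi> \<theta> g A"
  shows
    "((\<lambda>N. max_err u (cheb_trunc u N)) \<in> O[nondegenerate g](\<lambda>N. cmod (A N) / real N powr (2 * \<phi>)) \<and>
      (\<lambda>N. max_err u (diff_trunc u N)) \<in> O[nondegenerate g](\<lambda>N. cmod (A N) / real N powr (2 * \<phi>)) \<and>
      (\<lambda>N. max_err u (quad_trunc u N)) \<in> O[nondegenerate g](\<lambda>N. cmod (A N) / real N powr (2 * \<phi> - 1))) \<and>
     ((\<lambda>N. max_err u (cheb_trunc u N)) \<in> O(\<lambda>N. log_order \<phi> \<theta> N / real N powr (2 * \<phi>)) \<and>
      (\<lambda>N. max_err u (diff_trunc u N)) \<in> O(\<lambda>N. log_order \<phi> \<theta> N / real N powr (2 * \<phi>)) \<and>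
      (\<lambda>N. max_err u (quad_trunc u N)) \<in> O(\<lambda>N. log_order \<phi> \<theta> N / real N powr (2 * \<phi> - 1)))"
proof -
  have u: "u x = g (of_real x) * log_branch \<phi> \<theta> (of_real (sqrt (1 - x\<^sup>2)))" if "x \<in> {-1..1}" for x
    by (rule u_eq_log_branch[OF assms(4-6) that])
  have v: "(\<lambda>t. u (cos t) / of_real (1 - (cos t)\<^sup>2)) absolutely_integrable_on {0..pi}"
    by (rule v_absolutely_integrable[OF assms(1,3) u])
  have c: "continuous_on {-1..1} u" by (rule u_continuous[OF assms(1,3) u])
  have lo: "log_order \<phi> \<theta> = (\<lambda>N. ln (real N) ^ log_exponent \<phi> \<theta>)"
    by (simp add: fun_eq_iff log_order_def log_exponent_def)
  obtain C where C: "\<And>n. n \<ge> 1 \<Longrightarrow> norm (cheb_coeff u n) \<le> C * log_weight (2 * \<phi> + 1) (log_exponent \<phi> \<theta>) n"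
    using norm_cheb_coeff_le[OF assms(1,3) u] by blast
  have p: "2 * \<phi> > 1" using assms(1) by simp
  obtain D where D:
    "\<And>N. N \<ge> 4 \<Longrightarrow> \<bar>max_err u (cheb_trunc u N)\<bar> \<le> D * log_weight (2 * \<phi>) (log_exponent \<phi> \<theta>) N"
    "\<And>N. N \<ge> 4 \<Longrightarrow> \<bar>max_err u (diff_trunc u N)\<bar> \<le> D * log_weight (2 * \<phi>) (log_exponent \<phi> \<theta>) N"
    "\<And>N. N \<ge> 4 \<Longrightarrow> \<bar>max_err u (quad_trunc u N)\<bar> \<le> D * log_weight (2 * \<phi> - 1) (log_exponent \<phi> \<theta>) N"
  proof (rule truncation_errors_le[OF v assms(6,5) p C c])
    fix D
    assume D:
      "\<And>N. N \<ge> 4 \<Longrightarrow> \<bar>max_err u (cheb_trunc u N)\<bar> \<le> D * log_weight (2 * \<phi>) (log_exponent \<phi> \<theta>) N"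
      "\<And>N. N \<ge> 4 \<Longrightarrow> \<bar>max_err u (diff_trunc u N)\<bar> \<le> D * log_weight (2 * \<phi>) (log_exponent \<phi> \<theta>) N"
      "\<And>N. N \<ge> 4 \<Longrightarrow> \<bar>max_err u (quad_trunc u N)\<bar> \<le> D * log_weight (2 * \<phi> - 1) (log_exponent \<phi> \<theta>) N"
    show thesis by (rule that[OF D])
  qed
  have O: "(\<lambda>N. max_err u (cheb_trunc u N)) \<in> O(\<lambda>N. log_order \<phi> \<theta> N / real N powr (2 * \<phi>))"
    "(\<lambda>N. max_err u (diff_trunc u N)) \<in> O(\<lambda>N. log_order \<phi> \<theta> N / real N powr (2 * \<phi>))"
    "(\<lambda>N. max_err u (quad_trunc u N)) \<in> O(\<lambda>N. log_order \<phi> \<theta> N / real N powr (2 * \<phi> - 1))"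
    unfolding lo using D by (blast intro: log_weight_bigo)+
  have "\<phi> > 0" using assms(1) by simp
  then obtain c where c: "c > 0" "\<forall>\<^sub>F N in sequentially. gamma3 g N \<noteq> 0 \<longrightarrow> c * log_order \<phi> \<theta> N \<le> norm (A N)"
    by (rule slow_factor_lower_bound[OF _ assms(2,7)])
  show ?thesis using O O[THEN bigo_slow_factor[OF c]] by blast
qed

end
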